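(* Let $G^P$ be a Sobolev-type metric on $\mathrm{Imm}(M,\mathbb R^n)$ given by an operator $P$ that is invariant under the action of the Euclidean motion group $\mathbb R^n\rtimes \mathrm{SO}(n)$. Then the linear momentum $$\int_M Pf_t\, \mathrm{vol}(g)\in(\mathbb R^n)^*$$ and the angular momentum $$\forall X\in \mathfrak{so}(n):\ \int_M \bar g( X.f,Pf_t )\, \mathrm{vol}(g),\qquad\text{or equivalently}\qquad \int_M (f\wedge Pf_t )\, \mathrm{vol}(g)\in\textstyle{\bigwedge^2}\mathbb R^n\cong \mathfrak{so}(n)^*,$$ are constant along any geodesic $f$ in $\mathrm{Imm}(M,\mathbb R^n)$. The operator $P=1+A \Delta^p$ (with a constant $A>0$) satisfies this invariance property.
   Context: $M$ is a compact connected smooth manifold without boundary, $\dim M\le n$; $\mathbb R^n$ carries the Euclidean metric $\bar g$. $\mathrm{Imm}=\mathrm{Imm}(M,\mathbb R^n)$ is the Fréchet manifold of smooth immersions, with $T_f\mathrm{Imm}=C^\infty(M,\mathbb R^n)$. For $f\in\mathrm{Imm}$: $g=f^*\bar g$, $\mathrm{vol}(g)$ is its volume density, $\Delta=\nabla^*\nabla$ is the Bochner-Laplacian on $\Gamma(f^*T\mathbb R^n)=C^\infty(M,\mathbb R^n)$ (nonnegative). The Euclidean motion group acts on $\mathrm{Imm}$ by composition from the left, and on tangent vectors by the tangent action. Standing assumptions on $P$: $P$ is a smooth section of $L(T\mathrm{Imm};T\mathrm{Imm})$ such that each $P_f$ is an elliptic pseudo-differential operator, symmetric and positive with respect to $\int_M\bar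 g(h,k)\,\mathrm{vol}(g)$; $P$ is $\mathrm{Diff}(M)$-invariant, $P_f(h)\circ\varphi=P_{f\circ\varphi}(h\circ\varphi)$; and there exists a smooth section $\mathrm{Adj}(\nabla P)$ of $L^2(T\mathrm{Imm};T\mathrm{Imm})$ with $\int_M\bar g((\nabla_mP)h,k)\,\mathrm{vol}(g)=\int_M\bar g(m,\mathrm{Adj}(\nabla P)(h,k))\,\mathrm{vol}(g)$, where $\nabla_mP$ is the derivative of $f\mapsto P_f$ in direction $m$. The Sobolev-type metric is $G^P_f(h,k)=\int_M\bar g(P_fh,k)\,\mathrm{vol}(g)$; geodesics are critical points of the energy $\frac12\int G^P_f(f_t,f_t)\,dt$ for fixed endpoints. *)

theory Defs
  imports "HOL-Analysis.Analysis"
begin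

section \<open>Calculus in coordinates\<close>

text \<open>The model space of a \<open>d\<close>-dimensional manifold is \<^term>\<open>Euclidean_space d\<close>, that is, the
  functions \<open>nat \<Rightarrow> real\<close> vanishing at all indices \<open>\<ge> d\<close>. This includes \<open>d = 0\<close>.\<close>

abbreviation coord_space :: "nat \<Rightarrow> (nat \<Rightarrow> real) set" where
  "coord_space d \<equiv> topspace (Euclidean_space d)"

definition coord_dot :: "nat \<Rightarrow> (nat \<Rightarrow> real) \<Rightarrow> (nat \<Rightarrow> real) \<Rightarrow> real" where
  "coord_dot d x y = (\<Sum>i<d. x i * y i)"

definition coord_norm :: "nat \<Rightarrow> (nat \<Rightarrow> real) \<Rightarrow> real" where
  "coord_norm d x = sqrt (coord_dot d x x)"

definition coord_lebesgue :: "nat \<Rightarrow> (nat \<Rightarrow> real) measure" where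
  "coord_lebesgue d =
     distr (Pi\<^sub>M {..<d} (\<lambda>_. lborel)) borel (\<lambda>y i. if i < d then y i else 0)"

definition partial_deriv ::
    "nat \<Rightarrow> ((nat \<Rightarrow> real) \<Rightarrow> 'b::real_normed_vector) \<Rightarrow> (nat \<Rightarrow> real) \<Rightarrow> 'b" where
  "partial_deriv i u x = vector_derivative (\<lambda>r. u (x(i := r))) (at (x i))"

primrec partial_derivs ::
    "nat list \<Rightarrow> ((nat \<Rightarrow> real) \<Rightarrow> 'b::real_normed_vector) \<Rightarrow> (nat \<Rightarrow> real) \<Rightarrow> 'b" where
  "partial_derivs [] u = u"
| "partial_derivs (i # js) u = partial_deriv i (partial_derivs js u)"

text \<open>\<open>C\<^sup>\<infinity>\<close> on a set \<open>V\<close> that is open in \<^term>\<open>Euclidean_space d\<close>: all iterated partial derivatives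
  exist and are continuous.\<close>

definition smooth_coord ::
    "nat \<Rightarrow> (nat \<Rightarrow> real) set \<Rightarrow> ((nat \<Rightarrow> real) \<Rightarrow> 'b::real_normed_vector) \<Rightarrow> bool" where
  "smooth_coord d V u \<longleftrightarrow>
     (\<forall>js. set js \<subseteq> {..<d} \<longrightarrow>
        continuous_on V (partial_derivs js u) \<and>
        (\<forall>i<d. \<forall>x\<in>V. (\<lambda>r. partial_derivs js u (x(i := r))) differentiable (at (x i))))"

definition test_function ::
    "nat \<Rightarrow> (nat \<Rightarrow> real) set \<Rightarrow> ((nat \<Rightarrow> real) \<Rightarrow> 'b::real_normed_vector) \<Rightarrow> bool" where
  "test_function d V u \<longleftrightarrow>
     smooth_coord d (coord_space d) u \<and>
     (\<exists>K. compact K \<and> K \<subseteq> V \<and> (\<forall>x\<in>coord_space d - K. u x = 0))"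

definition coord_det :: "nat \<Rightarrow> (nat \<Rightarrow> nat \<Rightarrow> real) \<Rightarrow> real" where
  "coord_det d G = (\<Sum>\<pi> | \<pi> permutes {..<d}. of_int (sign \<pi>) * (\<Prod>i<d. G i (\<pi> i)))"

definition coord_inverse :: "nat \<Rightarrow> (nat \<Rightarrow> nat \<Rightarrow> real) \<Rightarrow> nat \<Rightarrow> nat \<Rightarrow> real" where
  "coord_inverse d G =
     (SOME H. \<forall>i<d. \<forall>j<d. (\<Sum>k<d. H i k * G k j) = (if i = j then 1 else 0))"


section \<open>Closed manifolds and smooth functions on them\<close>

text \<open>A chart is a pair of its domain and its coordinate map; the values of the coordinate map
  outside the domain are irrelevant.\<close>

type_synonym 'a chart = "'a set \<times> ('a \<Rightarrow> nat \<Rightarrow> real)"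

record 'a manifold =
  mdim :: nat
  atlas :: "'a chart set"

definition chart_image :: "'a chart \<Rightarrow> (nat \<Rightarrow> real) set" where
  "chart_image c = snd c ` fst c"

definition chart_inv :: "'a chart \<Rightarrow> (nat \<Rightarrow> real) \<Rightarrow> 'a" where
  "chart_inv c = inv_into (fst c) (snd c)"

definition in_chart :: "'a chart \<Rightarrow> ('a \<Rightarrow> 'b) \<Rightarrow> (nat \<Rightarrow> real) \<Rightarrow> 'b" where
  "in_chart c u = u \<circ> chart_inv c"

definition is_chart :: "nat \<Rightarrow> 'a::topological_space chart \<Rightarrow> bool" where
  "is_chart d c \<longleftrightarrow>
     open (fst c) \<and> openin (Euclidean_space d) (chart_image c) \<and>
     homeomorphic_map (top_of_set (fst c)) (top_of_set (chart_image c)) (snd c)"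

definition smooth_transition :: "nat \<Rightarrow> 'a chart \<Rightarrow> 'a chart \<Rightarrow> bool" where
  "smooth_transition d c c' \<longleftrightarrow>
     (\<forall>j<d. smooth_coord d (snd c ` (fst c \<inter> fst c')) (in_chart c (\<lambda>p. snd c' p j)))"

definition compatible_charts :: "nat \<Rightarrow> 'a chart \<Rightarrow> 'a chart \<Rightarrow> bool" where
  "compatible_charts d c c' \<longleftrightarrow> smooth_transition d c c' \<and> smooth_transition d c' c"

text \<open>The underlying topological space is the whole type, which is required to be Hausdorff
  in the statements below; second countability follows from compactness. The atlas is maximal.\<close>

definition closed_connected_manifold :: "'a::t2_space manifold \<Rightarrow> bool" where
  "closed_connected_manifold M \<longleftrightarrow>
     compact (UNIV :: 'a set) \<and> connected (UNIV :: 'a set) \<and>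
     (\<forall>c\<in>atlas M. is_chart (mdim M) c) \<and>
     (\<Union>c\<in>atlas M. fst c) = UNIV \<and>
     (\<forall>c\<in>atlas M. \<forall>c'\<in>atlas M. compatible_charts (mdim M) c c') \<and>
     (\<forall>c. is_chart (mdim M) c \<and> (\<forall>c'\<in>atlas M. compatible_charts (mdim M) c c') \<longrightarrow> c \<in> atlas M)"

definition smooth_maps :: "'a manifold \<Rightarrow> ('a \<Rightarrow> 'b::real_normed_vector) set" where
  "smooth_maps M = {u. \<forall>c\<in>atlas M. smooth_coord (mdim M) (chart_image c) (in_chart c u)}"

definition smooth_self_map :: "'a::topological_space manifold \<Rightarrow> ('a \<Rightarrow> 'a) \<Rightarrow> bool" where
  "smooth_self_map M \<phi> \<longleftrightarrow>
     continuous_on UNIV \<phi> \<and>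
     (\<forall>c\<in>atlas M. \<forall>c'\<in>atlas M. \<forall>j<mdim M.
        smooth_coord (mdim M) (snd c ` (fst c \<inter> \<phi> -` fst c')) (in_chart c (\<lambda>p. snd c' (\<phi> p) j)))"

definition diffeos :: "'a::topological_space manifold \<Rightarrow> ('a \<Rightarrow> 'a) set" where
  "diffeos M = {\<phi>. bij \<phi> \<and> smooth_self_map M \<phi> \<and> smooth_self_map M (inv \<phi>)}"

text \<open>Immersions into \<open>\<real>\<^sup>n\<close>: the differential is injective at every point.\<close>

definition Imm :: "'a manifold \<Rightarrow> ('a \<Rightarrow> real ^ 'n) set" where
  "Imm M = {f \<in> smooth_maps M. \<forall>c\<in>atlas M. \<forall>x\<in>chart_image c. \<forall>v :: nat \<Rightarrow> real.
     (\<Sum>i<mdim M. v i *\<^sub>R partial_deriv i (in_chart c f) x) = 0 \<longrightarrow> (\<forall>i<mdim M. v i = 0)}"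


section \<open>The induced metric, its volume density and the Bochner-Laplacian\<close>

text \<open>Components of \<open>g = f\<^sup>* g\<^sub>E\<close> with \<open>g\<^sub>E\<close> the Euclidean metric, in the chart \<open>c\<close> at the coordinate
  point \<open>x\<close>.\<close>

definition induced_metric :: "('a \<Rightarrow> real ^ 'n) \<Rightarrow> 'a chart \<Rightarrow> (nat \<Rightarrow> real) \<Rightarrow> nat \<Rightarrow> nat \<Rightarrow> real"
  where
  "induced_metric f c x i j = partial_deriv i (in_chart c f) x \<bullet> partial_deriv j (in_chart c f) x"

text \<open>To integrate against \<open>vol(g)\<close>, cut the manifold into finitely many disjoint Borel pieces, each
  relatively compact in a chart domain, and add up the integrals against \<open>sqrt (det g\<^sub>i\<^sub>j) dx\<close>. By the
  change of variables formula the result does not depend on the chosen pieces.\<close>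

definition chart_decomposition :: "'a::topological_space manifold \<Rightarrow> ('a chart \<times> 'a set) set \<Rightarrow> bool"
  where
  "chart_decomposition M D \<longleftrightarrow>
     finite D \<and>
     (\<forall>(c, B)\<in>D. c \<in> atlas M \<and> B \<in> sets borel \<and> (\<exists>K. compact K \<and> B \<subseteq> K \<and> K \<subseteq> fst c)) \<and>
     (\<forall>p\<in>D. \<forall>q\<in>D. p \<noteq> q \<longrightarrow> snd p \<inter> snd q = {}) \<and>
     (\<Union>p\<in>D. snd p) = UNIV"

definition vol_integral ::
    "'a::topological_space manifold \<Rightarrow> ('a \<Rightarrow> real ^ 'n) \<Rightarrow>
     ('a \<Rightarrow> 'b::{banach, second_countable_topology}) \<Rightarrow> 'b" where
  "vol_integral M f F =
     (\<Sum>(c, B) \<in> (SOME D. chart_decomposition M D).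
        LINT x:(snd c ` B)|coord_lebesgue (mdim M).
          sqrt (coord_det (mdim M) (induced_metric f c x)) *\<^sub>R in_chart c F x)"

text \<open>An \<open>\<real>\<^sup>n\<close>-valued one-form is given by its components \<open>B c p i\<close> in the chart \<open>c\<close> at the point \<open>p\<close>.
  The covariant derivative on \<open>\<Gamma>(f\<^sup>* T\<real>\<^sup>n)\<close> is the differential.\<close>

type_synonym ('a, 'n) one_form = "'a chart \<Rightarrow> 'a \<Rightarrow> nat \<Rightarrow> real ^ 'n"

definition cov_deriv :: "('a \<Rightarrow> real ^ 'n) \<Rightarrow> ('a, 'n) one_form" where
  "cov_deriv h c p i = partial_deriv i (in_chart c h) (snd c p)"

text \<open>The fibre metric \<open>g\<^sup>-\<^sup>1 \<otimes> g\<^sub>E\<close> on \<open>T\<^sup>*M \<otimes> \<real>\<^sup>n\<close>; its value does not depend on the chart around \<open>p\<close>.\<close>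

definition form_inner ::
    "'a manifold \<Rightarrow> ('a \<Rightarrow> real ^ 'n) \<Rightarrow> ('a, 'n) one_form \<Rightarrow> ('a, 'n) one_form \<Rightarrow> 'a \<Rightarrow> real" where
  "form_inner M f B C p =
     (let c = (SOME c. c \<in> atlas M \<and> p \<in> fst c);
          G = coord_inverse (mdim M) (induced_metric f c (snd c p))
      in \<Sum>i<mdim M. \<Sum>j<mdim M. G i j * (B c p i \<bullet> C c p j))"

text \<open>\<open>\<nabla>\<^sup>*\<close> is the formal adjoint of \<open>\<nabla>\<close> with respect to the \<open>L\<^sup>2\<close> inner products. For a smooth one-form
  \<open>B\<close> and an immersion \<open>f\<close> it exists and is unique; in all other cases we fall back to \<open>0\<close>.\<close>

definition is_cov_adjoint ::
    "'a::topological_space manifold \<Rightarrow> ('a \<Rightarrow> real ^ 'n) \<Rightarrow> ('a, 'n) one_form \<Rightarrow>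
     ('a \<Rightarrow> real ^ 'n) \<Rightarrow> bool" where
  "is_cov_adjoint M f B u \<longleftrightarrow>
     u \<in> smooth_maps M \<and>
     (\<forall>k\<in>smooth_maps M.
        vol_integral M f (form_inner M f B (cov_deriv k)) = vol_integral M f (\<lambda>p. u p \<bullet> k p))"

definition cov_adjoint ::
    "'a::topological_space manifold \<Rightarrow> ('a \<Rightarrow> real ^ 'n) \<Rightarrow> ('a, 'n) one_form \<Rightarrow> 'a \<Rightarrow> real ^ 'n" where
  "cov_adjoint M f B =
     (if \<exists>!u. is_cov_adjoint M f B u then THE u. is_cov_adjoint M f B u else (\<lambda>_. 0))"

definition bochner_laplacian ::
    "'a::topological_space manifold \<Rightarrow> ('a \<Rightarrow> real ^ 'n) \<Rightarrow> ('a \<Rightarrow> real ^ 'n) \<Rightarrow> 'a \<Rightarrow> real ^ 'n" where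
  "bochner_laplacian M f h = cov_adjoint M f (cov_deriv h)"


section \<open>Calculus in the Frechet space of smooth functions\<close>

text \<open>Convergence in the Frechet topology: uniform convergence of all partial derivatives on
  compact subsets of chart domains.\<close>

definition smooth_limit ::
    "'a::topological_space manifold \<Rightarrow> 'i filter \<Rightarrow> ('i \<Rightarrow> 'a \<Rightarrow> 'b::real_normed_vector) \<Rightarrow>
     ('a \<Rightarrow> 'b) \<Rightarrow> bool" where
  "smooth_limit M F u l \<longleftrightarrow>
     (\<forall>c\<in>atlas M. \<forall>K js. compact K \<and> K \<subseteq> fst c \<and> set js \<subseteq> {..<mdim M} \<longrightarrow>
        uniform_limit (snd c ` K) (\<lambda>s. partial_derivs js (in_chart c (u s)))
          (partial_derivs js (in_chart c l)) F)"

text \<open>Smooth maps from a subset \<open>S\<close> of a Euclidean space into the Frechet space: there are continuous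
  iterated partial derivatives \<open>D vs\<close> of all orders, difference quotients converging in the Frechet
  topology. It is used for (products of) nondegenerate intervals only, with one-sided derivatives
  at boundary points.\<close>

definition smooth_into ::
    "'a::topological_space manifold \<Rightarrow> 'e::euclidean_space set \<Rightarrow>
     ('e \<Rightarrow> 'a \<Rightarrow> 'b::real_normed_vector) \<Rightarrow> bool" where
  "smooth_into M S c \<longleftrightarrow>
     (\<exists>D :: 'e list \<Rightarrow> 'e \<Rightarrow> 'a \<Rightarrow> 'b.
        (\<forall>x\<in>S. D [] x = c x) \<and>
        (\<forall>vs. set vs \<subseteq> Basis \<longrightarrow>
          (\<forall>x\<in>S. D vs x \<in> smooth_maps M \<and>
             smooth_limit M (at x within S) (D vs) (D vs x) \<and>
             (\<forall>v\<in>Basis.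
                smooth_limit M (at 0 within {r. x + r *\<^sub>R v \<in> S})
                  (\<lambda>r p. (D vs (x + r *\<^sub>R v) p - D vs x p) /\<^sub>R r) (D (v # vs) x)))))"

definition velocity :: "real set \<Rightarrow> (real \<Rightarrow> 'a \<Rightarrow> 'b::real_normed_vector) \<Rightarrow> real \<Rightarrow> 'a \<Rightarrow> 'b" where
  "velocity I f t p = vector_derivative (\<lambda>r. f r p) (at t within I)"

text \<open>Smooth sections of \<open>L(TImm; TImm)\<close> and \<open>L\<^sup>2(TImm; TImm)\<close>: fibrewise (bi)linear maps that are smooth
  in the sense of convenient calculus, that is, map smooth curves to smooth curves.\<close>

definition smooth_section_L ::
    "'a::topological_space manifold \<Rightarrow>
     (('a \<Rightarrow> real ^ 'n) \<Rightarrow> ('a \<Rightarrow> real ^ 'n) \<Rightarrow> 'a \<Rightarrow> real ^ 'n) \<Rightarrow> bool" where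
  "smooth_section_L M P \<longleftrightarrow>
     (\<forall>f\<in>Imm M. \<forall>h\<in>smooth_maps M. P f h \<in> smooth_maps M) \<and>
     (\<forall>f\<in>Imm M. \<forall>h\<in>smooth_maps M. \<forall>k\<in>smooth_maps M. \<forall>r s :: real.
        P f (\<lambda>p. r *\<^sub>R h p + s *\<^sub>R k p) = (\<lambda>p. r *\<^sub>R P f h p + s *\<^sub>R P f k p)) \<and>
     (\<forall>(f :: real \<Rightarrow> _) h. smooth_into M UNIV f \<and> (\<forall>t. f t \<in> Imm M) \<and> smooth_into M UNIV h \<longrightarrow>
        smooth_into M UNIV (\<lambda>t. P (f t) (h t)))"

definition smooth_section_L2 ::
    "'a::topological_space manifold \<Rightarrow>
     (('a \<Rightarrow> real ^ 'n) \<Rightarrow> ('a \<Rightarrow> real ^ 'n) \<Rightarrow> ('a \<Rightarrow> real ^ 'n) \<Rightarrow> 'a \<Rightarrow> real ^ 'n) \<Rightarrow> bool" where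
  "smooth_section_L2 M Q \<longleftrightarrow>
     (\<forall>f\<in>Imm M. \<forall>h\<in>smooth_maps M. \<forall>k\<in>smooth_maps M. Q f h k \<in> smooth_maps M) \<and>
     (\<forall>f\<in>Imm M. \<forall>h\<in>smooth_maps M. \<forall>h'\<in>smooth_maps M. \<forall>k\<in>smooth_maps M. \<forall>r s :: real.
        Q f (\<lambda>p. r *\<^sub>R h p + s *\<^sub>R h' p) k = (\<lambda>p. r *\<^sub>R Q f h k p + s *\<^sub>R Q f h' k p) \<and>
        Q f k (\<lambda>p. r *\<^sub>R h p + s *\<^sub>R h' p) = (\<lambda>p. r *\<^sub>R Q f k h p + s *\<^sub>R Q f k h' p)) \<and>
     (\<forall>(f :: real \<Rightarrow> _) h k. smooth_into M UNIV f \<and> (\<forall>t. f t \<in> Imm M) \<and>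
        smooth_into M UNIV h \<and> smooth_into M UNIV k \<longrightarrow>
        smooth_into M UNIV (\<lambda>t. Q (f t) (h t) (k t)))"

text \<open>\<open>(\<nabla>\<^sub>m P) h\<close> at the foot point \<open>f\<close>.\<close>

definition nabla_op ::
    "(('a \<Rightarrow> real ^ 'n) \<Rightarrow> ('a \<Rightarrow> real ^ 'n) \<Rightarrow> 'a \<Rightarrow> real ^ 'n) \<Rightarrow>
     ('a \<Rightarrow> real ^ 'n) \<Rightarrow> ('a \<Rightarrow> real ^ 'n) \<Rightarrow> ('a \<Rightarrow> real ^ 'n) \<Rightarrow> 'a \<Rightarrow> real ^ 'n" where
  "nabla_op P f m h p = vector_derivative (\<lambda>s. P (\<lambda>q. f q + s *\<^sub>R m q) h p) (at 0)"


section \<open>Elliptic pseudo-differential operators\<close>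

text \<open>A symbol is a function of \<open>(x, \<xi>) \<in> \<real>\<^sup>d \<times> \<real>\<^sup>d\<close>, encoded as a function on \<open>\<real>\<^sup>2\<^sup>d\<close> with the components of
  \<open>\<xi>\<close> at the indices \<open>d, \<dots>, 2d - 1\<close>.\<close>

definition join :: "nat \<Rightarrow> (nat \<Rightarrow> real) \<Rightarrow> (nat \<Rightarrow> real) \<Rightarrow> nat \<Rightarrow> real" where
  "join d x \<xi> = (\<lambda>i. if i < d then x i else \<xi> (i - d))"

text \<open>The Hoermander class \<open>S\<^sup>m(\<real>\<^sup>d \<times> \<real>\<^sup>d)\<close> of type \<open>(1, 0)\<close>, matrix valued.\<close>

definition symbol_class :: "nat \<Rightarrow> real \<Rightarrow> ((nat \<Rightarrow> real) \<Rightarrow> complex ^ 'n ^ 'n) \<Rightarrow> bool" where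
  "symbol_class d m a \<longleftrightarrow>
     smooth_coord (2 * d) (coord_space (2 * d)) a \<and>
     (\<forall>js. set js \<subseteq> {..<2 * d} \<longrightarrow>
        (\<exists>C. \<forall>x\<in>coord_space d. \<forall>\<xi>\<in>coord_space d.
           norm (partial_derivs js a (join d x \<xi>))
             \<le> C * (1 + coord_norm d \<xi>) powr (m - real (length (filter (\<lambda>i. d \<le> i) js)))))"

definition complexify :: "real ^ 'n \<Rightarrow> complex ^ 'n" where
  "complexify v = (\<chi> i. complex_of_real (v $ i))"

definition fourier :: "nat \<Rightarrow> ((nat \<Rightarrow> real) \<Rightarrow> real ^ 'n) \<Rightarrow> (nat \<Rightarrow> real) \<Rightarrow> complex ^ 'n" where
  "fourier d u \<xi> = (LINT x|coord_lebesgue d. cis (- coord_dot d x \<xi>) *s complexify (u x))"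

definition symbol_op ::
    "nat \<Rightarrow> ((nat \<Rightarrow> real) \<Rightarrow> complex ^ 'n ^ 'n) \<Rightarrow> ((nat \<Rightarrow> real) \<Rightarrow> real ^ 'n) \<Rightarrow>
     (nat \<Rightarrow> real) \<Rightarrow> complex ^ 'n" where
  "symbol_op d a u x =
     (1 / (2 * pi) ^ d) *\<^sub>R
       (LINT \<xi>|coord_lebesgue d. cis (coord_dot d x \<xi>) *s (a (join d x \<xi>) *v fourier d u \<xi>))"

definition pullback :: "'a chart \<Rightarrow> ((nat \<Rightarrow> real) \<Rightarrow> 'b::zero) \<Rightarrow> 'a \<Rightarrow> 'b" where
  "pullback c u p = (if p \<in> fst c then u (snd c p) else 0)"

text \<open>In the chart \<open>c\<close>, the operator \<open>u \<mapsto> \<phi> A (\<psi> u)\<close> is the pseudo-differential operator on \<open>\<real>\<^sup>d\<close> with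
  symbol \<open>a\<close>.\<close>

definition has_local_symbol ::
    "'a manifold \<Rightarrow> 'a chart \<Rightarrow> ((nat \<Rightarrow> real) \<Rightarrow> real) \<Rightarrow> ((nat \<Rightarrow> real) \<Rightarrow> real) \<Rightarrow>
     (('a \<Rightarrow> real ^ 'n) \<Rightarrow> 'a \<Rightarrow> real ^ 'n) \<Rightarrow> ((nat \<Rightarrow> real) \<Rightarrow> complex ^ 'n ^ 'n) \<Rightarrow> bool" where
  "has_local_symbol M c \<phi> \<psi> A a \<longleftrightarrow>
     (\<forall>u. test_function (mdim M) (coord_space (mdim M)) u \<longrightarrow>
        (\<forall>x\<in>coord_space (mdim M).
           complexify (if x \<in> chart_image c
                       then \<phi> x *\<^sub>R A (pullback c (\<lambda>y. \<psi> y *\<^sub>R u y)) (chart_inv c x) else 0)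
             = symbol_op (mdim M) a u x))"

text \<open>Hoermander's definition (The Analysis of Linear Partial Differential Operators III, 18.1.20).
  The charts of a maximal atlas need not have connected domains, so the condition also forces the
  kernel to be smooth off the diagonal.\<close>

definition pseudo_differential ::
    "'a manifold \<Rightarrow> real \<Rightarrow> (('a \<Rightarrow> real ^ 'n) \<Rightarrow> 'a \<Rightarrow> real ^ 'n) \<Rightarrow> bool" where
  "pseudo_differential M m A \<longleftrightarrow>
     (\<forall>c\<in>atlas M. \<forall>\<phi> \<psi>.
        test_function (mdim M) (chart_image c) \<phi> \<and> test_function (mdim M) (chart_image c) \<psi> \<longrightarrow>
        (\<exists>a. symbol_class (mdim M) m a \<and> has_local_symbol M c \<phi> \<psi> A a))"

text \<open>Ellipticity at every point: the local symbol is invertible for large \<open>\<xi>\<close>, with inverse bounded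
  by a multiple of \<open>|\<xi>|\<^sup>-\<^sup>m\<close>.\<close>

definition elliptic ::
    "'a manifold \<Rightarrow> real \<Rightarrow> (('a \<Rightarrow> real ^ 'n) \<Rightarrow> 'a \<Rightarrow> real ^ 'n) \<Rightarrow> bool" where
  "elliptic M m A \<longleftrightarrow>
     (\<forall>p. \<exists>c\<in>atlas M. p \<in> fst c \<and>
        (\<exists>\<phi> \<psi> W a. test_function (mdim M) (chart_image c) \<phi> \<and>
           test_function (mdim M) (chart_image c) \<psi> \<and>
           openin (Euclidean_space (mdim M)) W \<and> snd c p \<in> W \<and> (\<forall>x\<in>W. \<phi> x = 1 \<and> \<psi> x = 1) \<and>
           symbol_class (mdim M) m a \<and> has_local_symbol M c \<phi> \<psi> A a \<and>
           (\<exists>R>0. \<exists>\<delta>>0. \<forall>\<xi>\<in>coord_space (mdim M). R \<le> coord_norm (mdim M) \<xi> \<longrightarrow>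
              (\<forall>v. \<delta> * coord_norm (mdim M) \<xi> powr m * norm v
                     \<le> norm (a (join (mdim M) (snd c p) \<xi>) *v v)))))"

definition elliptic_pseudo_differential ::
    "'a manifold \<Rightarrow> (('a \<Rightarrow> real ^ 'n) \<Rightarrow> 'a \<Rightarrow> real ^ 'n) \<Rightarrow> bool" where
  "elliptic_pseudo_differential M A \<longleftrightarrow> (\<exists>m. pseudo_differential M m A \<and> elliptic M m A)"


section \<open>Sobolev-type metrics and their geodesics\<close>

type_synonym ('a, 'n) operator_field =
  "('a \<Rightarrow> real ^ 'n) \<Rightarrow> ('a \<Rightarrow> real ^ 'n) \<Rightarrow> 'a \<Rightarrow> real ^ 'n"

definition admissible_operator ::
    "'a::topological_space manifold \<Rightarrow> ('a, 'n::finite) operator_field \<Rightarrow> bool" where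
  "admissible_operator M P \<longleftrightarrow>
     smooth_section_L M P \<and>
     (\<forall>f\<in>Imm M. elliptic_pseudo_differential M (P f)) \<and>
     (\<forall>f\<in>Imm M. \<forall>h\<in>smooth_maps M. \<forall>k\<in>smooth_maps M.
        vol_integral M f (\<lambda>p. P f h p \<bullet> k p) = vol_integral M f (\<lambda>p. h p \<bullet> P f k p)) \<and>
     (\<forall>f\<in>Imm M. \<forall>h\<in>smooth_maps M. h \<noteq> (\<lambda>_. 0) \<longrightarrow> vol_integral M f (\<lambda>p. P f h p \<bullet> h p) > 0) \<and>
     (\<forall>\<phi>\<in>diffeos M. \<forall>f\<in>Imm M. \<forall>h\<in>smooth_maps M. P f h \<circ> \<phi> = P (f \<circ> \<phi>) (h \<circ> \<phi>)) \<and>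
     (\<exists>Adj. smooth_section_L2 M Adj \<and>
        (\<forall>f\<in>Imm M. \<forall>m\<in>smooth_maps M. \<forall>h\<in>smooth_maps M. \<forall>k\<in>smooth_maps M.
           vol_integral M f (\<lambda>p. nabla_op P f m h p \<bullet> k p)
             = vol_integral M f (\<lambda>p. m p \<bullet> Adj f h k p)))"

definition sobolev_metric ::
    "'a::topological_space manifold \<Rightarrow> ('a, 'n::finite) operator_field \<Rightarrow>
     ('a \<Rightarrow> real ^ 'n) \<Rightarrow> ('a \<Rightarrow> real ^ 'n) \<Rightarrow> ('a \<Rightarrow> real ^ 'n) \<Rightarrow> real" where
  "sobolev_metric M P f h k = vol_integral M f (\<lambda>p. P f h p \<bullet> k p)"

definition energy ::
    "'a::topological_space manifold \<Rightarrow> ('a, 'n::finite) operator_field \<Rightarrow> real \<Rightarrow> real \<Rightarrow>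
     (real \<Rightarrow> 'a \<Rightarrow> real ^ 'n) \<Rightarrow> real" where
  "energy M P a b f =
     1 / 2 * integral {a..b} (\<lambda>t. sobolev_metric M P (f t) (velocity {a..b} f t) (velocity {a..b} f t))"

definition smooth_variation ::
    "'a::topological_space manifold \<Rightarrow> real \<Rightarrow> real \<Rightarrow> (real \<Rightarrow> 'a \<Rightarrow> real ^ 'n) \<Rightarrow> real \<Rightarrow>
     (real \<times> real \<Rightarrow> 'a \<Rightarrow> real ^ 'n) \<Rightarrow> bool" where
  "smooth_variation M a b f \<epsilon> F \<longleftrightarrow>
     smooth_into M ({-\<epsilon><..<\<epsilon>} \<times> {a..b}) F \<and>
     (\<forall>s\<in>{-\<epsilon><..<\<epsilon>}. \<forall>t\<in>{a..b}. F (s, t) \<in> Imm M) \<and>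
     (\<forall>t\<in>{a..b}. F (0, t) = f t) \<and>
     (\<forall>s\<in>{-\<epsilon><..<\<epsilon>}. F (s, a) = f a \<and> F (s, b) = f b)"

text \<open>A geodesic on an interval \<open>I\<close>: a smooth path of immersions whose restriction to each compact
  subinterval is a critical point of the energy for fixed endpoints.\<close>

definition geodesic ::
    "'a::topological_space manifold \<Rightarrow> ('a, 'n::finite) operator_field \<Rightarrow> real set \<Rightarrow>
     (real \<Rightarrow> 'a \<Rightarrow> real ^ 'n) \<Rightarrow> bool" where
  "geodesic M P I f \<longleftrightarrow>
     smooth_into M I f \<and> (\<forall>t\<in>I. f t \<in> Imm M) \<and>
     (\<forall>a b. a < b \<and> {a..b} \<subseteq> I \<longrightarrow>
        (\<forall>\<epsilon>>0. \<forall>F. smooth_variation M a b f \<epsilon> F \<longrightarrow>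
           ((\<lambda>s. energy M P a b (\<lambda>t. F (s, t))) has_real_derivative 0) (at 0)))"


section \<open>The Euclidean motion group\<close>

text \<open>The motion \<open>y \<mapsto> R y + b\<close> acts on immersions by composition from the left, and on tangent
  vectors by its differential \<open>R\<close>.\<close>

definition motion_invariant ::
    "'a manifold \<Rightarrow> ('a, 'n::finite) operator_field \<Rightarrow> bool" where
  "motion_invariant M P \<longleftrightarrow>
     (\<forall>R b. rotation_matrix R \<longrightarrow>
        (\<forall>f\<in>Imm M. \<forall>h\<in>smooth_maps M.
           P (\<lambda>p. R *v f p + b) (\<lambda>p. R *v h p) = (\<lambda>p. R *v P f h p)))"

definition so_algebra :: "(real ^ 'n ^ 'n) set" where
  "so_algebra = {X. transpose X = - X}"

text \<open>\<open>\<Lambda>\<^sup>2 \<real>\<^sup>n\<close> is realized as the space of skew-symmetric matrices.\<close>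

definition wedge :: "real ^ 'n \<Rightarrow> real ^ 'n \<Rightarrow> real ^ 'n ^ 'n" where
  "wedge u v = (\<chi> i j. u $ i * v $ j - u $ j * v $ i)"

text \<open>The isomorphism \<open>\<Lambda>\<^sup>2 \<real>\<^sup>n \<cong> so(n)\<^sup>*\<close> that sends \<open>u \<and> v\<close> to \<open>X \<mapsto> (X u) \<bullet> v\<close>.\<close>

definition bivector_dual :: "real ^ 'n ^ 'n \<Rightarrow> real ^ 'n ^ 'n \<Rightarrow> real" where
  "bivector_dual W X = trace (X ** W) / 2"

lemma bivector_dual_wedge:
  fixes u v :: "real ^ 'n"
  assumes "X \<in> so_algebra"
  shows "bivector_dual (wedge u v) X = (X *v u) \<bullet> v"
proof -
  have skew: "X $ k $ i = - X $ i $ k" for i k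
  proof -
    have "transpose X $ i $ k = (- X) $ i $ k"
      using assms by (simp add: so_algebra_def)
    then show ?thesis
      by (simp add: transpose_def)
  qed
  have "(\<Sum>i\<in>UNIV. \<Sum>k\<in>UNIV. X $ i $ k * (u $ i * v $ k))
      = (\<Sum>i\<in>UNIV. \<Sum>k\<in>UNIV. X $ k $ i * (u $ k * v $ i))"
    by (rule sum.swap)
  also have "\<dots> = - (\<Sum>i\<in>UNIV. \<Sum>k\<in>UNIV. X $ i $ k * (u $ k * v $ i))"
    unfolding sum_negf[symmetric]
    by (intro sum.cong refl) (metis skew mult_minus_left)
  finally have *: "(\<Sum>i\<in>UNIV. \<Sum>k\<in>UNIV. X $ i $ k * (u $ i * v $ k))
      = - (\<Sum>i\<in>UNIV. \<Sum>k\<in>UNIV. X $ i $ k * (u $ k * v $ i))" .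
  have "trace (X ** wedge u v) = (\<Sum>i\<in>UNIV. \<Sum>k\<in>UNIV. X $ i $ k * (u $ k * v $ i))
      - (\<Sum>i\<in>UNIV. \<Sum>k\<in>UNIV. X $ i $ k * (u $ i * v $ k))"
    by (simp add: trace_def matrix_matrix_mult_def wedge_def algebra_simps sum_subtractf)
  also have "\<dots> = 2 * ((X *v u) \<bullet> v)"
    unfolding * by (simp add: inner_vec_def matrix_vector_mult_def sum_distrib_right mult.assoc)
  finally show ?thesis by (simp add: bivector_dual_def)
qed

lemma bivector_dual_nondegenerate:
  fixes W :: "real ^ 'n ^ 'n"
  assumes "transpose W = - W" and "\<And>X. X \<in> so_algebra \<Longrightarrow> bivector_dual W X = 0"
  shows "W = 0"
proof -
  have skew: "W $ k $ i = - W $ i $ k" for i k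
  proof -
    have "transpose W $ i $ k = (- W) $ i $ k"
      using assms(1) by simp
    then show ?thesis
      by (simp add: transpose_def)
  qed
  have "trace (W ** W) = 0"
    using assms by (simp add: bivector_dual_def so_algebra_def)
  moreover have "W $ i $ k * W $ k $ i = - (W $ i $ k)\<^sup>2" for i k
    by (subst skew[of k i]) (simp add: power2_eq_square)
  ultimately have "(\<Sum>i\<in>UNIV. \<Sum>k\<in>UNIV. (W $ i $ k)\<^sup>2) = 0"
    by (simp add: trace_def matrix_matrix_mult_def sum_negf)
  then show ?thesis
    by (simp add: sum_nonneg_eq_0_iff sum_nonneg vec_eq_iff)
qed

end

theory Submission
  imports Defs
begin

text \<open>
  The conservation laws are Noether's theorem, proved by a variation that stays inside the symmetry
  group. Let \<open>\<Phi>\<^sub>\<theta>\<close> be a one-parameter group of Euclidean motions with infinitesimal generator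
  \<open>\<xi>(y) = J y + e\<close>, let \<open>f\<close> be a geodesic on \<open>[a, b]\<close>, and let \<open>\<eta>\<close> be a function with
  \<open>\<eta>(a) = \<eta>(b) = 0\<close>. The family \<open>F(s, t) = \<Phi>\<^bsub>s \<eta>(t)\<^esub> \<circ> f(t)\<close> is a variation with fixed end points
  and velocity \<open>F\<^sub>t = D\<Phi>\<^bsub>s \<eta>\<^esub> (f\<^sub>t + s \<eta>' \<xi>(f))\<close>. Since \<open>P\<close>, the volume density and the Euclidean inner
  product are invariant under motions, \<open>\<Phi>\<close> drops out of the energy:
  \<open>E(s) = 1/2 \<integral> G\<^sub>f(f\<^sub>t + s \<eta>' \<xi>(f), f\<^sub>t + s \<eta>' \<xi>(f)) dt\<close>. This is a quadratic polynomial in \<open>s\<close>. Its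
  linear coefficient is \<open>\<integral> \<eta>' m dt\<close>, where \<open>m(t) = \<integral>\<^sub>M \<langle>P f\<^sub>t, \<xi>(f)\<rangle> vol(g)\<close> is the momentum, and it
  vanishes because \<open>f\<close> is a critical point (lemma \<open>noether_integral\<close>). No derivative of \<open>P\<close> or of the
  volume density in the direction of the variation ever occurs. As \<open>\<eta>\<close> is arbitrary and \<open>m\<close> is
  continuous, \<open>m\<close> is constant (\<open>constant_if_orthogonal_to_derivatives\<close>; polynomials \<open>\<eta>\<close> suffice, by the
  Weierstrass theorem).

  Two families of motions give all the assertions, and they are treated together as screw motions:
  translations (\<open>J = 0\<close>) yield the linear momentum, and rotations of the coordinate planes (\<open>e = 0\<close>)
  yield the components of \<open>\<integral>\<^sub>M f \<and> P f\<^sub>t vol(g)\<close>. Pairing the latter with \<open>X\<close> in \<open>so(n)\<close> gives the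
  other form of the angular momentum.

  Most of the text supplies the analysis behind this computation. The variation has to be smooth
  as a map into the Frechet space of smooth maps; \<open>smooth_into_scale_comp\<close> shows this for the families
  \<open>g(x) \<alpha>(\<rho>(x))\<close> from which \<open>F\<close> is built. Continuity of \<open>m\<close> up to the end points of the interval
  (\<open>continuous_on_momentum\<close>) needs dominated convergence for the volume integral, and a
  reparametrisation of \<open>f\<close> to a curve on the whole line, where the smoothness of \<open>P\<close> can be applied.

  The operator \<open>1 + A \<Delta>\<^sup>p\<close> is invariant because \<open>\<Delta> = \<nabla>\<^sup>*\<nabla>\<close> is determined by the integrals of
  \<open>\<langle>\<nabla>h, \<nabla>k\<rangle>\<close> and \<open>\<langle>u, k\<rangle>\<close>, and a motion preserves both (\<open>bochner_laplacian_motion\<close>).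
\<close>

section \<open>Partial derivatives and smooth functions\<close>

lemma openin_Euclidean_space_iff:
  "openin (Euclidean_space d) V \<longleftrightarrow> (\<exists>U. open U \<and> V = U \<inter> coord_space d)"
  by (auto simp: Euclidean_space_def openin_subtopology euclidean_product_topology Int_commute)

lemma eventually_fun_upd_in_openin:
  assumes V: "openin (Euclidean_space d) V" and x: "x \<in> V" and i: "i < d"
  shows "\<forall>\<^sub>F r in nhds (x i). x(i := r) \<in> V"
proof -
  obtain U where U: "open U" "V = U \<inter> coord_space d"
    using V by (auto simp: openin_Euclidean_space_iff)
  have "continuous_on UNIV (\<lambda>r. x(i := r))"
  proof (rule continuous_on_coordinatewise_then_product)
    show "continuous_on UNIV (\<lambda>r. (x(i := r)) j)" for j
      by (cases "j = i") (auto intro!: continuous_intros)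
  qed
  then have "open ((\<lambda>r. x(i := r)) -` U)"
    using U(1) by (simp add: open_vimage continuous_on_eq_continuous_at)
  moreover have "x i \<in> (\<lambda>r. x(i := r)) -` U"
    using x U by simp
  ultimately have "\<forall>\<^sub>F r in nhds (x i). r \<in> (\<lambda>r. x(i := r)) -` U"
    by (rule eventually_nhds_in_open)
  then show ?thesis
    by (rule eventually_mono) (use x U i in \<open>auto simp: topspace_Euclidean_space\<close>)
qed

text \<open>\<^const>\<open>partial_deriv\<close> looks at \<open>u\<close> along a whole coordinate line, but only its values near the point
  matter.\<close>

lemma partial_deriv_cong:
  assumes "openin (Euclidean_space d) V" "x \<in> V" "i < d" "\<And>y. y \<in> V \<Longrightarrow> u y = w y"
  shows "partial_deriv i u x = partial_deriv i w x"
  unfolding partial_deriv_def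
proof (rule vector_derivative_cong_eq)
  show "\<forall>\<^sub>F r in nhds (x i). r \<in> UNIV \<longrightarrow> u (x(i := r)) = w (x(i := r))"
    using eventually_fun_upd_in_openin[OF assms(1-3)]
    by (rule eventually_mono) (simp add: assms(4))
qed auto

lemma smooth_coord_has_deriv:
  assumes "smooth_coord d V u" "set js \<subseteq> {..<d}" "i < d" "x \<in> V"
  shows "((\<lambda>r. partial_derivs js u (x(i := r))) has_vector_derivative partial_derivs (i # js) u x)
           (at (x i))"
proof -
  have "(\<lambda>r. partial_derivs js u (x(i := r))) differentiable (at (x i))"
    using assms unfolding smooth_coord_def by blast
  then show ?thesis
    by (simp add: partial_deriv_def vector_derivative_works)
qed

lemma smooth_coord_cont:
  "smooth_coord d V u \<Longrightarrow> set js \<subseteq> {..<d} \<Longrightarrow> continuous_on V (partial_derivs js u)"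
  unfolding smooth_coord_def by blast

text \<open>The one rule from which sums, multiples and linear images of smooth functions all follow.\<close>

lemma partial_derivs_lincomb:
  assumes V: "openin (Euclidean_space d) V"
    and u: "smooth_coord d V u" and w: "smooth_coord d V w"
    and L: "bounded_linear L" and L': "bounded_linear L'"
    and js: "set js \<subseteq> {..<d}" and x: "x \<in> V"
  shows "partial_derivs js (\<lambda>y. L (u y) + L' (w y)) x
           = L (partial_derivs js u x) + L' (partial_derivs js w x)"
  using js x
proof (induction js arbitrary: x)
  case Nil
  then show ?case by simp
next
  case (Cons i js)
  then have i: "i < d" and js: "set js \<subseteq> {..<d}" by auto
  have "partial_derivs (i # js) (\<lambda>y. L (u y) + L' (w y)) x
      = partial_deriv i (\<lambda>y. L (partial_derivs js u y) + L' (partial_derivs js w y)) x"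
    unfolding partial_derivs.simps by (rule partial_deriv_cong[OF V Cons.prems(2) i Cons.IH[OF js]])
  also have "\<dots> = L (partial_derivs (i # js) u x) + L' (partial_derivs (i # js) w x)"
    unfolding partial_deriv_def[of i "\<lambda>y. L (partial_derivs js u y) + L' (partial_derivs js w y)"]
    by (intro vector_derivative_at has_vector_derivative_add
        bounded_linear.has_vector_derivative[OF L] bounded_linear.has_vector_derivative[OF L']
        smooth_coord_has_deriv[OF u js i Cons.prems(2)] smooth_coord_has_deriv[OF w js i Cons.prems(2)])
  finally show ?case .
qed

lemma smooth_coord_lincomb:
  assumes V: "openin (Euclidean_space d) V"
    and u: "smooth_coord d V u" and w: "smooth_coord d V w"
    and L: "bounded_linear L" and L': "bounded_linear L'"
  shows "smooth_coord d V (\<lambda>y. L (u y) + L' (w y))"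
  unfolding smooth_coord_def
proof (intro allI impI conjI ballI)
  fix js assume js: "set js \<subseteq> {..<d}"
  note pd = partial_derivs_lincomb[OF V u w L L' js]
  have "continuous_on V (\<lambda>x. L (partial_derivs js u x) + L' (partial_derivs js w x))"
    by (intro continuous_intros bounded_linear.continuous_on[OF L]
        bounded_linear.continuous_on[OF L'] smooth_coord_cont[OF u js] smooth_coord_cont[OF w js])
  then show "continuous_on V (partial_derivs js (\<lambda>y. L (u y) + L' (w y)))"
    by (simp add: pd cong: continuous_on_cong)
  fix i x assume i: "i < d" and x: "x \<in> V"
  have D: "((\<lambda>r. L (partial_derivs js u (x(i := r))) + L' (partial_derivs js w (x(i := r))))
        has_vector_derivative (L (partial_derivs (i # js) u x) + L' (partial_derivs (i # js) w x)))
        (at (x i))"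
    by (intro has_vector_derivative_add
        bounded_linear.has_vector_derivative[OF L] bounded_linear.has_vector_derivative[OF L']
        smooth_coord_has_deriv[OF u js i x] smooth_coord_has_deriv[OF w js i x])
  have "((\<lambda>r. partial_derivs js (\<lambda>y. L (u y) + L' (w y)) (x(i := r)))
        has_vector_derivative (L (partial_derivs (i # js) u x) + L' (partial_derivs (i # js) w x)))
        (at (x i))"
  proof (rule iffD1[OF has_vector_derivative_cong_ev D])
    show "\<forall>\<^sub>F r in nhds (x i). r \<in> UNIV \<longrightarrow>
        L (partial_derivs js u (x(i := r))) + L' (partial_derivs js w (x(i := r)))
        = partial_derivs js (\<lambda>y. L (u y) + L' (w y)) (x(i := r))"
      using eventually_fun_upd_in_openin[OF V x i] by (rule eventually_mono) (simp add: pd)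
  qed (simp add: pd x)
  then show "(\<lambda>r. partial_derivs js (\<lambda>y. L (u y) + L' (w y)) (x(i := r))) differentiable (at (x i))"
    by (rule differentiableI_vector)
qed

lemma partial_derivs_const: "partial_derivs js (\<lambda>_. a) = (\<lambda>_. if js = [] then a else 0)"
  by (induction js) (auto simp: partial_deriv_def fun_eq_iff)

lemma smooth_coord_const: "smooth_coord d V (\<lambda>_. a)"
  by (auto simp: smooth_coord_def partial_derivs_const)

lemma in_chart_lincomb:
  "in_chart c (\<lambda>p. L (u p) + L' (w p)) = (\<lambda>x. L (in_chart c u x) + L' (in_chart c w x))"
  by (simp add: in_chart_def comp_def)

locale closed_manifold =
  fixes M :: "'a::t2_space manifold"
  assumes closed_connected: "closed_connected_manifold M"
begin

lemma openin_chart_image: "c \<in> atlas M \<Longrightarrow> openin (Euclidean_space (mdim M)) (chart_image c)"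
  using closed_connected by (simp add: closed_connected_manifold_def is_chart_def)

lemma ex_chart: "\<exists>c\<in>atlas M. p \<in> fst c"
  using closed_connected unfolding closed_connected_manifold_def by blast

lemma compact_UNIV: "compact (UNIV :: 'a set)"
  using closed_connected by (simp add: closed_connected_manifold_def)

lemma open_chart_domain: "c \<in> atlas M \<Longrightarrow> open (fst c)"
  using closed_connected by (simp add: closed_connected_manifold_def is_chart_def)

lemma chart_homeo:
  assumes "c \<in> atlas M"
  shows "continuous_on (fst c) (snd c)" "continuous_on (chart_image c) (chart_inv c)"
    and "inj_on (snd c) (fst c)"
    and "\<And>p. p \<in> fst c \<Longrightarrow> chart_inv c (snd c p) = p"
    and "\<And>x. x \<in> chart_image c \<Longrightarrow> chart_inv c x \<in> fst c \<and> snd c (chart_inv c x) = x"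
proof -
  have hm: "homeomorphic_map (top_of_set (fst c)) (top_of_set (chart_image c)) (snd c)"
    using closed_connected assms by (simp add: closed_connected_manifold_def is_chart_def)
  then show "continuous_on (fst c) (snd c)"
    using homeomorphic_imp_continuous_map by fastforce
  show inj: "inj_on (snd c) (fst c)"
    using hm homeomorphic_imp_injective_map by fastforce
  show l: "chart_inv c (snd c p) = p" if "p \<in> fst c" for p
    using that inj by (simp add: chart_inv_def)
  show r: "chart_inv c x \<in> fst c \<and> snd c (chart_inv c x) = x" if "x \<in> chart_image c" for x
    using that by (simp add: chart_inv_def chart_image_def inv_into_into f_inv_into_f)
  obtain g where g: "homeomorphic_maps (top_of_set (fst c)) (top_of_set (chart_image c)) (snd c) g"
    using hm by (auto simp: homeomorphic_map_maps)
  then have "continuous_on (chart_image c) g" "\<And>p. p \<in> fst c \<Longrightarrow> g (snd c p) = p"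
    by (auto simp: homeomorphic_maps_def)
  moreover have "g x = chart_inv c x" if "x \<in> chart_image c" for x
    using calculation(2) r[OF that] by metis
  ultimately show "continuous_on (chart_image c) (chart_inv c)"
    by (simp cong: continuous_on_cong)
qed

lemma smooth_maps_lincomb:
  assumes "u \<in> smooth_maps M" "w \<in> smooth_maps M" "bounded_linear L" "bounded_linear L'"
  shows "(\<lambda>p. L (u p) + L' (w p)) \<in> smooth_maps M"
  using assms unfolding smooth_maps_def mem_Collect_eq
  by (intro ballI, subst in_chart_lincomb)
     (intro smooth_coord_lincomb[OF openin_chart_image]; blast)

lemma smooth_maps_const: "(\<lambda>_. a) \<in> smooth_maps M"
  by (simp add: smooth_maps_def in_chart_def comp_def smooth_coord_const)

lemma smooth_maps_linear:
  "u \<in> smooth_maps M \<Longrightarrow> bounded_linear L \<Longrightarrow> (\<lambda>p. L (u p)) \<in> smooth_maps M"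
  using smooth_maps_lincomb[OF _ smooth_maps_const[of "0::real"], of u L "\<lambda>_. 0"]
  by (simp add: bounded_linear_zero)

lemma smooth_maps_add:
  "u \<in> smooth_maps M \<Longrightarrow> w \<in> smooth_maps M \<Longrightarrow> (\<lambda>p. u p + w p) \<in> smooth_maps M"
  using smooth_maps_lincomb[of u w "\<lambda>x. x" "\<lambda>x. x"] by (simp add: bounded_linear_ident)

lemma smooth_maps_scale:
  "u \<in> smooth_maps M \<Longrightarrow> (\<lambda>p. r *\<^sub>R u p) \<in> smooth_maps M"
  by (rule smooth_maps_linear) (auto intro: bounded_linear_scaleR_right)

lemma partial_derivs_chart_lincomb:
  assumes "u \<in> smooth_maps M" "w \<in> smooth_maps M" "bounded_linear L" "bounded_linear L'"
    and "c \<in> atlas M" "set js \<subseteq> {..<mdim M}" "x \<in> chart_image c"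
  shows "partial_derivs js (in_chart c (\<lambda>p. L (u p) + L' (w p))) x
    = L (partial_derivs js (in_chart c u) x) + L' (partial_derivs js (in_chart c w) x)"
  unfolding in_chart_lincomb
  using assms by (intro partial_derivs_lincomb[OF openin_chart_image]) (auto simp: smooth_maps_def)

lemma continuous_partial_derivs:
  assumes "u \<in> smooth_maps M" "c \<in> atlas M" "set js \<subseteq> {..<mdim M}"
  shows "continuous_on (chart_image c) (partial_derivs js (in_chart c u))"
  using assms by (intro smooth_coord_cont) (auto simp: smooth_maps_def)

lemma compact_chart_image:
  assumes "c \<in> atlas M" "compact K" "K \<subseteq> fst c"
  shows "compact (snd c ` K)" "snd c ` K \<subseteq> chart_image c"
  using assms chart_homeo(1)[OF assms(1)]
  by (auto intro!: compact_continuous_image continuous_on_subset[of "fst c"] simp: chart_image_def)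

end

section \<open>Curves and families in the Frechet space of smooth maps\<close>

lemma eventually_at_within_mem: "\<forall>\<^sub>F s in at x within S. s \<in> S"
  by (simp add: eventually_at_filter)

lemma smooth_limit_filterlim:
  assumes "smooth_limit M G u l" and "filterlim \<theta> G F"
  shows "smooth_limit M F (\<lambda>s. u (\<theta> s)) l"
  unfolding smooth_limit_def
proof (intro ballI allI impI)
  fix c K js
  assume "c \<in> atlas M" "compact K \<and> K \<subseteq> fst c \<and> set js \<subseteq> {..<mdim M}"
  then have "uniform_limit (snd c ` K) (\<lambda>s. partial_derivs js (in_chart c (u s)))
      (partial_derivs js (in_chart c l)) G"
    using assms(1) by (simp add: smooth_limit_def)
  then show "uniform_limit (snd c ` K) (\<lambda>s. partial_derivs js (in_chart c (u (\<theta> s))))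
      (partial_derivs js (in_chart c l)) F"
    by (rule filterlim_compose) fact
qed

lemma smooth_limit_mono: "smooth_limit M G u l \<Longrightarrow> F \<le> G \<Longrightarrow> smooth_limit M F u l"
  using smooth_limit_filterlim[of M G u l "\<lambda>s. s" F] by (simp add: filterlim_def)

lemma smooth_limit_cong:
  assumes "smooth_limit M F u l" and ev: "\<forall>\<^sub>F s in F. u s = w s"
  shows "smooth_limit M F w l"
  unfolding smooth_limit_def
proof (intro ballI allI impI)
  fix c K js
  assume "c \<in> atlas M" "compact K \<and> K \<subseteq> fst c \<and> set js \<subseteq> {..<mdim M}"
  then have "uniform_limit (snd c ` K) (\<lambda>s. partial_derivs js (in_chart c (u s)))
      (partial_derivs js (in_chart c l)) F"
    using assms(1) by (simp add: smooth_limit_def)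
  then show "uniform_limit (snd c ` K) (\<lambda>s. partial_derivs js (in_chart c (w s)))
      (partial_derivs js (in_chart c l)) F"
    by (rule iffD1[OF uniform_limit_cong, rotated 2])
       (use ev in \<open>auto elim: eventually_mono\<close>)
qed

lemma smooth_limit_const: "smooth_limit M F (\<lambda>_. l) l"
  by (simp add: smooth_limit_def uniform_limit_const)

text \<open>The filter \<open>at y\<close> omits \<open>y\<close>. Adding the point back makes limits stable under composition with
  maps that may take the value \<open>y\<close>.\<close>

lemma smooth_limit_principal:
  assumes "smooth_limit M F u l" and eq: "u y = l"
  shows "smooth_limit M (sup F (principal {y})) u l"
  unfolding smooth_limit_def
proof (intro ballI allI impI)
  fix c K js
  assume "c \<in> atlas M" "compact K \<and> K \<subseteq> fst c \<and> set js \<subseteq> {..<mdim M}"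
  then have "uniform_limit (snd c ` K) (\<lambda>s. partial_derivs js (in_chart c (u s)))
      (partial_derivs js (in_chart c l)) F"
    using assms(1) by (simp add: smooth_limit_def)
  then show "uniform_limit (snd c ` K) (\<lambda>s. partial_derivs js (in_chart c (u s)))
      (partial_derivs js (in_chart c l)) (sup F (principal {y}))"
    by (auto simp: uniform_limit_iff eventually_sup eventually_principal eq)
qed

definition directional_derivative ::
    "'a::topological_space manifold \<Rightarrow> 'e::euclidean_space set \<Rightarrow>
     ('e \<Rightarrow> 'a \<Rightarrow> 'b::real_normed_vector) \<Rightarrow> 'e \<Rightarrow> 'e \<Rightarrow> ('a \<Rightarrow> 'b) \<Rightarrow> bool" where
  "directional_derivative M S u v x w \<longleftrightarrow>
     smooth_limit M (at 0 within {r. x + r *\<^sub>R v \<in> S})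
       (\<lambda>r p. (u (x + r *\<^sub>R v) p - u x p) /\<^sub>R r) w"

lemma directional_derivative_cong:
  assumes "directional_derivative M S u v x w" "x \<in> S" "\<And>y. y \<in> S \<Longrightarrow> u y = u' y"
  shows "directional_derivative M S u' v x w"
  using assms(1) unfolding directional_derivative_def
  by (rule smooth_limit_cong)
     (rule eventually_mono[OF eventually_at_within_mem], simp add: assms)

text \<open>Smoothness of families is the largest property that passes to values, entails continuity and
  is inherited by some directional derivatives: this turns every closure property below into
  exhibiting a class of families that is closed under differentiation, with no formula for higher
  derivatives.\<close>

lemma smooth_into_coinduct:
  fixes u :: "'e::euclidean_space \<Rightarrow> 'a::topological_space \<Rightarrow> 'b::real_normed_vector"
  assumes u: "C u"
    and smooth: "\<And>u x. C u \<Longrightarrow> x \<in> S \<Longrightarrow> u x \<in> smooth_maps M"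
    and cont: "\<And>u x. C u \<Longrightarrow> x \<in> S \<Longrightarrow> smooth_limit M (at x within S) u (u x)"
    and deriv: "\<And>u v. C u \<Longrightarrow> v \<in> Basis \<Longrightarrow>
      \<exists>w. C w \<and> (\<forall>x\<in>S. directional_derivative M S u v x (w x))"
  shows "smooth_into M S u"
proof -
  have "\<forall>u v. \<exists>w. C u \<and> v \<in> Basis \<longrightarrow>
      C w \<and> (\<forall>x\<in>S. directional_derivative M S u v x (w x))"
    using deriv by blast
  then obtain \<delta> where \<delta>: "\<And>u v. C u \<Longrightarrow> v \<in> Basis \<Longrightarrow>
      C (\<delta> u v) \<and> (\<forall>x\<in>S. directional_derivative M S u v x (\<delta> u v x))"
    by metis
  define D where "D = (\<lambda>vs. foldr (\<lambda>v w. \<delta> w v) vs u)"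
  have C: "C (D vs)" if "set vs \<subseteq> Basis" for vs
    using that by (induction vs) (auto simp: D_def u \<delta>)
  show ?thesis
    unfolding smooth_into_def
  proof (intro exI[of _ D] conjI allI impI ballI)
    fix vs x v
    assume vs: "set vs \<subseteq> (Basis :: 'e set)" and x: "x \<in> S" and v: "v \<in> (Basis :: 'e set)"
    have "directional_derivative M S (D vs) v x (D (v # vs) x)"
      using \<delta>[OF C[OF vs] v] x by (simp add: D_def)
    then show "smooth_limit M (at 0 within {r. x + r *\<^sub>R v \<in> S})
        (\<lambda>r p. (D vs (x + r *\<^sub>R v) p - D vs x p) /\<^sub>R r) (D (v # vs) x)"
      by (simp add: directional_derivative_def)
  qed (use C smooth cont in \<open>auto simp: D_def\<close>)
qed

lemma smooth_intoE:
  assumes "smooth_into M S u"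
  obtains D where "\<And>x. x \<in> S \<Longrightarrow> D [] x = u x"
    and "\<And>vs x. set vs \<subseteq> Basis \<Longrightarrow> x \<in> S \<Longrightarrow> D vs x \<in> smooth_maps M"
    and "\<And>vs x. set vs \<subseteq> Basis \<Longrightarrow> x \<in> S \<Longrightarrow> smooth_limit M (at x within S) (D vs) (D vs x)"
    and "\<And>vs x v. set vs \<subseteq> Basis \<Longrightarrow> x \<in> S \<Longrightarrow> v \<in> Basis \<Longrightarrow>
      directional_derivative M S (D vs) v x (D (v # vs) x)"
  using assms unfolding smooth_into_def directional_derivative_def
proof (elim exE conjE, goal_cases)
  case (1 D)
  show ?case
    by (rule 1(1)[of D]) (use 1(2,3) in simp_all)
qed

lemma smooth_into_values: "smooth_into M S u \<Longrightarrow> x \<in> S \<Longrightarrow> u x \<in> smooth_maps M"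
  by (erule smooth_intoE) (metis empty_set empty_subsetI)

lemma smooth_into_continuous:
  assumes "smooth_into M S u" "x \<in> S"
  shows "smooth_limit M (at x within S) u (u x)"
  using assms(1)
proof (rule smooth_intoE)
  fix D
  assume D: "\<And>x. x \<in> S \<Longrightarrow> D [] x = u x"
    "\<And>vs x. set vs \<subseteq> Basis \<Longrightarrow> x \<in> S \<Longrightarrow> smooth_limit M (at x within S) (D vs) (D vs x)"
  have "smooth_limit M (at x within S) (D []) (u x)"
    using D(2)[of "[]" x] D(1) assms(2) by simp
  then show ?thesis
    by (rule smooth_limit_cong) (rule eventually_mono[OF eventually_at_within_mem], rule D)
qed

text \<open>The witness for the derivative consists of the higher derivatives whose innermost direction is \<open>v\<close>,
  which is why \<open>v\<close> is appended at the end of the list.\<close>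

lemma smooth_into_derivative:
  fixes u :: "'e::euclidean_space \<Rightarrow> 'a::topological_space \<Rightarrow> 'b::real_normed_vector"
  assumes "smooth_into M S u" "v \<in> Basis"
  obtains w where "smooth_into M S w" "\<And>x. x \<in> S \<Longrightarrow> directional_derivative M S u v x (w x)"
  using assms(1)
proof (rule smooth_intoE)
  fix D :: "'e list \<Rightarrow> 'e \<Rightarrow> 'a \<Rightarrow> 'b"
  assume D: "\<And>x. x \<in> S \<Longrightarrow> D [] x = u x"
    "\<And>vs x. set vs \<subseteq> Basis \<Longrightarrow> x \<in> S \<Longrightarrow> D vs x \<in> smooth_maps M"
    "\<And>vs x. set vs \<subseteq> Basis \<Longrightarrow> x \<in> S \<Longrightarrow> smooth_limit M (at x within S) (D vs) (D vs x)"
    "\<And>vs x v. set vs \<subseteq> Basis \<Longrightarrow> x \<in> S \<Longrightarrow> v \<in> Basis \<Longrightarrow>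
      directional_derivative M S (D vs) v x (D (v # vs) x)"
  show thesis
  proof (rule that[of "D [v]"])
    show "smooth_into M S (D [v])"
      unfolding smooth_into_def
    proof (intro exI[of _ "\<lambda>vs. D (vs @ [v])"] conjI allI impI ballI)
      fix vs :: "'e list" and x v' :: 'e
      assume *: "set vs \<subseteq> Basis" "x \<in> S"
      then have vs: "set (vs @ [v]) \<subseteq> Basis"
        using assms(2) by simp
      show "D (vs @ [v]) x \<in> smooth_maps M"
        "smooth_limit M (at x within S) (D (vs @ [v])) (D (vs @ [v]) x)"
        using D(2,3)[OF vs *(2)] .
      assume "v' \<in> (Basis :: 'e set)"
      then show "smooth_limit M (at 0 within {r. x + r *\<^sub>R v' \<in> S})
         (\<lambda>r p. (D (vs @ [v]) (x + r *\<^sub>R v') p - D (vs @ [v]) x p) /\<^sub>R r) (D ((v' # vs) @ [v]) x)"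
        using D(4)[OF vs *(2)] by (simp add: directional_derivative_def)
    qed simp
    show "directional_derivative M S u v x (D [v] x)" if "x \<in> S" for x
      by (rule directional_derivative_cong[OF D(4)[of "[]" x v]])
         (use that D(1) assms(2) in simp_all)
  qed
qed

lemma directional_derivative_subset:
  assumes "directional_derivative M S u v x w" "T \<subseteq> S"
  shows "directional_derivative M T u v x w"
  using assms(1) unfolding directional_derivative_def
  by (rule smooth_limit_mono) (use assms(2) in \<open>auto intro!: at_le\<close>)

lemma smooth_into_subset:
  fixes u :: "'e::euclidean_space \<Rightarrow> 'a::topological_space \<Rightarrow> 'b::real_normed_vector"
  assumes "smooth_into M S u" "T \<subseteq> S"
  shows "smooth_into M T u"
proof (rule smooth_into_coinduct[where C = "smooth_into M S"])
  fix u :: "'e \<Rightarrow> 'a \<Rightarrow> 'b" and x v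
  assume u: "smooth_into M S u"
  show "u x \<in> smooth_maps M" if "x \<in> T"
    using smooth_into_values[OF u] that assms(2) by blast
  show "smooth_limit M (at x within T) u (u x)" if "x \<in> T"
    using smooth_into_continuous[OF u] that assms(2) by (blast intro: smooth_limit_mono at_le)
  assume "v \<in> (Basis :: 'e set)"
  then show "\<exists>w. smooth_into M S w \<and> (\<forall>x\<in>T. directional_derivative M T u v x (w x))"
    by (metis smooth_into_derivative[OF u] directional_derivative_subset assms(2) subsetD)
qed (fact assms)

lemma smooth_into_const:
  fixes h :: "'a::topological_space \<Rightarrow> 'b::real_normed_vector"
  assumes "h \<in> smooth_maps M"
  shows "smooth_into M (S :: 'e::euclidean_space set) (\<lambda>_. h)"
proof (rule smooth_into_coinduct[where C = "\<lambda>u. \<exists>h\<in>smooth_maps M. u = (\<lambda>_. h)"])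
  fix u :: "'e \<Rightarrow> 'a \<Rightarrow> 'b" and x v
  assume "\<exists>h\<in>smooth_maps M. u = (\<lambda>_. h)"
  then obtain h where u: "u = (\<lambda>_. h)" "h \<in> smooth_maps M" by blast
  show "u x \<in> smooth_maps M" "smooth_limit M (at x within S) u (u x)"
    using u by (auto intro: smooth_limit_const)
  have "directional_derivative M S u v x (\<lambda>_. 0)" for x
    using smooth_limit_const[of M _ "\<lambda>_. 0 :: 'b"] by (simp add: directional_derivative_def u)
  moreover have "(\<lambda>_. 0 :: 'b) \<in> smooth_maps M"
    by (simp add: smooth_maps_def in_chart_def comp_def smooth_coord_const)
  ultimately show "\<exists>w. (\<exists>h\<in>smooth_maps M. w = (\<lambda>_. h)) \<and>
      (\<forall>x\<in>S. directional_derivative M S u v x (w x))"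
    by (intro exI[of _ "\<lambda>_ _. 0"]) auto
qed (use assms in auto)

text \<open>The scalar coefficients that occur below: a class of smooth functions that is visibly closed
  under partial derivatives.\<close>

inductive elementary :: "('e::euclidean_space \<Rightarrow> real) \<Rightarrow> bool" where
  const: "elementary (\<lambda>_. a)"
| inner: "elementary (\<lambda>x. x \<bullet> e)"
| add: "elementary g \<Longrightarrow> elementary h \<Longrightarrow> elementary (\<lambda>x. g x + h x)"
| mult: "elementary g \<Longrightarrow> elementary h \<Longrightarrow> elementary (\<lambda>x. g x * h x)"
| sin: "elementary g \<Longrightarrow> elementary (\<lambda>x. sin (g x))"
| cos: "elementary g \<Longrightarrow> elementary (\<lambda>x. cos (g x))"

lemma elementary_diff: "elementary g \<Longrightarrow> elementary h \<Longrightarrow> elementary (\<lambda>x. g x - h x)"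
  using elementary.add[of g "\<lambda>x. (-1) * h x"] elementary.mult[OF elementary.const[of "-1"], of h]
  by simp

lemma elementary_continuous: "elementary g \<Longrightarrow> continuous_on S g"
  by (induction rule: elementary.induct) (auto intro!: continuous_intros)

lemma elementary_polynomial:
  assumes "real_polynomial_function q" "elementary g"
  shows "elementary (\<lambda>x. q (g x :: real))"
  using assms(1)
proof induction
  case (linear f)
  have *: "f y = y * f 1" for y
    using linear_scale[OF bounded_linear.linear[OF linear], of y 1] by simp
  have "(\<lambda>x. f (g x)) = (\<lambda>x. g x * f 1)"
    by (rule ext) (rule *)
  with elementary.mult[OF assms(2) elementary.const[of "f 1"]] show ?case
    by (simp only:)
next
  case (const c)
  show ?case by (rule elementary.const)
next
  case (add f h)
  then show ?case by (intro elementary.add)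
next
  case (mult f h)
  then show ?case by (intro elementary.mult)
qed

lemma elementary_derivative:
  assumes "elementary g"
  shows "\<exists>g'. elementary g' \<and>
    (\<forall>x. ((\<lambda>r. g (x + r *\<^sub>R v)) has_real_derivative g' x) (at 0))"
  using assms
proof induction
  case (const a)
  show ?case by (intro exI[of _ "\<lambda>_. 0"] conjI elementary.const) simp
next
  case (inner e)
  show ?case
    by (intro exI[of _ "\<lambda>_. v \<bullet> e"] conjI elementary.const)
       (auto intro!: derivative_eq_intros simp: inner_add_left)
next
  case (add g h)
  then obtain g' h' where *: "elementary g'" "elementary h'"
    "\<And>x. ((\<lambda>r. g (x + r *\<^sub>R v)) has_real_derivative g' x) (at 0)"
    "\<And>x. ((\<lambda>r. h (x + r *\<^sub>R v)) has_real_derivative h' x) (at 0)" by metis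
  show ?case
    by (intro exI[of _ "\<lambda>x. g' x + h' x"] conjI elementary.add * allI DERIV_add)
next
  case (mult g h)
  then obtain g' h' where *: "elementary g'" "elementary h'"
    "\<And>x. ((\<lambda>r. g (x + r *\<^sub>R v)) has_real_derivative g' x) (at 0)"
    "\<And>x. ((\<lambda>r. h (x + r *\<^sub>R v)) has_real_derivative h' x) (at 0)" by metis
  have "((\<lambda>r. g (x + r *\<^sub>R v) * h (x + r *\<^sub>R v)) has_real_derivative g' x * h x + h' x * g x) (at 0)"
    for x using DERIV_mult[OF *(3,4)[of x]] by simp
  then show ?case
    by (intro exI[of _ "\<lambda>x. g' x * h x + h' x * g x"] conjI elementary.add elementary.mult allI
        * mult.hyps)
next
  case (sin g)
  then obtain g' where *: "elementary g'"
    "\<And>x. ((\<lambda>r. g (x + r *\<^sub>R v)) has_real_derivative g' x) (at 0)" by metis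
  have "((\<lambda>r. sin (g (x + r *\<^sub>R v))) has_real_derivative cos (g x) * g' x) (at 0)" for x
    using DERIV_fun_sin[OF *(2)[of x]] by simp
  then show ?case
    by (intro exI[of _ "\<lambda>x. cos (g x) * g' x"] conjI elementary.mult elementary.cos allI * sin.hyps)
next
  case (cos g)
  then obtain g' where *: "elementary g'"
    "\<And>x. ((\<lambda>r. g (x + r *\<^sub>R v)) has_real_derivative g' x) (at 0)" by metis
  have "((\<lambda>r. cos (g (x + r *\<^sub>R v))) has_real_derivative ((-1) * sin (g x)) * g' x) (at 0)" for x
    using DERIV_fun_cos[OF *(2)[of x]] by simp
  then show ?case
    by (intro exI[of _ "\<lambda>x. ((-1) * sin (g x)) * g' x"] conjI elementary.mult elementary.sin allI
        * cos.hyps elementary.const)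
qed

context closed_manifold
begin

lemma smooth_limit_lincomb:
  assumes u: "smooth_limit M F u l" and w: "smooth_limit M F w m"
    and ev: "\<forall>\<^sub>F s in F. u s \<in> smooth_maps M" "\<forall>\<^sub>F s in F. w s \<in> smooth_maps M"
    and lm: "l \<in> smooth_maps M" "m \<in> smooth_maps M"
    and L: "bounded_linear L" "bounded_linear L'"
  shows "smooth_limit M F (\<lambda>s p. L (u s p) + L' (w s p)) (\<lambda>p. L (l p) + L' (m p))"
  unfolding smooth_limit_def
proof (intro ballI allI impI)
  fix c K js
  assume c: "c \<in> atlas M" and K: "compact K \<and> K \<subseteq> fst c \<and> set js \<subseteq> {..<mdim M}"
  then have sub: "snd c ` K \<subseteq> chart_image c"
    using compact_chart_image by blast
  have "uniform_limit (snd c ` K)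
      (\<lambda>s x. L (partial_derivs js (in_chart c (u s)) x) + L' (partial_derivs js (in_chart c (w s)) x))
      (\<lambda>x. L (partial_derivs js (in_chart c l) x) + L' (partial_derivs js (in_chart c m) x)) F"
    using u w c K unfolding smooth_limit_def
    by (intro uniform_limit_add bounded_linear.uniform_limit[OF L(1)]
        bounded_linear.uniform_limit[OF L(2)]) blast+
  then show "uniform_limit (snd c ` K)
      (\<lambda>s. partial_derivs js (in_chart c (\<lambda>p. L (u s p) + L' (w s p))))
      (partial_derivs js (in_chart c (\<lambda>p. L (l p) + L' (m p)))) F"
  proof (rule iffD1[OF uniform_limit_cong, rotated 2])
    show "\<forall>\<^sub>F s in F. \<forall>x\<in>snd c ` K.
        L (partial_derivs js (in_chart c (u s)) x) + L' (partial_derivs js (in_chart c (w s)) x)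
        = partial_derivs js (in_chart c (\<lambda>p. L (u s p) + L' (w s p))) x"
      using ev
    proof eventually_elim
      case (elim s)
      show ?case
        using partial_derivs_chart_lincomb[OF elim L c] K sub by (metis subsetD)
    qed
    show "L (partial_derivs js (in_chart c l) x) + L' (partial_derivs js (in_chart c m) x)
        = partial_derivs js (in_chart c (\<lambda>p. L (l p) + L' (m p))) x" if "x \<in> snd c ` K" for x
      using partial_derivs_chart_lincomb[OF lm L c] K sub that by (metis subsetD)
  qed
qed

lemma smooth_limit_add:
  assumes "smooth_limit M F u l" "smooth_limit M F w m"
    and "\<forall>\<^sub>F s in F. u s \<in> smooth_maps M" "\<forall>\<^sub>F s in F. w s \<in> smooth_maps M"
    and "l \<in> smooth_maps M" "m \<in> smooth_maps M"
  shows "smooth_limit M F (\<lambda>s p. u s p + w s p) (\<lambda>p. l p + m p)"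
  by (rule smooth_limit_lincomb[OF assms bounded_linear_ident bounded_linear_ident])

text \<open>A product of uniform limits is a uniform limit when the limits are bounded; here they are, because
  the derivatives of a smooth map are continuous on compact sets.\<close>

lemma smooth_limit_scale:
  assumes g: "(g \<longlongrightarrow> (g0::real)) F" and u: "smooth_limit M F u l"
    and ev: "\<forall>\<^sub>F s in F. u s \<in> smooth_maps M" and l: "l \<in> smooth_maps M"
  shows "smooth_limit M F (\<lambda>s p. g s *\<^sub>R u s p) (\<lambda>p. g0 *\<^sub>R l p)"
  unfolding smooth_limit_def
proof (intro ballI allI impI)
  fix c K js
  assume c: "c \<in> atlas M" and K: "compact K \<and> K \<subseteq> fst c \<and> set js \<subseteq> {..<mdim M}"
  then have sub: "snd c ` K \<subseteq> chart_image c" and cpt: "compact (snd c ` K)"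
    using compact_chart_image by blast+
  have pd: "partial_derivs js (in_chart c (\<lambda>p. r *\<^sub>R h p)) x = r *\<^sub>R partial_derivs js (in_chart c h) x"
    if "h \<in> smooth_maps M" "x \<in> snd c ` K" for h :: "'a \<Rightarrow> 'c" and r x
    using partial_derivs_chart_lincomb[OF that(1) smooth_maps_const[of "0::'c"]
        bounded_linear_scaleR_right[of r] bounded_linear_zero c, of js x] K sub that(2)
    by auto
  have "bounded (partial_derivs js (in_chart c l) ` (snd c ` K))"
    by (intro compact_imp_bounded compact_continuous_image cpt
        continuous_on_subset[OF continuous_partial_derivs[OF l c] sub]) (use K in blast)
  moreover have "uniform_limit (snd c ` K) (\<lambda>s x. g s) (\<lambda>x. g0) F"
    by (rule uniform_limitI) (use tendstoD[OF g] in \<open>auto elim: eventually_mono\<close>)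
  moreover have "bounded ((\<lambda>x. g0) ` snd c ` K)"
    by (rule bounded_subset[of "{g0}"]) auto
  ultimately have "uniform_limit (snd c ` K)
      (\<lambda>s x. g s *\<^sub>R partial_derivs js (in_chart c (u s)) x)
      (\<lambda>x. g0 *\<^sub>R partial_derivs js (in_chart c l) x) F"
    using u c K unfolding smooth_limit_def
    by (intro bounded_bilinear.bounded_uniform_limit[OF bounded_bilinear_scaleR]) blast+
  then show "uniform_limit (snd c ` K) (\<lambda>s. partial_derivs js (in_chart c (\<lambda>p. g s *\<^sub>R u s p)))
      (partial_derivs js (in_chart c (\<lambda>p. g0 *\<^sub>R l p))) F"
  proof (rule iffD1[OF uniform_limit_cong, rotated 2])
    show "\<forall>\<^sub>F s in F. \<forall>x\<in>snd c ` K. g s *\<^sub>R partial_derivs js (in_chart c (u s)) x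
        = partial_derivs js (in_chart c (\<lambda>p. g s *\<^sub>R u s p)) x"
      using ev by (rule eventually_mono) (simp add: pd)
  qed (simp add: pd l)
qed

lemma eventually_smooth_at:
  assumes "\<And>x. x \<in> S \<Longrightarrow> u x \<in> smooth_maps M"
  shows "\<forall>\<^sub>F s in at x within S. u s \<in> smooth_maps M"
  by (rule eventually_mono[OF eventually_at_within_mem assms])

lemma smooth_maps_diff_quotient:
  assumes "h \<in> smooth_maps M" "k \<in> smooth_maps M"
  shows "(\<lambda>p. (h p - k p) /\<^sub>R r) \<in> smooth_maps M"
  using smooth_maps_lincomb[OF assms bounded_linear_scaleR_right[of "inverse r"]
      bounded_linear_scaleR_right[of "- inverse r"]]
  by (simp add: scaleR_diff_right)

lemma directional_derivative_lincomb:
  assumes u: "directional_derivative M S u v x u'" and w: "directional_derivative M S w v x w'"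
    and x: "x \<in> S"
    and sm: "\<And>y. y \<in> S \<Longrightarrow> u y \<in> smooth_maps M" "\<And>y. y \<in> S \<Longrightarrow> w y \<in> smooth_maps M"
    and "u' \<in> smooth_maps M" "w' \<in> smooth_maps M"
    and L: "bounded_linear L" "bounded_linear L'"
  shows "directional_derivative M S (\<lambda>y p. L (u y p) + L' (w y p)) v x (\<lambda>p. L (u' p) + L' (w' p))"
proof -
  have "smooth_limit M (at 0 within {r. x + r *\<^sub>R v \<in> S})
     (\<lambda>r p. L ((u (x + r *\<^sub>R v) p - u x p) /\<^sub>R r) + L' ((w (x + r *\<^sub>R v) p - w x p) /\<^sub>R r))
     (\<lambda>p. L (u' p) + L' (w' p))"
    using assms unfolding directional_derivative_def
    by (intro smooth_limit_lincomb eventually_smooth_at smooth_maps_diff_quotient) auto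
  moreover have "L ((u (x + r *\<^sub>R v) p - u x p) /\<^sub>R r) + L' ((w (x + r *\<^sub>R v) p - w x p) /\<^sub>R r)
      = (L (u (x + r *\<^sub>R v) p) + L' (w (x + r *\<^sub>R v) p) - (L (u x p) + L' (w x p))) /\<^sub>R r" for r p
    by (simp add: linear_diff[OF bounded_linear.linear[OF L(1)]]
        linear_diff[OF bounded_linear.linear[OF L(2)]] linear_scale[OF bounded_linear.linear[OF L(1)]]
        linear_scale[OF bounded_linear.linear[OF L(2)]] algebra_simps)
  ultimately show ?thesis
    unfolding directional_derivative_def by simp
qed

lemma smooth_into_lincomb:
  fixes u :: "'e::euclidean_space \<Rightarrow> 'a \<Rightarrow> 'b::real_normed_vector"
    and w :: "'e \<Rightarrow> 'a \<Rightarrow> 'c::real_normed_vector"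
    and L :: "'b \<Rightarrow> 'd::real_normed_vector"
  assumes u: "smooth_into M S u" and w: "smooth_into M S w"
    and L: "bounded_linear L" "bounded_linear L'"
  shows "smooth_into M S (\<lambda>x p. L (u x p) + L' (w x p))"
proof (rule smooth_into_coinduct[where C = "\<lambda>z. \<exists>u w. smooth_into M S u \<and> smooth_into M S w \<and>
      z = (\<lambda>x p. L (u x p) + L' (w x p))"])
  fix z :: "'e \<Rightarrow> 'a \<Rightarrow> 'd" and x v
  assume "\<exists>u w. smooth_into M S u \<and> smooth_into M S w \<and> z = (\<lambda>x p. L (u x p) + L' (w x p))"
  then obtain u w where u: "smooth_into M S u" and w: "smooth_into M S w"
    and z: "z = (\<lambda>x p. L (u x p) + L' (w x p))" by blast
  show "z x \<in> smooth_maps M" if "x \<in> S"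
    unfolding z by (intro smooth_maps_lincomb smooth_into_values[OF u] smooth_into_values[OF w] L that)
  show "smooth_limit M (at x within S) z (z x)" if "x \<in> S"
    unfolding z
    by (intro smooth_limit_lincomb smooth_into_continuous[OF u] smooth_into_continuous[OF w]
        eventually_smooth_at smooth_into_values[OF u] smooth_into_values[OF w] L that)
  assume v: "v \<in> (Basis :: 'e set)"
  obtain u' where u': "smooth_into M S u'" "\<And>x. x \<in> S \<Longrightarrow> directional_derivative M S u v x (u' x)"
    using smooth_into_derivative[OF u v] by blast
  obtain w' where w': "smooth_into M S w'" "\<And>x. x \<in> S \<Longrightarrow> directional_derivative M S w v x (w' x)"
    using smooth_into_derivative[OF w v] by blast
  show "\<exists>z'. (\<exists>u w. smooth_into M S u \<and> smooth_into M S w \<and> z' = (\<lambda>x p. L (u x p) + L' (w x p)))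
      \<and> (\<forall>x\<in>S. directional_derivative M S z v x (z' x))"
  proof (intro exI conjI ballI)
    show "smooth_into M S u'" "smooth_into M S w'" by fact+
    show "directional_derivative M S z v x (\<lambda>p. L (u' x p) + L' (w' x p))" if "x \<in> S" for x
      unfolding z
      by (intro directional_derivative_lincomb u' w' smooth_into_values[OF u] smooth_into_values[OF w]
          smooth_into_values[OF u'(1)] smooth_into_values[OF w'(1)] L that)
  qed simp
qed (use assms in blast)

lemma smooth_into_add:
  "smooth_into M S u \<Longrightarrow> smooth_into M S w \<Longrightarrow> smooth_into M S (\<lambda>x p. u x p + w x p)"
  by (rule smooth_into_lincomb[OF _ _ bounded_linear_ident bounded_linear_ident])

lemma smooth_into_linear:
  assumes "smooth_into M S u" "bounded_linear L"
  shows "smooth_into M S (\<lambda>x p. L (u x p))"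
  using smooth_into_lincomb[OF assms(1) assms(1) assms(2) bounded_linear_zero] by simp

lemma filterlim_at_0_line:
  assumes "continuous_on UNIV (\<rho> :: 'e::euclidean_space \<Rightarrow> real)" "\<rho> ` S \<subseteq> T"
  shows "filterlim (\<lambda>r. \<rho> (x + r *\<^sub>R v)) (sup (at (\<rho> x) within T) (principal {\<rho> x}))
      (at 0 within {r. x + r *\<^sub>R v \<in> S})"
proof -
  have "((\<lambda>r. \<rho> (x + r *\<^sub>R v)) \<longlongrightarrow> \<rho> (x + 0 *\<^sub>R v)) (at 0)"
    by (intro continuous_within_tendsto_compose'[OF continuous_on_imp_continuous_within[OF assms(1)]] tendsto_intros) auto
  then have lim: "((\<lambda>r. \<rho> (x + r *\<^sub>R v)) \<longlongrightarrow> \<rho> x) (at 0 within {r. x + r *\<^sub>R v \<in> S})"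
    by (simp add: tendsto_within_subset[of _ _ _ UNIV])
  show ?thesis
    unfolding filterlim_iff
  proof (intro allI impI)
    fix P
    assume "eventually P (sup (at (\<rho> x) within T) (principal {\<rho> x}))"
    then have "\<forall>\<^sub>F y in nhds (\<rho> x). y \<in> T \<longrightarrow> P y"
      by (auto simp: eventually_sup eventually_principal eventually_at_filter elim: eventually_mono)
    then have "\<forall>\<^sub>F r in at 0 within {r. x + r *\<^sub>R v \<in> S}. \<rho> (x + r *\<^sub>R v) \<in> T \<longrightarrow> P (\<rho> (x + r *\<^sub>R v))"
      using eventually_compose_filterlim[OF _ lim] by blast
    then show "\<forall>\<^sub>F r in at 0 within {r. x + r *\<^sub>R v \<in> S}. P (\<rho> (x + r *\<^sub>R v))"
      using eventually_at_within_mem[of "{r. x + r *\<^sub>R v \<in> S}" 0]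
      by eventually_elim (use assms(2) in auto)
  qed
qed

text \<open>Product and chain rule. The inner function may return to its value at \<open>x\<close> arbitrarily close to
  \<open>x\<close>, where the difference quotient of the outer curve is undefined. Caratheodory's device
  handles this: the quotient \<open>Q\<close>, completed by the derivative \<open>\<beta>\<close>, satisfies
  \<open>\<alpha>(z) - \<alpha>(y) = (z - y) Q(z)\<close> everywhere.\<close>

lemma directional_derivative_scale_comp:
  fixes \<alpha> :: "real \<Rightarrow> 'a \<Rightarrow> 'b::real_normed_vector" and g \<rho> :: "'e::euclidean_space \<Rightarrow> real"
  assumes \<alpha>: "smooth_into M T \<alpha>" and \<alpha>': "directional_derivative M T \<alpha> 1 (\<rho> x) \<beta>"
    and \<beta>: "\<beta> \<in> smooth_maps M"
    and \<rho>: "continuous_on UNIV \<rho>" "\<rho> ` S \<subseteq> T" and x: "x \<in> S"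
    and g': "((\<lambda>r. g (x + r *\<^sub>R v)) has_real_derivative g') (at 0)"
    and \<rho>': "((\<lambda>r. \<rho> (x + r *\<^sub>R v)) has_real_derivative \<rho>') (at 0)"
  shows "directional_derivative M S (\<lambda>x p. g x *\<^sub>R \<alpha> (\<rho> x) p) v x
      (\<lambda>p. g' *\<^sub>R \<alpha> (\<rho> x) p + (g x * \<rho>') *\<^sub>R \<beta> p)"
proof -
  define F where "F = at (0::real) within {r. x + r *\<^sub>R v \<in> S}"
  define y where "y = \<rho> x"
  define G where "G = sup (at y within T) (principal {y})"
  have y: "y \<in> T" using \<rho>(2) x by (auto simp: y_def)
  define Q where "Q = (\<lambda>z p. if z = y then \<beta> p else (\<alpha> z p - \<alpha> y p) /\<^sub>R (z - y))"
  note sm = smooth_into_values[OF \<alpha>]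
  have Q_smooth: "Q z \<in> smooth_maps M" if "z \<in> T" for z
  proof (cases "z = y")
    case True
    then have "Q z = \<beta>" by (simp add: Q_def)
    with \<beta> show ?thesis by (simp only:)
  next
    case False
    then have "Q z = (\<lambda>p. (\<alpha> z p - \<alpha> y p) /\<^sub>R (z - y))" by (simp add: Q_def)
    with smooth_maps_diff_quotient[OF sm[OF that] sm[OF y]] show ?thesis by (simp only:)
  qed
  have lim\<rho>: "filterlim (\<lambda>r. \<rho> (x + r *\<^sub>R v)) G F"
    unfolding F_def G_def y_def by (rule filterlim_at_0_line[OF \<rho>])
  have "filterlim (\<lambda>z. z - y) (at 0 within {r. y + r *\<^sub>R 1 \<in> T}) (at y within T)"
    unfolding filterlim_at
    by (auto simp: eventually_at_filter intro!: tendsto_eq_intros)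
  from smooth_limit_filterlim[OF \<alpha>'[unfolded directional_derivative_def, folded y_def] this]
  have "smooth_limit M (at y within T) (\<lambda>z p. (\<alpha> z p - \<alpha> y p) /\<^sub>R (z - y)) \<beta>"
    by simp
  then have "smooth_limit M (at y within T) Q \<beta>"
    by (rule smooth_limit_cong) (auto simp: eventually_at_filter Q_def)
  then have Q: "smooth_limit M F (\<lambda>r. Q (\<rho> (x + r *\<^sub>R v))) \<beta>"
    by (intro smooth_limit_filterlim[OF _ lim\<rho>]) (simp add: G_def smooth_limit_principal Q_def)
  have A: "smooth_limit M F (\<lambda>r. \<alpha> (\<rho> (x + r *\<^sub>R v))) (\<alpha> y)"
    by (intro smooth_limit_filterlim[OF _ lim\<rho>])
       (simp add: G_def smooth_limit_principal smooth_into_continuous[OF \<alpha> y])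
  have inT: "\<forall>\<^sub>F r in F. \<rho> (x + r *\<^sub>R v) \<in> T"
    unfolding F_def by (rule eventually_mono[OF eventually_at_within_mem]) (use \<rho>(2) in auto)
  have quot: "((\<lambda>r. (g (x + r *\<^sub>R v) - g x) / r) \<longlongrightarrow> g') F"
      "((\<lambda>r. (\<rho> (x + r *\<^sub>R v) - \<rho> x) / r) \<longlongrightarrow> \<rho>') F"
    using g' \<rho>' unfolding F_def has_field_derivative_iff
    by (auto intro: tendsto_within_subset[OF _ subset_UNIV])
  have quot': "((\<lambda>r. g x * ((\<rho> (x + r *\<^sub>R v) - \<rho> x) / r)) \<longlongrightarrow> g x * \<rho>') F"
    by (rule tendsto_mult[OF tendsto_const quot(2)])
  have evA: "\<forall>\<^sub>F r in F. \<alpha> (\<rho> (x + r *\<^sub>R v)) \<in> smooth_maps M"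
    and evQ: "\<forall>\<^sub>F r in F. Q (\<rho> (x + r *\<^sub>R v)) \<in> smooth_maps M"
    by (rule eventually_mono[OF inT], erule sm Q_smooth)+
  have "smooth_limit M F
      (\<lambda>r p. ((g (x + r *\<^sub>R v) - g x) / r) *\<^sub>R \<alpha> (\<rho> (x + r *\<^sub>R v)) p
         + (g x * ((\<rho> (x + r *\<^sub>R v) - \<rho> x) / r)) *\<^sub>R Q (\<rho> (x + r *\<^sub>R v)) p)
      (\<lambda>p. g' *\<^sub>R \<alpha> y p + (g x * \<rho>') *\<^sub>R \<beta> p)"
  proof (rule smooth_limit_add)
    show "smooth_limit M F (\<lambda>r p. ((g (x + r *\<^sub>R v) - g x) / r) *\<^sub>R \<alpha> (\<rho> (x + r *\<^sub>R v)) p)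
        (\<lambda>p. g' *\<^sub>R \<alpha> y p)"
      by (rule smooth_limit_scale[OF quot(1) A evA sm[OF y]])
    show "smooth_limit M F (\<lambda>r p. (g x * ((\<rho> (x + r *\<^sub>R v) - \<rho> x) / r)) *\<^sub>R Q (\<rho> (x + r *\<^sub>R v)) p)
        (\<lambda>p. (g x * \<rho>') *\<^sub>R \<beta> p)"
      by (rule smooth_limit_scale[OF quot' Q evQ \<beta>])
    show "\<forall>\<^sub>F r in F. (\<lambda>p. ((g (x + r *\<^sub>R v) - g x) / r) *\<^sub>R \<alpha> (\<rho> (x + r *\<^sub>R v)) p) \<in> smooth_maps M"
      by (rule eventually_mono[OF evA]) (rule smooth_maps_scale)
    show "\<forall>\<^sub>F r in F. (\<lambda>p. (g x * ((\<rho> (x + r *\<^sub>R v) - \<rho> x) / r)) *\<^sub>R Q (\<rho> (x + r *\<^sub>R v)) p)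
        \<in> smooth_maps M"
      by (rule eventually_mono[OF evQ]) (rule smooth_maps_scale)
    show "(\<lambda>p. g' *\<^sub>R \<alpha> y p) \<in> smooth_maps M" "(\<lambda>p. (g x * \<rho>') *\<^sub>R \<beta> p) \<in> smooth_maps M"
      by (simp_all add: smooth_maps_scale sm y \<beta>)
  qed
  then have "smooth_limit M F
      (\<lambda>r p. (g (x + r *\<^sub>R v) *\<^sub>R \<alpha> (\<rho> (x + r *\<^sub>R v)) p - g x *\<^sub>R \<alpha> (\<rho> x) p) /\<^sub>R r)
      (\<lambda>p. g' *\<^sub>R \<alpha> y p + (g x * \<rho>') *\<^sub>R \<beta> p)"
  proof (rule smooth_limit_cong)
    have "((g (x + r *\<^sub>R v) - g x) / r) *\<^sub>R \<alpha> z p + (g x * ((z - y) / r)) *\<^sub>R Q z p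
        = (g (x + r *\<^sub>R v) *\<^sub>R \<alpha> z p - g x *\<^sub>R \<alpha> y p) /\<^sub>R r" for r z p
    proof -
      have Qz: "(z - y) *\<^sub>R Q z p = \<alpha> z p - \<alpha> y p"
        by (simp add: Q_def)
      have "(g x * ((z - y) / r)) *\<^sub>R Q z p = (g x / r) *\<^sub>R (\<alpha> z p - \<alpha> y p)"
        unfolding Qz[symmetric] by simp
      then show ?thesis
        by (simp add: divide_inverse scaleR_diff_left scaleR_diff_right right_diff_distrib mult.commute)
    qed
    then show "\<forall>\<^sub>F r in F.
      (\<lambda>p. ((g (x + r *\<^sub>R v) - g x) / r) *\<^sub>R \<alpha> (\<rho> (x + r *\<^sub>R v)) p
         + (g x * ((\<rho> (x + r *\<^sub>R v) - \<rho> x) / r)) *\<^sub>R Q (\<rho> (x + r *\<^sub>R v)) p)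
      = (\<lambda>p. (g (x + r *\<^sub>R v) *\<^sub>R \<alpha> (\<rho> (x + r *\<^sub>R v)) p - g x *\<^sub>R \<alpha> (\<rho> x) p) /\<^sub>R r)"
      unfolding y_def by (intro always_eventually allI ext)
  qed
  then show ?thesis
    by (simp add: directional_derivative_def F_def y_def)
qed

text \<open>The derivative of \<open>g(x) \<alpha>(\<rho>(x))\<close> is a sum of two terms of the same form, so sums of such
  families are closed under differentiation. This is the class to which the coinduction principle is
  applied.\<close>

inductive comp_span :: "'e::euclidean_space set \<Rightarrow> real set \<Rightarrow> ('e \<Rightarrow> real) \<Rightarrow>
    ('e \<Rightarrow> 'a \<Rightarrow> 'b::real_normed_vector) \<Rightarrow> bool" for S T \<rho> where
  atom: "elementary g \<Longrightarrow> smooth_into M T \<alpha> \<Longrightarrow> comp_span S T \<rho> (\<lambda>x p. g x *\<^sub>R \<alpha> (\<rho> x) p)"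
| add: "comp_span S T \<rho> u \<Longrightarrow> comp_span S T \<rho> w \<Longrightarrow> comp_span S T \<rho> (\<lambda>x p. u x p + w x p)"

lemma comp_span_values:
  assumes "comp_span S T \<rho> u" "x \<in> S" "\<rho> ` S \<subseteq> T"
  shows "u x \<in> smooth_maps M"
  using assms(1)
proof induction
  case (atom g \<alpha>)
  then show ?case
    using assms(2,3) by (intro smooth_maps_scale smooth_into_values[OF atom(2)]) auto
next
  case (add u w)
  then show ?case
    by (intro smooth_maps_add)
qed

text \<open>Used for two purposes: with \<open>\<rho>(s, t) = t\<close> to build variations of a curve, and with
  \<open>\<rho>(\<tau>) = p + q sin \<tau>\<close> to reparametrise a curve on a compact interval.\<close>

lemma smooth_into_scale_comp:
  fixes \<alpha> :: "real \<Rightarrow> 'a \<Rightarrow> 'b::real_normed_vector" and g \<rho> :: "'e::euclidean_space \<Rightarrow> real"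
  assumes \<alpha>: "smooth_into M T \<alpha>" and g: "elementary g" and \<rho>: "elementary \<rho>" "\<rho> ` S \<subseteq> T"
  shows "smooth_into M S (\<lambda>x p. g x *\<^sub>R \<alpha> (\<rho> x) p)"
proof (rule smooth_into_coinduct[where C = "comp_span S T \<rho>"])
  note cont\<rho> = elementary_continuous[OF \<rho>(1), of UNIV]
  fix u :: "'e \<Rightarrow> 'a \<Rightarrow> 'b" and v :: 'e
  assume u: "comp_span S T \<rho> u"
  show sm: "u x \<in> smooth_maps M" if "x \<in> S" for x
    by (rule comp_span_values[OF u that \<rho>(2)])
  show "smooth_limit M (at x within S) u (u x)" if "x \<in> S" for x
    using u
  proof induction
    case (atom g \<alpha>)
    have "filterlim \<rho> (sup (at (\<rho> x) within T) (principal {\<rho> x})) (at x within S)"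
      unfolding filterlim_iff
    proof (intro allI impI)
      fix P
      assume "eventually P (sup (at (\<rho> x) within T) (principal {\<rho> x}))"
      then have "\<forall>\<^sub>F y in nhds (\<rho> x). y \<in> T \<longrightarrow> P y"
        by (auto simp: eventually_sup eventually_principal eventually_at_filter elim: eventually_mono)
      moreover have lim: "(\<rho> \<longlongrightarrow> \<rho> x) (at x within S)"
        using elementary_continuous[OF \<rho>(1), of S] that by (simp add: continuous_on)
      ultimately have "\<forall>\<^sub>F y in at x within S. \<rho> y \<in> T \<longrightarrow> P (\<rho> y)"
        using eventually_compose_filterlim[OF _ lim] by blast
      then show "\<forall>\<^sub>F y in at x within S. P (\<rho> y)"
        using eventually_at_within_mem[of S x] by eventually_elim (use \<rho>(2) in auto)
    qed
    moreover have "smooth_limit M (sup (at (\<rho> x) within T) (principal {\<rho> x})) \<alpha> (\<alpha> (\<rho> x))"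
      using \<rho>(2) that by (intro smooth_limit_principal smooth_into_continuous atom) auto
    ultimately have "smooth_limit M (at x within S) (\<lambda>x. \<alpha> (\<rho> x)) (\<alpha> (\<rho> x))"
      by (rule smooth_limit_filterlim[rotated])
    moreover have "(g \<longlongrightarrow> g x) (at x within S)"
      using elementary_continuous[OF atom(1), of S] that by (simp add: continuous_on)
    ultimately show ?case
      using \<rho>(2) that
      by (intro smooth_limit_scale eventually_smooth_at smooth_into_values[OF atom(2)]) auto
  next
    case (add u w)
    then show ?case
      using smooth_limit_add[OF add.IH eventually_smooth_at eventually_smooth_at
          comp_span_values[OF add.hyps(1) that \<rho>(2)] comp_span_values[OF add.hyps(2) that \<rho>(2)]]
        comp_span_values[OF add.hyps(1) _ \<rho>(2)] comp_span_values[OF add.hyps(2) _ \<rho>(2)] by blast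
  qed
  assume v: "v \<in> Basis"
  show "\<exists>w. comp_span S T \<rho> w \<and> (\<forall>x\<in>S. directional_derivative M S u v x (w x))"
    using u
  proof induction
    case (atom g \<alpha>)
    obtain g' where g': "elementary g'" "\<And>x. ((\<lambda>r. g (x + r *\<^sub>R v)) has_real_derivative g' x) (at 0)"
      using elementary_derivative[OF atom(1)] by blast
    obtain \<rho>' where \<rho>': "elementary \<rho>'"
        "\<And>x. ((\<lambda>r. \<rho> (x + r *\<^sub>R v)) has_real_derivative \<rho>' x) (at 0)"
      using elementary_derivative[OF \<rho>(1)] by blast
    obtain \<alpha>' where \<alpha>': "smooth_into M T \<alpha>'"
        "\<And>t. t \<in> T \<Longrightarrow> directional_derivative M T \<alpha> 1 t (\<alpha>' t)"
      using smooth_into_derivative[OF atom(2), of 1] by auto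
    show ?case
    proof (intro exI conjI ballI)
      show "comp_span S T \<rho> (\<lambda>x p. g' x *\<^sub>R \<alpha> (\<rho> x) p + (g x * \<rho>' x) *\<^sub>R \<alpha>' (\<rho> x) p)"
        by (intro comp_span.intros elementary.mult atom g' \<rho>' \<alpha>')
      show "directional_derivative M S (\<lambda>x p. g x *\<^sub>R \<alpha> (\<rho> x) p) v x
          (\<lambda>p. g' x *\<^sub>R \<alpha> (\<rho> x) p + (g x * \<rho>' x) *\<^sub>R \<alpha>' (\<rho> x) p)" if "x \<in> S" for x
        using that \<rho>(2)
        by (intro directional_derivative_scale_comp[OF atom(2)] \<alpha>' cont\<rho> g' \<rho>'
            smooth_into_values[OF \<alpha>'(1)]) auto
    qed
  next
    case (add u w)
    from add obtain u' w' where uw': "comp_span S T \<rho> u'" "comp_span S T \<rho> w'"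
      "\<forall>x\<in>S. directional_derivative M S u v x (u' x)" "\<forall>x\<in>S. directional_derivative M S w v x (w' x)"
      by blast
    show ?case
    proof (intro exI conjI ballI)
      show "comp_span S T \<rho> (\<lambda>x p. u' x p + w' x p)"
        by (intro comp_span.add uw')
      show "directional_derivative M S (\<lambda>x p. u x p + w x p) v x (\<lambda>p. u' x p + w' x p)"
        if "x \<in> S" for x
        using uw'(3,4) that
          comp_span_values[OF add.hyps(1) _ \<rho>(2)] comp_span_values[OF add.hyps(2) _ \<rho>(2)]
          comp_span_values[OF uw'(1) that \<rho>(2)] comp_span_values[OF uw'(2) that \<rho>(2)]
        by (intro directional_derivative_lincomb[where L = "\<lambda>x. x" and L' = "\<lambda>x. x" and u = u
              and w = w and u' = "u' x" and w' = "w' x"] bounded_linear_ident) blast+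
    qed
  qed
qed (intro comp_span.atom g \<alpha>)

end

section \<open>Integration against the volume density\<close>

text \<open>A continuous path in a space of continuous functions with the uniform topology is jointly
  continuous. Thus pointwise operations (determinants, square roots, products) can be
  handled as continuous functions of two variables instead of by calculus of uniform limits.\<close>

lemma continuous_on_prod_uniform_limit:
  fixes h :: "'s::metric_space \<Rightarrow> 'x::metric_space \<Rightarrow> 'y::metric_space"
  assumes lim: "\<And>t. t \<in> T \<Longrightarrow> uniform_limit A h (h t) (at t within T)"
    and cont: "\<And>t. t \<in> T \<Longrightarrow> continuous_on A (h t)"
  shows "continuous_on (T \<times> A) (\<lambda>z. h (fst z) (snd z))"
  unfolding continuous_on_iff
proof (intro ballI allI impI)
  fix z e
  assume z: "z \<in> T \<times> A" and e: "(0::real) < e"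
  obtain t x where tx: "z = (t, x)" "t \<in> T" "x \<in> A" using z by auto
  obtain d1 where d1: "d1 > 0" "\<And>s y. s \<in> T \<Longrightarrow> s \<noteq> t \<Longrightarrow> dist s t < d1 \<Longrightarrow> y \<in> A \<Longrightarrow>
      dist (h s y) (h t y) < e / 2"
    using uniform_limitD[OF lim[OF tx(2)], of "e / 2"] e unfolding eventually_at by auto
  obtain d2 where d2: "d2 > 0" "\<And>y. y \<in> A \<Longrightarrow> dist y x < d2 \<Longrightarrow> dist (h t y) (h t x) < e / 2"
    using cont[OF tx(2)] tx(3) e unfolding continuous_on_iff by (meson half_gt_zero)
  show "\<exists>d>0. \<forall>z'\<in>T \<times> A. dist z' z < d \<longrightarrow> dist (h (fst z') (snd z')) (h (fst z) (snd z)) < e"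
  proof (intro exI[of _ "min d1 d2"] conjI ballI impI)
    fix z'
    assume z': "z' \<in> T \<times> A" "dist z' z < min d1 d2"
    obtain s y where sy: "z' = (s, y)" "s \<in> T" "y \<in> A" using z'(1) by auto
    have d: "dist s t < d1" "dist y x < d2"
      using z'(2) dist_fst_le[of z' z] dist_snd_le[of z' z] sy(1) tx(1) by auto
    have "dist (h s y) (h t y) < e / 2"
      using d1(2)[OF sy(2) _ d(1) sy(3)] e by (cases "s = t") auto
    moreover have "dist (h t y) (h t x) < e / 2"
      by (rule d2(2)[OF sy(3) d(2)])
    ultimately show "dist (h (fst z') (snd z')) (h (fst z) (snd z)) < e"
      using dist_triangle[of "h s y" "h t x" "h t y"] sy(1) tx(1) by simp
  qed (use d1 d2 in simp)
qed

text \<open>Joint continuity on a compact set supplies the constant bound needed for dominated convergence.\<close>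

lemma continuous_on_parametric_set_integral:
  fixes H :: "'s::metric_space \<Rightarrow> 'x::metric_space \<Rightarrow> 'y::{banach, second_countable_topology}"
  assumes sets: "sets \<mu> = sets borel" and A: "A \<in> sets borel" "A \<subseteq> K"
    and K: "compact K" "emeasure \<mu> K < \<infinity>" and T: "compact T"
    and H: "continuous_on (T \<times> K) (\<lambda>z. H (fst z) (snd z))"
  shows "continuous_on T (\<lambda>t. LINT x:A|\<mu>. H t x)"
proof -
  have "bounded ((\<lambda>z. H (fst z) (snd z)) ` (T \<times> K))"
    by (intro compact_imp_bounded compact_continuous_image H compact_Times T K)
  then obtain C where C: "\<And>t x. t \<in> T \<Longrightarrow> x \<in> K \<Longrightarrow> norm (H t x) \<le> C"
    unfolding bounded_iff by force
  have contH: "continuous_on A (H t)" if "t \<in> T" for t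
  proof -
    have "continuous_on A (\<lambda>x. H (fst (t, x)) (snd (t, x)))"
      by (rule continuous_on_compose2[OF H]) (use that A(2) in \<open>auto intro!: continuous_intros\<close>)
    then show ?thesis by simp
  qed
  have meas: "(\<lambda>x. indicator A x *\<^sub>R H t x) \<in> borel_measurable \<mu>" if "t \<in> T" for t
    using borel_measurable_continuous_on_indicator[OF A(1) contH[OF that]] sets
    by (simp add: measurable_cong_sets[OF sets refl])
  have fin: "emeasure \<mu> A < \<infinity>"
    using emeasure_mono[OF A(2)] K sets by (metis borel_closed compact_imp_closed order_le_less_trans)
  have w: "integrable \<mu> (\<lambda>x. indicator A x *\<^sub>R C)"
    using A(1) sets fin by (intro integrable_scaleR_left) (simp add: integrable_indicator_iff)
  show ?thesis
    unfolding continuous_on_sequentially set_lebesgue_integral_def comp_def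
  proof (intro allI ballI impI)
    fix s t
    assume t: "t \<in> T" and s: "(\<forall>n. s n \<in> T) \<and> s \<longlonglongrightarrow> t"
    show "(\<lambda>n. LINT x|\<mu>. indicator A x *\<^sub>R H (s n) x) \<longlonglongrightarrow> (LINT x|\<mu>. indicator A x *\<^sub>R H t x)"
    proof (rule integral_dominated_convergence[OF meas[OF t] meas w])
      show "AE x in \<mu>. (\<lambda>n. indicator A x *\<^sub>R H (s n) x) \<longlonglongrightarrow> indicator A x *\<^sub>R H t x"
      proof (rule AE_I2)
        fix x
        have "(\<lambda>n. H (fst (s n, x)) (snd (s n, x))) \<longlonglongrightarrow> H (fst (t, x)) (snd (t, x))" if "x \<in> A"
          using H s t that A(2) unfolding continuous_on_sequentially comp_def
          by (elim allE[of _ "\<lambda>n. (s n, x)"] ballE[of _ _ "(t, x)"]) (auto intro: tendsto_Pair)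
        then show "(\<lambda>n. indicator A x *\<^sub>R H (s n) x) \<longlonglongrightarrow> indicator A x *\<^sub>R H t x"
          by (cases "x \<in> A") auto
      qed
      show "AE x in \<mu>. norm (indicator A x *\<^sub>R H (s n) x) \<le> indicator A x *\<^sub>R C" for n
        using C s A(2) by (intro AE_I2) (auto simp: indicator_def)
    qed (use s in auto)
  qed
qed

lemma sets_coord_lebesgue [simp]: "sets (coord_lebesgue d) = sets borel"
  by (simp add: coord_lebesgue_def)

lemma emeasure_coord_lebesgue_compact:
  assumes "compact A"
  shows "emeasure (coord_lebesgue d) A < \<infinity>"
proof -
  interpret product_sigma_finite "\<lambda>_. lborel :: real measure"
    by standard
  let ?E = "\<lambda>(y :: nat \<Rightarrow> real) i. if i < d then y i else 0"
  let ?P = "Pi\<^sub>M {..<d} (\<lambda>_. lborel :: real measure)"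
  have "\<exists>C. \<forall>x\<in>A. \<bar>x i\<bar> \<le> C" for i
  proof -
    have "bounded ((\<lambda>x. x i) ` A)"
      by (intro compact_imp_bounded compact_continuous_image assms
          continuous_on_subset[OF continuous_on_product_coordinates subset_UNIV])
    then show ?thesis
      by (auto simp: bounded_iff)
  qed
  then obtain C where C: "\<And>i x. x \<in> A \<Longrightarrow> \<bar>x i\<bar> \<le> C i" by metis
  have "(\<lambda>y. ?E y) \<in> measurable ?P (Pi\<^sub>M UNIV (\<lambda>_. borel))"
  proof (rule measurable_PiM_single')
    show "(\<lambda>y. ?E y i) \<in> measurable ?P borel" for i
    proof (cases "i < d")
      case True
      then have "(\<lambda>y. y i) \<in> measurable ?P lborel"
        by (intro measurable_component_singleton) simp
      with True show ?thesis by simp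
    qed simp
  qed auto
  then have E: "?E \<in> measurable ?P borel"
    by (simp add: measurable_cong_sets[OF refl sets_PiM_equal_borel])
  have "emeasure (coord_lebesgue d) A = emeasure ?P (?E -` A \<inter> space ?P)"
    unfolding coord_lebesgue_def
    by (rule emeasure_distr[OF E]) (simp add: assms compact_imp_closed)
  also have "\<dots> \<le> emeasure ?P (Pi\<^sub>E {..<d} (\<lambda>i. {- C i..C i}))"
  proof (rule emeasure_mono)
    show "?E -` A \<inter> space ?P \<subseteq> Pi\<^sub>E {..<d} (\<lambda>i. {- C i..C i})"
    proof
      fix y assume y: "y \<in> ?E -` A \<inter> space ?P"
      then have "\<bar>?E y i\<bar> \<le> C i" for i
        using C by blast
      then have "\<bar>y i\<bar> \<le> C i" if "i < d" for i
        using that by (metis (full_types))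
      then show "y \<in> Pi\<^sub>E {..<d} (\<lambda>i. {- C i..C i})"
        using y by (auto simp: space_PiM PiE_iff abs_le_iff minus_le_iff)
    qed
  qed (auto intro!: sets_PiM_I_finite)
  also have "\<dots> = (\<Prod>i<d. emeasure lborel {- C i..C i})"
    by (rule emeasure_PiM) auto
  also have "\<dots> < \<infinity>"
    by (simp add: ennreal_prod_eq_top less_top[symmetric] emeasure_lborel_Icc_eq)
  finally show ?thesis .
qed

context closed_manifold
begin

lemma compact_neighbourhood:
  assumes "open A" "p \<in> A"
  obtains U K where "open U" "p \<in> U" "U \<subseteq> K" "compact K" "K \<subseteq> (A :: 'a set)"
proof -
  have cpt: "compact (- A)"
    using compact_Int_closed[OF compact_UNIV, of "- A"] assms(1) by (simp add: closed_Compl)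
  have "\<exists>U V. open U \<and> open V \<and> p \<in> U \<and> q \<in> V \<and> U \<inter> V = {}" if "q \<in> - A" for q
    using hausdorff[of p q] assms(2) that by blast
  then obtain U V where UV: "\<And>q. q \<in> - A \<Longrightarrow>
      open (U q) \<and> open (V q) \<and> p \<in> U q \<and> q \<in> V q \<and> U q \<inter> V q = {}"
    by metis
  obtain C where C: "C \<subseteq> - A" "finite C" "- A \<subseteq> (\<Union>q\<in>C. V q)"
    by (rule compactE_image[OF cpt, of "- A" V]) (use UV in blast)+
  show thesis
  proof (rule that)
    show "open (\<Inter>q\<in>C. U q)" "p \<in> (\<Inter>q\<in>C. U q)"
      using C UV by (auto intro!: open_INT)
    show "(\<Inter>q\<in>C. U q) \<subseteq> - (\<Union>q\<in>C. V q)" "- (\<Union>q\<in>C. V q) \<subseteq> A"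
      using C UV by blast+
    have "open (\<Union>q\<in>C. V q)"
      using C UV by (intro open_UN) blast
    then have "closed (- (\<Union>q\<in>C. V q))"
      by (rule closed_Compl)
    from compact_Int_closed[OF compact_UNIV this]
    show "compact (- (\<Union>q\<in>C. V q))"
      by (simp only: Int_UNIV_left)
  qed
qed

text \<open>The volume integral picks some decomposition, so its properties need one to exist: cover the
  compact space by finitely many small open sets and make them disjoint in turn.\<close>

lemma ex_chart_decomposition: "\<exists>D. chart_decomposition M D"
proof -
  have "\<exists>c U K. c \<in> atlas M \<and> open U \<and> p \<in> U \<and> U \<subseteq> K \<and> compact K \<and> K \<subseteq> fst c" for p
  proof -
    obtain c where c: "c \<in> atlas M" "p \<in> fst c"
      using ex_chart by blast
    show ?thesis
      by (rule compact_neighbourhood[OF open_chart_domain[OF c(1)] c(2)]) (use c(1) in blast)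
  qed
  then obtain c U K where cUK: "\<And>p. c p \<in> atlas M \<and> open (U p) \<and> p \<in> U p \<and> U p \<subseteq> K p \<and>
      compact (K p) \<and> K p \<subseteq> fst (c p)"
    by metis
  obtain C where C: "finite C" "UNIV \<subseteq> (\<Union>p\<in>C. U p)"
    by (rule compactE_image[OF compact_UNIV, of UNIV U]) (use cUK in blast)+
  obtain e n where e: "C = e ` {i::nat. i < n}"
    using finite_imp_nat_seg_image_inj_on[OF C(1)] by blast
  define B where "B = (\<lambda>i. U (e i) - (\<Union>j<i. U (e j)))"
  define D where "D = (\<lambda>i. (c (e i), B i)) ` {..<n}"
  have "chart_decomposition M D"
    unfolding chart_decomposition_def
  proof (intro conjI)
    show "finite D" by (simp add: D_def)
    have piece: "c (e i) \<in> atlas M \<and> B i \<in> sets borel \<and> (\<exists>K. compact K \<and> B i \<subseteq> K \<and> K \<subseteq> fst (c (e i)))"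
      for i
    proof (intro conjI exI)
      show "c (e i) \<in> atlas M" "compact (K (e i))" "K (e i) \<subseteq> fst (c (e i))"
        using cUK by blast+
      show "B i \<in> sets borel"
        unfolding B_def using cUK by (intro sets.Diff sets.finite_UN borel_open) auto
      show "B i \<subseteq> K (e i)"
        using cUK unfolding B_def by blast
    qed
    show "\<forall>(c, B)\<in>D. c \<in> atlas M \<and> B \<in> sets borel \<and> (\<exists>K. compact K \<and> B \<subseteq> K \<and> K \<subseteq> fst c)"
      unfolding D_def using piece by (simp add: split_beta)
    have disj: "B i \<inter> B j = {}" if "i < j" for i j
      using that by (auto simp: B_def)
    show "\<forall>p\<in>D. \<forall>q\<in>D. p \<noteq> q \<longrightarrow> snd p \<inter> snd q = {}"
    proof (intro ballI impI)
      fix x y assume "x \<in> D" "y \<in> D" and ne: "x \<noteq> y"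
      then obtain i j where ij: "x = (c (e i), B i)" "y = (c (e j), B j)"
        unfolding D_def by blast
      with ne have "i < j \<or> j < i"
        by (metis linorder_neqE_nat)
      then show "snd x \<inter> snd y = {}"
        unfolding ij snd_conv using disj[of i j] disj[of j i] by (metis Int_commute)
    qed
    have "\<exists>i<n. q \<in> B i" for q
    proof -
      define i where "i = (LEAST i. q \<in> U (e i))"
      obtain k where k: "k < n" "q \<in> U (e k)"
        using C(2) e by blast
      then have "q \<in> U (e i)" "i \<le> k"
        unfolding i_def by (auto intro: LeastI Least_le)
      moreover have "q \<notin> U (e j)" if "j < i" for j
        using that not_less_Least unfolding i_def by blast
      ultimately show ?thesis
        using k by (intro exI[of _ i]) (auto simp: B_def)
    qed
    then show "(\<Union>p\<in>D. snd p) = UNIV"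
      by (auto simp: D_def)
  qed
  then show ?thesis by blast
qed

text \<open>The decomposition depends on the manifold alone. Integrals for different immersions are therefore
  compared piece by piece, without the change of variables formula.\<close>

definition pieces :: "('a chart \<times> 'a set) set" where
  "pieces = (SOME D. chart_decomposition M D)"

lemma chart_decomposition_pieces: "chart_decomposition M pieces"
  unfolding pieces_def by (rule someI_ex[OF ex_chart_decomposition])

lemma piecesE:
  assumes "(c, B) \<in> pieces"
  obtains K where "c \<in> atlas M" "B \<in> sets borel" "compact K" "B \<subseteq> K" "K \<subseteq> fst c"
    "snd c ` B \<in> sets borel" "compact (snd c ` K)" "snd c ` B \<subseteq> snd c ` K" "snd c ` K \<subseteq> chart_image c"
proof -
  obtain K where K: "c \<in> atlas M" "B \<in> sets borel" "compact K" "B \<subseteq> K" "K \<subseteq> fst c"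
  proof -
    have "\<forall>(c, B)\<in>pieces. c \<in> atlas M \<and> B \<in> sets borel \<and> (\<exists>K. compact K \<and> B \<subseteq> K \<and> K \<subseteq> fst c)"
      using chart_decomposition_pieces unfolding chart_decomposition_def by (elim conjE)
    from bspec[OF this assms] show ?thesis
      using that by (auto simp only: prod.case)
  qed
  note h = chart_homeo[OF K(1)]
  have meas_image: "chart_image c \<in> sets borel"
  proof -
    obtain U where U: "open U" "chart_image c = U \<inter> coord_space (mdim M)"
      using openin_chart_image[OF K(1)] by (auto simp: openin_Euclidean_space_iff)
    have "closed (coord_space (mdim M))"
      by (metis closedin_Euclidean_imp_closed closedin_topspace)
    then show ?thesis
      unfolding U(2) using U(1) by (intro sets.Int borel_open borel_closed)
  qed
  have meas_inv: "chart_inv c \<in> measurable (restrict_space borel (chart_image c)) borel"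
    by (rule borel_measurable_continuous_on_restrict[OF h(2)])
  have "chart_inv c -` B \<inter> chart_image c \<in> sets borel"
    using measurable_sets[OF meas_inv K(2)] meas_image
    by (simp add: space_restrict_space sets_restrict_space_iff)
  moreover have "snd c ` B = chart_inv c -` B \<inter> chart_image c"
  proof (intro equalityI subsetI)
    fix x assume "x \<in> snd c ` B"
    then obtain p where "x = snd c p" "p \<in> B" "p \<in> fst c"
      using K(4,5) by blast
    then show "x \<in> chart_inv c -` B \<inter> chart_image c"
      using h(4) by (simp add: chart_image_def)
  next
    fix x assume "x \<in> chart_inv c -` B \<inter> chart_image c"
    then have "chart_inv c x \<in> B" "x = snd c (chart_inv c x)"
      using h(5)[of x] by auto
    then show "x \<in> snd c ` B"
      by (rule rev_image_eqI)
  qed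
  ultimately have meas: "snd c ` B \<in> sets borel"
    by (simp only:)
  show thesis
    by (rule that[OF K meas compact_chart_image(1)[OF K(1,3,5)] image_mono[OF K(4)]
          compact_chart_image(2)[OF K(1,3,5)]])
qed

definition volume_density :: "('a \<Rightarrow> real ^ 'n) \<Rightarrow> 'a chart \<Rightarrow> (nat \<Rightarrow> real) \<Rightarrow> real" where
  "volume_density f c x = sqrt (coord_det (mdim M) (induced_metric f c x))"

lemma vol_integral_pieces:
  "vol_integral M f F = (\<Sum>(c, B)\<in>pieces.
     LINT x:(snd c ` B)|coord_lebesgue (mdim M). volume_density f c x *\<^sub>R in_chart c F x)"
  by (simp add: vol_integral_def pieces_def volume_density_def)

lemma continuous_on_volume_density:
  fixes T :: "'s::topological_space set"
  assumes "\<And>i. i < mdim M \<Longrightarrow> continuous_on T (\<lambda>z. partial_derivs [i] (in_chart c (f z)) (g z))"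
  shows "continuous_on T (\<lambda>z. volume_density (f z) c (g z))"
proof -
  have "continuous_on T (\<lambda>z. partial_deriv i (in_chart c (f z)) (g z) \<bullet>
      partial_deriv (\<pi> i) (in_chart c (f z)) (g z))"
    if "i < mdim M" "\<pi> permutes {..<mdim M}" for i \<pi>
  proof -
    have "\<pi> i < mdim M"
      using permutes_in_image[OF that(2), of i] that(1) by simp
    then show ?thesis
      using assms[of i] assms[of "\<pi> i"] that(1) by (simp add: continuous_on_inner)
  qed
  then show ?thesis
    unfolding volume_density_def coord_det_def induced_metric_def
    by (intro continuous_on_real_sqrt continuous_on_sum continuous_on_mult continuous_on_const
        continuous_on_prod) simp
qed

text \<open>Continuity, expressed in the charts, since this is how it enters the integrals.\<close>

definition chart_continuous :: "('a \<Rightarrow> 'b::topological_space) \<Rightarrow> bool" where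
  "chart_continuous F \<longleftrightarrow> (\<forall>c\<in>atlas M. continuous_on (chart_image c) (in_chart c F))"

lemma chart_continuous_smooth: "u \<in> smooth_maps M \<Longrightarrow> chart_continuous u"
  unfolding chart_continuous_def using continuous_partial_derivs[of u _ "[]"] by simp

lemma set_integrable_piece:
  fixes F :: "'a \<Rightarrow> 'b::{banach, second_countable_topology}"
  assumes f: "f \<in> smooth_maps M" and F: "chart_continuous F" and cB: "(c, B) \<in> pieces"
  shows "integrable (coord_lebesgue (mdim M))
    (\<lambda>x. indicator (snd c ` B) x *\<^sub>R (volume_density f c x *\<^sub>R in_chart c F x))"
  using cB
proof (rule piecesE)
  fix K
  assume c: "c \<in> atlas M" and B: "snd c ` B \<in> sets borel" "compact (snd c ` K)"
    "snd c ` B \<subseteq> snd c ` K" "snd c ` K \<subseteq> chart_image c"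
  let ?g = "\<lambda>x. volume_density f c x *\<^sub>R in_chart c F x"
  have cont: "continuous_on (chart_image c) ?g"
  proof (intro continuous_on_scaleR continuous_on_volume_density)
    show "continuous_on (chart_image c) (in_chart c F)"
      using F c by (simp add: chart_continuous_def)
    show "continuous_on (chart_image c) (\<lambda>x. partial_derivs [i] (in_chart c f) x)" if "i < mdim M" for i
      using continuous_partial_derivs[OF f c, of "[i]"] that by simp
  qed
  have "bounded (?g ` snd c ` K)"
    by (intro compact_imp_bounded compact_continuous_image B continuous_on_subset[OF cont])
  then obtain C where C: "\<And>x. x \<in> snd c ` K \<Longrightarrow> norm (?g x) \<le> C"
    by (auto simp: bounded_iff)
  show ?thesis
  proof (rule integrableI_bounded_set[where A = "snd c ` B" and B = C])
    show "snd c ` B \<in> sets (coord_lebesgue (mdim M))" using B by simp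
    show "emeasure (coord_lebesgue (mdim M)) (snd c ` B) < \<infinity>"
      using emeasure_mono[OF B(3)] emeasure_coord_lebesgue_compact[OF B(2)] B(2)
      by (metis borel_closed compact_imp_closed order_le_less_trans sets_coord_lebesgue)
    show "(\<lambda>x. indicator (snd c ` B) x *\<^sub>R ?g x) \<in> borel_measurable (coord_lebesgue (mdim M))"
      using borel_measurable_continuous_on_indicator[OF B(1) continuous_on_subset[OF cont]] B(3,4)
      by (simp add: measurable_cong_sets[OF sets_coord_lebesgue refl])
    show "AE x in coord_lebesgue (mdim M). x \<in> snd c ` B \<longrightarrow> norm (indicator (snd c ` B) x *\<^sub>R ?g x) \<le> C"
      using C B(3) by (intro AE_I2) (auto simp: indicator_def)
  qed auto
qed

lemma vol_integral_lincomb: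
  fixes F :: "'a \<Rightarrow> 'b::{banach, second_countable_topology}"
    and G :: "'a \<Rightarrow> 'c::{banach, second_countable_topology}"
    and L :: "'b \<Rightarrow> 'd::{banach, second_countable_topology}"
  assumes f: "f \<in> smooth_maps M" and F: "chart_continuous F" and G: "chart_continuous G"
    and L: "bounded_linear L" "bounded_linear L'"
  shows "vol_integral M f (\<lambda>p. L (F p) + L' (G p)) = L (vol_integral M f F) + L' (vol_integral M f G)"
proof -
  note lin = bounded_linear.linear[OF L(1)] bounded_linear.linear[OF L(2)]
  have "(LINT x:(snd c ` B)|coord_lebesgue (mdim M).
        volume_density f c x *\<^sub>R in_chart c (\<lambda>p. L (F p) + L' (G p)) x)
      = L (LINT x:(snd c ` B)|coord_lebesgue (mdim M). volume_density f c x *\<^sub>R in_chart c F x)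
      + L' (LINT x:(snd c ` B)|coord_lebesgue (mdim M). volume_density f c x *\<^sub>R in_chart c G x)"
    if cB: "(c, B) \<in> pieces" for c B
  proof -
    note int = set_integrable_piece[OF f F cB] set_integrable_piece[OF f G cB]
    show ?thesis
      unfolding set_lebesgue_integral_def in_chart_lincomb
        integral_bounded_linear[OF L(1) int(1), symmetric]
        integral_bounded_linear[OF L(2) int(2), symmetric]
        Bochner_Integration.integral_add[OF integrable_bounded_linear[OF L(1) int(1)]
          integrable_bounded_linear[OF L(2) int(2)], symmetric]
      by (simp add: linear_scale[OF lin(1)] linear_scale[OF lin(2)] scaleR_add_right)
  qed
  then show ?thesis
    unfolding vol_integral_pieces
    by (simp add: linear_sum[OF lin(1)] linear_sum[OF lin(2)] split_beta sum.distrib[symmetric])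
qed

lemma vol_integral_linear:
  fixes F :: "'a \<Rightarrow> 'b::{banach, second_countable_topology}"
    and L :: "'b \<Rightarrow> 'd::{banach, second_countable_topology}"
  assumes "f \<in> smooth_maps M" "chart_continuous F" "bounded_linear L"
  shows "vol_integral M f (\<lambda>p. L (F p)) = L (vol_integral M f F)"
  using vol_integral_lincomb[OF assms(1,2,2,3) bounded_linear_zero] by simp

lemma continuous_on_smooth_family:
  fixes u :: "'s::metric_space \<Rightarrow> 'a \<Rightarrow> 'b::real_normed_vector"
  assumes u: "\<And>t. t \<in> T \<Longrightarrow> u t \<in> smooth_maps M"
      "\<And>t. t \<in> T \<Longrightarrow> smooth_limit M (at t within T) u (u t)"
    and c: "c \<in> atlas M" "compact K" "K \<subseteq> fst c" "set js \<subseteq> {..<mdim M}"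
  shows "continuous_on (T \<times> snd c ` K) (\<lambda>z. partial_derivs js (in_chart c (u (fst z))) (snd z))"
proof (rule continuous_on_prod_uniform_limit)
  fix t assume t: "t \<in> T"
  show "uniform_limit (snd c ` K) (\<lambda>t. partial_derivs js (in_chart c (u t)))
      (partial_derivs js (in_chart c (u t))) (at t within T)"
    using u(2)[OF t] c unfolding smooth_limit_def by blast
  show "continuous_on (snd c ` K) (partial_derivs js (in_chart c (u t)))"
    using continuous_partial_derivs[OF u(1)[OF t] c(1,4)] compact_chart_image(2)[OF c(1-3)]
    by (rule continuous_on_subset)
qed

lemma continuous_on_vol_integral:
  fixes T :: "'s::metric_space set" and f u w :: "'s \<Rightarrow> 'a \<Rightarrow> real ^ 'n"
  assumes T: "compact T"
    and f: "\<And>t. t \<in> T \<Longrightarrow> f t \<in> smooth_maps M"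
      "\<And>t. t \<in> T \<Longrightarrow> smooth_limit M (at t within T) f (f t)"
    and u: "\<And>t. t \<in> T \<Longrightarrow> u t \<in> smooth_maps M"
      "\<And>t. t \<in> T \<Longrightarrow> smooth_limit M (at t within T) u (u t)"
    and w: "\<And>t. t \<in> T \<Longrightarrow> w t \<in> smooth_maps M"
      "\<And>t. t \<in> T \<Longrightarrow> smooth_limit M (at t within T) w (w t)"
  shows "continuous_on T (\<lambda>t. vol_integral M (f t) (\<lambda>p. u t p \<bullet> w t p))"
  unfolding vol_integral_pieces
proof (rule continuous_on_sum)
  fix cB assume cB: "cB \<in> pieces"
  obtain c B where cB': "cB = (c, B)" by (cases cB)
  have "continuous_on T (\<lambda>t. LINT x:(snd c ` B)|coord_lebesgue (mdim M).
      volume_density (f t) c x *\<^sub>R in_chart c (\<lambda>p. u t p \<bullet> w t p) x)"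
    using cB[unfolded cB']
  proof (rule piecesE)
    fix K
    assume K: "c \<in> atlas M" "compact K" "K \<subseteq> fst c"
      and B: "snd c ` B \<in> sets borel" "compact (snd c ` K)" "snd c ` B \<subseteq> snd c ` K"
    note cont = continuous_on_smooth_family[OF _ _ K]
    show ?thesis
    proof (rule continuous_on_parametric_set_integral[where K = "snd c ` K"])
      have "continuous_on (T \<times> snd c ` K) (\<lambda>z. volume_density (f (fst z)) c (snd z) *\<^sub>R
          (partial_derivs [] (in_chart c (u (fst z))) (snd z) \<bullet>
           partial_derivs [] (in_chart c (w (fst z))) (snd z)))"
        by (intro continuous_on_scaleR continuous_on_inner continuous_on_volume_density cont f u w) auto
      then show "continuous_on (T \<times> snd c ` K) (\<lambda>z. volume_density (f (fst z)) c (snd z) *\<^sub>R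
          in_chart c (\<lambda>p. u (fst z) p \<bullet> w (fst z) p) (snd z))"
        by (simp add: in_chart_def)
    qed (use T B emeasure_coord_lebesgue_compact in auto)
  qed
  then show "continuous_on T (\<lambda>t. case cB of (c, B) \<Rightarrow>
      LINT x:(snd c ` B)|coord_lebesgue (mdim M).
        volume_density (f t) c x *\<^sub>R in_chart c (\<lambda>p. u t p \<bullet> w t p) x)"
    by (simp add: cB')
qed

end

section \<open>Euclidean motions and the equivariance of the Bochner-Laplacian\<close>

lemma orthogonal_matrix_inner:
  fixes R :: "real ^ 'n ^ 'n"
  assumes "orthogonal_matrix R"
  shows "(R *v x) \<bullet> (R *v y) = x \<bullet> y"
  using assms orthogonal_transformation_matrix[of "(*v) R"]
  by (simp add: orthogonal_transformation_def)

text \<open>An anonymous inverse is preferable to \<open>transpose R\<close>, which the simplifier rewrites to the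
  vector-matrix product.\<close>

lemma orthogonal_matrix_inverse:
  fixes R :: "real ^ 'n ^ 'n"
  assumes "orthogonal_matrix R"
  obtains S :: "real ^ 'n ^ 'n" where "orthogonal_matrix S" "\<forall>x. S *v (R *v x) = x" "\<forall>x. R *v (S *v x) = x"
proof (rule that)
  show "orthogonal_matrix (transpose R)"
    using assms by (simp add: orthogonal_matrix_transpose)
  show "\<forall>x. transpose R *v (R *v x) = x" "\<forall>x. R *v (transpose R *v x) = x"
    using assms unfolding matrix_vector_mul_assoc orthogonal_matrix_def
    by (simp_all only: matrix_vector_mul_lid simp_thms)
qed

text \<open>The inverse is a choice among all matrices satisfying a condition on the entries below \<open>d\<close>, so equal
  entries lead to the same choice.\<close>

lemma coord_inverse_cong:
  assumes "\<And>i j. i < d \<Longrightarrow> j < d \<Longrightarrow> G i j = G' i j"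
  shows "coord_inverse d G = coord_inverse d G'"
  unfolding coord_inverse_def using assms by simp

context closed_manifold
begin

lemma smooth_maps_matrix:
  fixes f :: "'a \<Rightarrow> real ^ 'n" and R :: "real ^ 'n ^ 'n"
  assumes "f \<in> smooth_maps M"
  shows "(\<lambda>p. R *v f p) \<in> smooth_maps M"
  by (rule smooth_maps_linear[where L = "(*v) R", OF assms matrix_vector_mul_bounded_linear])

lemma smooth_maps_motion:
  fixes f :: "'a \<Rightarrow> real ^ 'n" and R :: "real ^ 'n ^ 'n"
  assumes "f \<in> smooth_maps M"
  shows "(\<lambda>p. R *v f p + b) \<in> smooth_maps M"
  by (intro smooth_maps_add smooth_maps_const smooth_maps_matrix assms)

lemma partial_deriv_motion:
  fixes f :: "'a \<Rightarrow> real ^ 'n" and R :: "real ^ 'n ^ 'n"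
  assumes f: "f \<in> smooth_maps M" and c: "c \<in> atlas M" and x: "x \<in> chart_image c" and i: "i < mdim M"
  shows "partial_deriv i (in_chart c (\<lambda>p. R *v f p + b)) x = R *v partial_deriv i (in_chart c f) x"
proof -
  have "partial_derivs [i] (in_chart c (\<lambda>p. R *v f p + b)) x
      = R *v partial_derivs [i] (in_chart c f) x + partial_derivs [i] (in_chart c (\<lambda>_. b)) x"
    by (rule partial_derivs_chart_lincomb[OF f smooth_maps_const matrix_vector_mul_bounded_linear
          bounded_linear_ident c _ x]) (use i in simp)
  moreover have "partial_derivs [i] (in_chart c (\<lambda>_. b)) x = 0"
    using partial_derivs_const[of "[i]" b] by (simp add: in_chart_def comp_def)
  ultimately show ?thesis by simp
qed

lemma induced_metric_motion:
  fixes f :: "'a \<Rightarrow> real ^ 'n"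
  assumes "orthogonal_matrix R" "f \<in> smooth_maps M" "c \<in> atlas M" "x \<in> chart_image c"
    and "i < mdim M" "j < mdim M"
  shows "induced_metric (\<lambda>p. R *v f p + b) c x i j = induced_metric f c x i j"
  using assms by (simp add: induced_metric_def partial_deriv_motion orthogonal_matrix_inner)

lemma Imm_motion:
  fixes f :: "'a \<Rightarrow> real ^ 'n"
  assumes R: "orthogonal_matrix R" and f: "f \<in> Imm M"
  shows "(\<lambda>p. R *v f p + b) \<in> Imm M"
proof -
  have fs: "f \<in> smooth_maps M" using f by (simp add: Imm_def)
  show ?thesis
    unfolding Imm_def mem_Collect_eq
  proof (intro conjI ballI allI impI)
    fix c x v i
    assume c: "c \<in> atlas M" and x: "x \<in> chart_image c" and i: "i < mdim M"
      and eq: "(\<Sum>i<mdim M. v i *\<^sub>R partial_deriv i (in_chart c (\<lambda>p. R *v f p + b)) x) = 0"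
    have "R *v (\<Sum>i<mdim M. v i *\<^sub>R partial_deriv i (in_chart c f) x)
        = (\<Sum>i<mdim M. v i *\<^sub>R (R *v partial_deriv i (in_chart c f) x))"
      by (simp add: linear_sum[OF matrix_vector_mul_linear] matrix_vector_mult_scaleR)
    also have "\<dots> = 0"
      using eq partial_deriv_motion[OF fs c x] by simp
    finally have "(\<Sum>i<mdim M. v i *\<^sub>R partial_deriv i (in_chart c f) x) = 0"
      by (metis orthogonal_matrix_inverse[OF R] matrix_vector_mult_0_right)
    then show "v i = 0"
      using f c x i unfolding Imm_def by blast
  qed (rule smooth_maps_motion[OF fs])
qed

lemma volume_density_motion:
  fixes f :: "'a \<Rightarrow> real ^ 'n"
  assumes R: "orthogonal_matrix R" and f: "f \<in> smooth_maps M"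
    and c: "c \<in> atlas M" "x \<in> chart_image c"
  shows "volume_density (\<lambda>p. R *v f p + b) c x = volume_density f c x"
proof -
  have "(\<Prod>i<mdim M. induced_metric (\<lambda>p. R *v f p + b) c x i (\<pi> i))
      = (\<Prod>i<mdim M. induced_metric f c x i (\<pi> i))" if "\<pi> permutes {..<mdim M}" for \<pi>
    using permutes_in_image[OF that] by (intro prod.cong refl induced_metric_motion[OF R f c]) auto
  then show ?thesis
    by (simp add: volume_density_def coord_det_def)
qed

lemma vol_integral_motion:
  fixes f :: "'a \<Rightarrow> real ^ 'n" and F :: "'a \<Rightarrow> 'b::{banach, second_countable_topology}"
  assumes R: "orthogonal_matrix R" and f: "f \<in> smooth_maps M"
  shows "vol_integral M (\<lambda>p. R *v f p + b) F = vol_integral M f F"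
  unfolding vol_integral_pieces
proof (intro sum.cong refl, clarify)
  fix s m B assume "((s, m), B) \<in> pieces"
  then obtain K where "(s, m) \<in> atlas M" "snd (s, m) ` B \<subseteq> snd (s, m) ` K"
      "snd (s, m) ` K \<subseteq> chart_image (s, m)"
    by (rule piecesE)
  then have "indicator (snd (s, m) ` B) x *\<^sub>R
        (volume_density (\<lambda>p. R *v f p + b) (s, m) x *\<^sub>R in_chart (s, m) F x)
      = indicator (snd (s, m) ` B) x *\<^sub>R (volume_density f (s, m) x *\<^sub>R in_chart (s, m) F x)" for x
    using volume_density_motion[OF R f, of "(s, m)" x b]
    by (cases "x \<in> snd (s, m) ` B") auto
  then show "(LINT x:snd (s, m) ` B|coord_lebesgue (mdim M).
        volume_density (\<lambda>p. R *v f p + b) (s, m) x *\<^sub>R in_chart (s, m) F x)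
      = (LINT x:snd (s, m) ` B|coord_lebesgue (mdim M).
        volume_density f (s, m) x *\<^sub>R in_chart (s, m) F x)"
    unfolding set_lebesgue_integral_def by (simp only:)
qed

lemma form_inner_motion:
  fixes f h k :: "'a \<Rightarrow> real ^ 'n"
  assumes R: "orthogonal_matrix R"
    and f: "f \<in> smooth_maps M" and h: "h \<in> smooth_maps M" and k: "k \<in> smooth_maps M"
  shows "form_inner M (\<lambda>p. R *v f p + b) (cov_deriv (\<lambda>p. R *v h p)) (cov_deriv (\<lambda>p. R *v k p))
    = form_inner M f (cov_deriv h) (cov_deriv k)"
proof
  fix p
  define c where "c = (SOME c. c \<in> atlas M \<and> p \<in> fst c)"
  have c: "c \<in> atlas M" "p \<in> fst c"
    using someI_ex[of "\<lambda>c. c \<in> atlas M \<and> p \<in> fst c"] ex_chart[of p] unfolding c_def by blast+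
  then have x: "snd c p \<in> chart_image c"
    by (simp add: chart_image_def)
  have "coord_inverse (mdim M) (induced_metric (\<lambda>p. R *v f p + b) c (snd c p))
      = coord_inverse (mdim M) (induced_metric f c (snd c p))"
    by (intro coord_inverse_cong induced_metric_motion[OF R f c(1) x])
  moreover have "cov_deriv (\<lambda>p. R *v u p) c p i = R *v cov_deriv u c p i"
    if "u \<in> smooth_maps M" "i < mdim M" for u :: "'a \<Rightarrow> real ^ 'n" and i
    using partial_deriv_motion[OF that(1) c(1) x that(2), of R 0] by (simp add: cov_deriv_def)
  ultimately show "form_inner M (\<lambda>p. R *v f p + b) (cov_deriv (\<lambda>p. R *v h p)) (cov_deriv (\<lambda>p. R *v k p)) p
      = form_inner M f (cov_deriv h) (cov_deriv k) p"
    unfolding form_inner_def c_def[symmetric] Let_def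
    by (intro sum.cong refl) (simp add: h k orthogonal_matrix_inner[OF R])
qed

text \<open>Every test map has the form \<open>R k'\<close>, and for those both sides of the adjoint equation are
  unchanged by the motion.\<close>

lemma is_cov_adjoint_motion:
  fixes f h u :: "'a \<Rightarrow> real ^ 'n"
  assumes R: "orthogonal_matrix R" and f: "f \<in> smooth_maps M" and h: "h \<in> smooth_maps M"
    and u: "is_cov_adjoint M f (cov_deriv h) u"
  shows "is_cov_adjoint M (\<lambda>p. R *v f p + b) (cov_deriv (\<lambda>p. R *v h p)) (\<lambda>p. R *v u p)"
  unfolding is_cov_adjoint_def
proof (intro conjI ballI)
  show "(\<lambda>p. R *v u p) \<in> smooth_maps M"
    by (rule smooth_maps_matrix) (rule u[unfolded is_cov_adjoint_def, THEN conjunct1])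
  fix k :: "'a \<Rightarrow> real ^ 'n"
  assume k: "k \<in> smooth_maps M"
  obtain S where "orthogonal_matrix S" "\<forall>x. S *v (R *v x) = x" and S: "\<forall>x. R *v (S *v x) = x"
    by (rule orthogonal_matrix_inverse[OF R])
  define k' where "k' = (\<lambda>p. S *v k p)"
  have k': "k' \<in> smooth_maps M"
    unfolding k'_def by (rule smooth_maps_matrix[OF k])
  have k_eq: "k = (\<lambda>p. R *v k' p)"
    unfolding k'_def by (rule ext) (rule S[rule_format, symmetric])
  have 1: "form_inner M (\<lambda>p. R *v f p + b) (cov_deriv (\<lambda>p. R *v h p)) (cov_deriv k)
      = form_inner M f (cov_deriv h) (cov_deriv k')"
    by (subst k_eq) (rule form_inner_motion[OF R f h k'])
  have 2: "(R *v u p) \<bullet> k p = u p \<bullet> k' p" for p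
    by (subst k_eq) (rule orthogonal_matrix_inner[OF R])
  have 3: "vol_integral M f (form_inner M f (cov_deriv h) (cov_deriv k')) = vol_integral M f (\<lambda>p. u p \<bullet> k' p)"
    by (rule bspec[OF conjunct2[OF u[unfolded is_cov_adjoint_def]] k'])
  show "vol_integral M (\<lambda>p. R *v f p + b) (form_inner M (\<lambda>p. R *v f p + b)
        (cov_deriv (\<lambda>p. R *v h p)) (cov_deriv k))
      = vol_integral M (\<lambda>p. R *v f p + b) (\<lambda>p. (R *v u p) \<bullet> k p)"
    unfolding vol_integral_motion[OF R f] 1 2 by (rule 3)
qed

lemma is_cov_adjoint_smooth: "is_cov_adjoint M f B u \<Longrightarrow> u \<in> smooth_maps M"
  by (simp add: is_cov_adjoint_def)

lemma bochner_laplacian_smooth: "bochner_laplacian M f h \<in> smooth_maps M"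
proof (cases "\<exists>!u. is_cov_adjoint M f (cov_deriv h) u")
  case True
  show ?thesis
    unfolding bochner_laplacian_def cov_adjoint_def if_P[OF True]
    by (rule is_cov_adjoint_smooth[OF theI'[OF True]])
next
  case False
  show ?thesis
    unfolding bochner_laplacian_def cov_adjoint_def if_not_P[OF False] by (rule smooth_maps_const)
qed

text \<open>An isometry maps formal adjoints to formal adjoints bijectively, so existence, uniqueness and
  the default value all correspond.\<close>

lemma bochner_laplacian_motion:
  fixes f h :: "'a \<Rightarrow> real ^ 'n"
  assumes R: "orthogonal_matrix R" and f: "f \<in> smooth_maps M" and h: "h \<in> smooth_maps M"
  shows "bochner_laplacian M (\<lambda>p. R *v f p + b) (\<lambda>p. R *v h p) = (\<lambda>p. R *v bochner_laplacian M f h p)"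
proof -
  let ?A = "is_cov_adjoint M f (cov_deriv h)"
  let ?A' = "is_cov_adjoint M (\<lambda>p. R *v f p + b) (cov_deriv (\<lambda>p. R *v h p))"
  obtain S where R': "orthogonal_matrix S" and S: "\<forall>x. S *v (R *v x) = x" "\<forall>x. R *v (S *v x) = x"
    by (rule orthogonal_matrix_inverse[OF R])
  note cancel = S[rule_format]
  have to: "?A' (\<lambda>p. R *v u p)" if "?A u" for u
    by (rule is_cov_adjoint_motion[OF R f h that])
  have from': "?A (\<lambda>p. S *v w p)" if "?A' w" for w
    using is_cov_adjoint_motion[OF R' smooth_maps_motion[OF f] smooth_maps_matrix[OF h] that, of "- (S *v b)"]
    by (simp add: cancel matrix_vector_right_distrib)
  have iff: "?A' w \<longleftrightarrow> ?A (\<lambda>p. S *v w p)" for w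
    using from'[of w] to[of "\<lambda>p. S *v w p"] by (auto simp: cancel)
  show ?thesis
  proof (cases "\<exists>!u. ?A u")
    case True
    define u where "u = (THE u. ?A u)"
    have u: "?A u" "\<And>w. ?A w \<Longrightarrow> w = u"
      using theI'[OF True] True unfolding u_def by blast+
    have A': "?A' (\<lambda>p. R *v u p)" by (rule to[OF u(1)])
    have uniq: "w = (\<lambda>p. R *v u p)" if "?A' w" for w
      using u(2)[OF from'[OF that]] by (metis (no_types, lifting) cancel(2) ext)
    have "\<exists>!w. ?A' w" using A' uniq by blast
    moreover have "(THE w. ?A' w) = (\<lambda>p. R *v u p)" using A' uniq by (rule the_equality)
    ultimately show ?thesis
      unfolding bochner_laplacian_def cov_adjoint_def if_P[OF True] by (simp only: if_True u_def)
  next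
    case False
    have "\<not> (\<exists>!w. ?A' w)"
    proof
      assume "\<exists>!w. ?A' w"
      then obtain w where w: "?A' w" "\<And>w'. ?A' w' \<Longrightarrow> w' = w" by blast
      have "u = (\<lambda>p. S *v w p)" if "?A u" for u
        using w(2)[OF to[OF that]] by (metis (no_types, lifting) cancel(1) ext)
      with from'[OF w(1)] have "\<exists>!u. ?A u" by blast
      with False show False by blast
    qed
    with False show ?thesis
      unfolding bochner_laplacian_def cov_adjoint_def by (simp only: if_False matrix_vector_mult_0_right)
  qed
qed

lemma motion_invariant_bochner_operator:
  "motion_invariant M (\<lambda>(f :: 'a \<Rightarrow> real ^ 'n) h x. h x + A *\<^sub>R ((bochner_laplacian M f ^^ p) h) x)"
  unfolding motion_invariant_def
proof (intro allI ballI impI)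
  fix R :: "real ^ 'n ^ 'n" and b and f h :: "'a \<Rightarrow> real ^ 'n"
  assume "rotation_matrix R" and "f \<in> Imm M" and h: "h \<in> smooth_maps M"
  then have R: "orthogonal_matrix R" and f: "f \<in> smooth_maps M"
    by (simp_all add: rotation_matrix_def Imm_def)
  have "(bochner_laplacian M f ^^ q) h \<in> smooth_maps M \<and>
      (bochner_laplacian M (\<lambda>p. R *v f p + b) ^^ q) (\<lambda>p. R *v h p)
        = (\<lambda>p. R *v (bochner_laplacian M f ^^ q) h p)" for q
    by (induction q) (simp_all add: h bochner_laplacian_smooth bochner_laplacian_motion[OF R f])
  then show "(\<lambda>x. R *v h x + A *\<^sub>R (bochner_laplacian M (\<lambda>p. R *v f p + b) ^^ p) (\<lambda>p. R *v h p) x)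
      = (\<lambda>x. R *v (h x + A *\<^sub>R (bochner_laplacian M f ^^ p) h x))"
    by (simp add: matrix_vector_right_distrib matrix_vector_mult_scaleR)
qed

end

section \<open>Screw motions\<close>

text \<open>This is \<open>exp(\<theta> J)\<close> when \<open>J\<^sup>3 = - J\<close>, for instance for the generator of the rotations in a plane
  (Rodrigues' formula). The screw motion in question is \<open>y \<mapsto> exp(\<theta> J) y + \<theta> e\<close> with \<open>J e = 0\<close>. Sine and
  cosine as the only coefficients keep the variations within the reach of elementary functions.\<close>

definition screw_rotation :: "real ^ 'n ^ 'n \<Rightarrow> real \<Rightarrow> real ^ 'n ^ 'n" where
  "screw_rotation J \<theta> = mat 1 + sin \<theta> *\<^sub>R J + (1 - cos \<theta>) *\<^sub>R (J ** J)"

lemma screw_rotation_apply: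
  "screw_rotation J \<theta> *v y = y + sin \<theta> *\<^sub>R (J *v y) + (1 - cos \<theta>) *\<^sub>R (J *v (J *v y))"
  by (simp add: screw_rotation_def matrix_vector_mult_add_rdistrib scaleR_matrix_vector_assoc[symmetric]
      matrix_vector_mul_assoc)

lemma screw_rotation_mult:
  fixes J :: "real ^ 'n ^ 'n"
  assumes J3: "\<And>y. J *v (J *v (J *v y)) = - (J *v y)"
  shows "screw_rotation J \<theta> ** screw_rotation J \<eta> = screw_rotation J (\<theta> + \<eta>)"
proof -
  have "screw_rotation J \<theta> *v (screw_rotation J \<eta> *v y) = screw_rotation J (\<theta> + \<eta>) *v y" for y
  proof -
    have "screw_rotation J \<theta> *v (screw_rotation J \<eta> *v y) = y
      + (sin \<theta> + sin \<eta> - sin \<theta> * (1 - cos \<eta>) - (1 - cos \<theta>) * sin \<eta>) *\<^sub>R (J *v y)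
      + (1 - cos \<theta> + (1 - cos \<eta>) + sin \<theta> * sin \<eta> - (1 - cos \<theta>) * (1 - cos \<eta>)) *\<^sub>R (J *v (J *v y))"
      unfolding screw_rotation_apply
      by (simp add: matrix_vector_right_distrib matrix_vector_mult_scaleR J3 algebra_simps
          vec.neg)
    also have "\<dots> = screw_rotation J (\<theta> + \<eta>) *v y"
      unfolding screw_rotation_apply sin_add cos_add
      by (simp add: algebra_simps)
    finally show ?thesis .
  qed
  then show ?thesis
    by (simp add: matrix_eq matrix_vector_mul_assoc[symmetric])
qed

lemma skew_inner:
  fixes J :: "real ^ 'n ^ 'n"
  assumes "transpose J = - J"
  shows "(J *v x) \<bullet> y = - (x \<bullet> (J *v y))"
proof -
  have "(J *v x) \<bullet> y = x \<bullet> (transpose J *v y)"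
    by (metis dot_lmul_matrix inner_commute transpose_matrix_vector)
  also have "transpose J *v y = - (J *v y)"
    unfolding assms by (simp add: matrix_vector_mult_def vec_eq_iff sum_negf)
  finally show ?thesis by simp
qed

text \<open>The determinant is \<open>1\<close> rather than \<open>-1\<close> because a rotation by \<open>\<theta>\<close> is the square of one by
  \<open>\<theta>/2\<close>.\<close>

lemma rotation_matrix_screw_rotation:
  fixes J :: "real ^ 'n ^ 'n"
  assumes skew: "transpose J = - J" and J3: "\<And>y. J *v (J *v (J *v y)) = - (J *v y)"
  shows "rotation_matrix (screw_rotation J \<theta>)"
proof -
  have one: "screw_rotation J 0 = mat 1"
    by (simp add: screw_rotation_def)
  have tr: "transpose (screw_rotation J \<theta>) = screw_rotation J (- \<theta>)" for \<theta>
  proof -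
    have "(screw_rotation J \<theta> *v x) \<bullet> y = x \<bullet> (screw_rotation J (- \<theta>) *v y)" for x y
      by (simp add: screw_rotation_apply inner_add_left inner_add_right inner_diff_left
        inner_diff_right skew_inner[OF skew])
    then have "x \<bullet> (transpose (screw_rotation J \<theta>) *v y) = x \<bullet> (screw_rotation J (- \<theta>) *v y)" for x y
      by (metis dot_lmul_matrix inner_commute transpose_matrix_vector)
    then show ?thesis
      by (simp add: matrix_eq vector_eq_rdot inner_commute del: transpose_matrix_vector)
        (metis inner_commute vector_eq_rdot)
  qed
  have orth: "orthogonal_matrix (screw_rotation J \<theta>)" for \<theta>
    unfolding orthogonal_matrix_def tr by (simp add: screw_rotation_mult[OF J3] one)
  have "det (screw_rotation J \<theta>) = det (screw_rotation J (\<theta> / 2)) * det (screw_rotation J (\<theta> / 2))"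
    by (metis det_mul screw_rotation_mult[OF J3] field_sum_of_halves)
  also have "\<dots> = 1"
    using det_orthogonal_matrix[OF orth[of "\<theta> / 2"]] by auto
  finally show ?thesis
    using orth by (simp add: rotation_matrix_def)
qed


section \<open>The fundamental lemma of the calculus of variations with polynomial test functions\<close>

lemma polynomial_antiderivative:
  assumes "real_polynomial_function (q :: real \<Rightarrow> real)"
  obtains Q where "real_polynomial_function Q" "\<And>t. (Q has_real_derivative q t) (at t)"
proof -
  obtain a n where q: "q = (\<lambda>x. \<Sum>i\<le>n. a i * x ^ i)"
    using assms by (auto simp: real_polynomial_function_iff_sum)
  define Q where "Q = (\<lambda>x :: real. \<Sum>i\<le>n. a i / real (Suc i) * x ^ Suc i)"
  show thesis
  proof (rule that[of Q])
    have "real_polynomial_function (\<lambda>x :: real. x ^ k)" for k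
      by (induction k) (auto intro: real_polynomial_function.intros(2)
          real_polynomial_function.intros(4)[OF real_polynomial_function.intros(1)[OF bounded_linear_ident]])
    then show "real_polynomial_function Q"
      unfolding Q_def
      by (intro real_polynomial_function_sum real_polynomial_function.intros(2,4)) (rule finite_atMost)
    have "((\<lambda>x. a i / real (Suc i) * x ^ Suc i) has_real_derivative a i * t ^ i) (at t)" for i t
      by (auto intro!: derivative_eq_intros simp del: of_nat_Suc power_Suc)
    then show "(Q has_real_derivative q t) (at t)" for t
      unfolding Q_def q by (intro DERIV_sum)
  qed
qed

text \<open>The lemma of du Bois-Reymond. A polynomial \<open>q\<close> minus its mean has an antiderivative that vanishes
  at both ends, so \<open>w\<close>, that is, \<open>m\<close> minus its mean, is orthogonal to all polynomials. Approximating \<open>w\<close>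
  by polynomials gives \<open>\<integral> w\<^sup>2 = 0\<close>.\<close>

lemma constant_if_orthogonal_to_derivatives:
  fixes m :: "real \<Rightarrow> real"
  assumes ab: "a < b" and m: "continuous_on {a..b} m"
    and orth: "\<And>q Q. real_polynomial_function q \<Longrightarrow> real_polynomial_function Q \<Longrightarrow>
      (\<And>t. (Q has_real_derivative q t) (at t)) \<Longrightarrow> Q a = 0 \<Longrightarrow> Q b = 0 \<Longrightarrow>
      integral {a..b} (\<lambda>t. q t * m t) = 0"
  shows "m a = m b"
proof -
  define \<mu> where "\<mu> = integral {a..b} m / (b - a)"
  define w where "w = (\<lambda>t. m t - \<mu>)"
  have w: "continuous_on {a..b} w"
    unfolding w_def by (intro continuous_intros m)
  have int_w: "integral {a..b} w = 0"
    unfolding w_def integral_diff[OF integrable_continuous_interval[OF m] integrable_const_ivl]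
    using ab by (simp add: \<mu>_def)
  have poly_cont: "continuous_on {a..b} q" if "real_polynomial_function q" for q :: "real \<Rightarrow> real"
    using that by (simp add: continuous_on_polymonial_function real_polynomial_function_eq)
  have poly: "integral {a..b} (\<lambda>t. w t * q t) = 0" if q: "real_polynomial_function q" for q
  proof -
    obtain Q where Q: "real_polynomial_function Q" "\<And>t. (Q has_real_derivative q t) (at t)"
      using polynomial_antiderivative[OF q] by blast
    define c where "c = (Q b - Q a) / (b - a)"
    have P: "real_polynomial_function (\<lambda>t. q t - c)"
        "real_polynomial_function (\<lambda>t. Q t - Q a - c * (t - a))"
      by (rule real_polynomial_function_diff real_polynomial_function.intros(2,4) q Q(1)
          real_polynomial_function.intros(1)[OF bounded_linear_ident])+
    have d: "((\<lambda>t. Q t - Q a - c * (t - a)) has_real_derivative q t - c) (at t)" for t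
      by (auto intro!: derivative_eq_intros Q(2))
    have 1: "integral {a..b} (\<lambda>t. (q t - c) * m t) = 0"
      by (rule orth[OF P d]) (use ab in \<open>simp_all add: c_def\<close>)
    have "((\<lambda>t. q t - c) has_integral (Q b - Q a - c * (b - a)) - (Q a - Q a - c * (a - a))) {a..b}"
      using ab by (intro fundamental_theorem_of_calculus)
        (auto simp: has_real_derivative_iff_has_vector_derivative[symmetric]
          intro: has_field_derivative_at_within[OF d])
    then have 2: "integral {a..b} (\<lambda>t. q t - c) = 0"
      using ab by (simp add: integral_unique c_def)
    have int: "(\<lambda>t. (q t - c) * m t) integrable_on {a..b}" "(\<lambda>t. \<mu> * (q t - c)) integrable_on {a..b}"
        "(\<lambda>t. c * w t) integrable_on {a..b}"
      by (intro integrable_continuous_interval continuous_intros m w poly_cont[OF q])+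
    have "integral {a..b} (\<lambda>t. w t * q t)
        = integral {a..b} (\<lambda>t. (q t - c) * m t - \<mu> * (q t - c) + c * w t)"
      by (intro integral_cong) (simp add: w_def algebra_simps)
    also have "\<dots> = integral {a..b} (\<lambda>t. (q t - c) * m t) - \<mu> * integral {a..b} (\<lambda>t. q t - c)
        + c * integral {a..b} w"
      by (simp only: integral_add[OF integrable_diff[OF int(1,2)] int(3)] integral_diff[OF int(1,2)]
          integral_mult_right)
    finally show ?thesis
      by (simp add: 1 2 int_w)
  qed
  \<comment> \<open>\<open>w\<^sup>2\<close> and \<open>w (w - q)\<close> have the same integral, and \<open>q\<close> can be chosen uniformly close to \<open>w\<close>.\<close>
  define N where "N = integral {a..b} (\<lambda>t. \<bar>w t\<bar>)"
  have N: "0 \<le> N"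
    unfolding N_def by (rule integral_nonneg[OF integrable_continuous_interval]) (use w in \<open>auto intro: continuous_intros\<close>)
  have le: "integral {a..b} (\<lambda>t. w t * w t) \<le> e * N" if e: "e > 0" for e
  proof -
    obtain q where q: "real_polynomial_function q" "\<And>t. t \<in> {a..b} \<Longrightarrow> \<bar>w t - q t\<bar> < e"
      using Stone_Weierstrass_real_polynomial_function[OF _ w e] by auto
    have int: "(\<lambda>t. w t * w t) integrable_on {a..b}" "(\<lambda>t. w t * q t) integrable_on {a..b}"
      "(\<lambda>t. e * \<bar>w t\<bar>) integrable_on {a..b}"
      by (intro integrable_continuous_interval continuous_intros w poly_cont[OF q(1)])+
    have "integral {a..b} (\<lambda>t. w t * w t) = integral {a..b} (\<lambda>t. w t * w t - w t * q t)"
      using int by (simp add: integral_diff poly[OF q(1)])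
    also have "\<dots> \<le> integral {a..b} (\<lambda>t. e * \<bar>w t\<bar>)"
    proof (rule integral_le[OF integrable_diff[OF int(1,2)] int(3)])
      fix t assume "t \<in> {a..b}"
      then have "\<bar>w t\<bar> * \<bar>w t - q t\<bar> \<le> \<bar>w t\<bar> * e"
        using q(2)[of t] by (intro mult_left_mono) auto
      moreover have "w t * (w t - q t) \<le> \<bar>w t\<bar> * \<bar>w t - q t\<bar>"
        by (metis abs_ge_self abs_mult)
      ultimately show "w t * w t - w t * q t \<le> e * \<bar>w t\<bar>"
        by (simp add: right_diff_distrib mult.commute)
    qed
    finally show ?thesis
      by (simp add: N_def)
  qed
  have "integral {a..b} (\<lambda>t. w t * w t) \<le> 0"
  proof (rule field_le_epsilon)
    fix e :: real assume e: "e > 0"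
    have "integral {a..b} (\<lambda>t. w t * w t) \<le> e / (N + 1) * N"
      using le[of "e / (N + 1)"] e N by simp
    also have "\<dots> \<le> e"
      using e N by (simp add: divide_le_eq)
    finally show "integral {a..b} (\<lambda>t. w t * w t) \<le> 0 + e" by simp
  qed
  moreover have "0 \<le> integral {a..b} (\<lambda>t. w t * w t)"
    by (rule integral_nonneg[OF integrable_continuous_interval]) (use w in \<open>auto intro: continuous_intros\<close>)
  ultimately have "integral {a..b} (\<lambda>t. w t * w t) = 0" by simp
  then have "\<forall>t\<in>{a..b}. w t * w t = 0"
    using integral_eq_0_iff[OF continuous_on_mult[OF w w] ab] by simp
  then show ?thesis
    using ab by (simp add: w_def)
qed

section \<open>Conservation of momentum\<close>

context closed_manifold
begin

lemma chart_continuous_inner: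
  fixes u w :: "'a \<Rightarrow> real ^ 'n"
  assumes "u \<in> smooth_maps M" "w \<in> smooth_maps M"
  shows "chart_continuous (\<lambda>p. u p \<bullet> w p)"
proof -
  have "in_chart c (\<lambda>p. u p \<bullet> w p) = (\<lambda>x. in_chart c u x \<bullet> in_chart c w x)" for c
    by (simp add: in_chart_def comp_def)
  then show ?thesis
    using assms[THEN chart_continuous_smooth]
    by (auto simp: chart_continuous_def intro!: continuous_on_inner)
qed

lemma vol_integral_inner_lincomb:
  fixes f u v w :: "'a \<Rightarrow> real ^ 'n"
  assumes "f \<in> smooth_maps M" "u \<in> smooth_maps M" "v \<in> smooth_maps M" "w \<in> smooth_maps M"
  shows "vol_integral M f (\<lambda>p. (u p + r *\<^sub>R v p) \<bullet> w p)
    = vol_integral M f (\<lambda>p. u p \<bullet> w p) + r * vol_integral M f (\<lambda>p. v p \<bullet> w p)"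
  using vol_integral_lincomb[OF assms(1) chart_continuous_inner[OF assms(2,4)]
      chart_continuous_inner[OF assms(3,4)] bounded_linear_ident bounded_linear_mult_right[of r]]
  by (simp add: inner_add_left)

lemma directional_derivative_pointwise:
  fixes f :: "real \<Rightarrow> 'a \<Rightarrow> 'b::real_normed_vector"
  assumes "directional_derivative M T f 1 t w"
  shows "((\<lambda>r. f r p) has_vector_derivative w p) (at t within T)"
proof -
  obtain c where c: "c \<in> atlas M" "p \<in> fst c"
    using ex_chart by blast
  let ?q = "\<lambda>r p. (f (t + r *\<^sub>R 1) p - f t p) /\<^sub>R r"
  have "uniform_limit (snd c ` {p}) (\<lambda>r. partial_derivs [] (in_chart c (?q r)))
      (partial_derivs [] (in_chart c w)) (at 0 within {r. t + r *\<^sub>R 1 \<in> T})"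
    using assms c unfolding directional_derivative_def smooth_limit_def
    by (elim ballE[of _ _ c] allE[of _ "{p}"] allE[of _ "[]"]) auto
  then have "((\<lambda>r. ?q r p) \<longlongrightarrow> w p) (at 0 within {r. t + r \<in> T})"
    using chart_homeo(4)[OF c] by (simp add: in_chart_def)
  moreover have "filterlim (\<lambda>z. z - t) (at 0 within {r. t + r \<in> T}) (at t within T)"
    unfolding filterlim_at by (auto simp: eventually_at_filter intro!: tendsto_eq_intros)
  ultimately have "((\<lambda>z. ?q (z - t) p) \<longlongrightarrow> w p) (at t within T)"
    by (rule filterlim_compose)
  then have lim: "((\<lambda>z. (f z p - f t p) /\<^sub>R (z - t)) \<longlongrightarrow> w p) (at t within T)"
    by simp
  have "((\<lambda>z. norm ((f z p - f t p) /\<^sub>R (z - t) - w p)) \<longlongrightarrow> 0) (at t within T)"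
    using tendsto_norm_zero[OF LIM_zero[OF lim]] .
  moreover have "\<forall>\<^sub>F z in at t within T. norm ((f z p - f t p) /\<^sub>R (z - t) - w p)
      = norm ((1 / norm (z - t)) *\<^sub>R (f z p - (f t p + (z - t) *\<^sub>R w p)))"
  proof -
    have "norm ((f z p - f t p) /\<^sub>R (z - t) - w p)
      = norm ((1 / norm (z - t)) *\<^sub>R (f z p - (f t p + (z - t) *\<^sub>R w p)))" if "z \<noteq> t" for z
    proof -
      have "(f z p - f t p) /\<^sub>R (z - t) - w p = (1 / (z - t)) *\<^sub>R (f z p - (f t p + (z - t) *\<^sub>R w p))"
        using that by (simp add: scaleR_diff_right scaleR_add_right divide_inverse)
      then show ?thesis by simp
    qed
    then show ?thesis
      by (simp add: eventually_at_filter)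
  qed
  ultimately have "((\<lambda>z. norm ((1 / norm (z - t)) *\<^sub>R (f z p - (f t p + (z - t) *\<^sub>R w p)))) \<longlongrightarrow> 0) (at t within T)"
    by (rule Lim_transform_eventually)
  then show ?thesis
    unfolding has_vector_derivative_def has_derivative_within
    by (intro conjI bounded_linear_scaleR_left) (rule tendsto_norm_zero_cancel)
qed

text \<open>Smoothness of \<open>P\<close> speaks about curves defined on the whole line. Running through \<open>[a, b]\<close> as
  \<open>(a + b)/2 + (b - a)/2 sin \<tau>\<close> produces such a curve, and \<open>arcsin\<close> undoes the reparametrisation
  continuously, up to and including the end points.\<close>

lemma continuous_on_momentum:
  fixes f h k :: "real \<Rightarrow> 'a \<Rightarrow> real ^ 'n" and P :: "('a, 'n) operator_field"
  assumes P: "smooth_section_L M P" and ab: "a < b"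
    and f: "smooth_into M {a..b} f" "\<And>t. t \<in> {a..b} \<Longrightarrow> f t \<in> Imm M"
    and h: "smooth_into M {a..b} h" and k: "smooth_into M {a..b} k"
  shows "continuous_on {a..b} (\<lambda>t. vol_integral M (f t) (\<lambda>p. P (f t) (h t) p \<bullet> k t p))"
proof -
  define \<rho> where "\<rho> = (\<lambda>\<tau>::real. (a + b) / 2 + (b - a) / 2 * sin \<tau>)"
  define \<sigma> where "\<sigma> = (\<lambda>t. arcsin ((2 * t - (a + b)) / (b - a)))"
  define T where "T = {- (pi / 2)..pi / 2}"
  have \<rho>_el: "elementary \<rho>"
    using elementary.add[OF elementary.const[of "(a + b) / 2"] elementary.mult[OF
        elementary.const[of "(b - a) / 2"] elementary.sin[OF elementary.inner[of "1 :: real"]]]]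
    unfolding \<rho>_def by (simp only: inner_real_def mult_1_right)
  have \<rho>_im: "\<rho> \<tau> \<in> {a..b}" for \<tau>
  proof -
    have "(b - a) / 2 * (-1) \<le> (b - a) / 2 * sin \<tau>" "(b - a) / 2 * sin \<tau> \<le> (b - a) / 2 * 1"
      using ab by (intro mult_left_mono; simp)+
    then show ?thesis
      unfolding \<rho>_def by (simp add: field_simps)
  qed
  have comp: "smooth_into M UNIV (\<lambda>\<tau>. u (\<rho> \<tau>))" if "smooth_into M {a..b} u"
    for u :: "real \<Rightarrow> 'a \<Rightarrow> real ^ 'n"
    using smooth_into_scale_comp[OF that elementary.const[of 1] \<rho>_el image_subsetI[of UNIV, OF \<rho>_im]] by simp
  define u where "u = (\<lambda>\<tau>. P (f (\<rho> \<tau>)) (h (\<rho> \<tau>)))"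
  have u: "smooth_into M UNIV u"
    using P comp[OF f(1)] comp[OF h] f(2)[OF \<rho>_im] unfolding smooth_section_L_def u_def by blast
  have sub: "smooth_into M T (\<lambda>\<tau>. f (\<rho> \<tau>))" "smooth_into M T u" "smooth_into M T (\<lambda>\<tau>. k (\<rho> \<tau>))"
    by (rule smooth_into_subset[OF comp[OF f(1)] subset_UNIV] smooth_into_subset[OF u subset_UNIV]
        smooth_into_subset[OF comp[OF k] subset_UNIV])+
  have "compact T"
    unfolding T_def by (rule compact_Icc)
  then have "continuous_on T (\<lambda>\<tau>. vol_integral M (f (\<rho> \<tau>)) (\<lambda>p. u \<tau> p \<bullet> k (\<rho> \<tau>) p))"
    by (rule continuous_on_vol_integral)
       (rule smooth_into_values[OF sub(1)] smooth_into_continuous[OF sub(1)]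
         smooth_into_values[OF sub(2)] smooth_into_continuous[OF sub(2)]
         smooth_into_values[OF sub(3)] smooth_into_continuous[OF sub(3)]; assumption)+
  moreover have \<sigma>_bd: "- 1 \<le> (2 * t - (a + b)) / (b - a)" "(2 * t - (a + b)) / (b - a) \<le> 1"
    if "t \<in> {a..b}" for t
    using that ab by (simp_all add: field_simps)
  have "continuous_on {a..b} \<sigma>"
    unfolding \<sigma>_def using ab \<sigma>_bd by (intro continuous_on_arcsin continuous_intros) auto
  moreover have "\<sigma> ` {a..b} \<subseteq> T"
    unfolding \<sigma>_def T_def using arcsin_bounded \<sigma>_bd by auto
  ultimately have cont: "continuous_on {a..b}
      (\<lambda>t. vol_integral M (f (\<rho> (\<sigma> t))) (\<lambda>p. u (\<sigma> t) p \<bullet> k (\<rho> (\<sigma> t)) p))"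
    by (rule continuous_on_compose2)
  have "\<rho> (\<sigma> t) = t" if "t \<in> {a..b}" for t
    using \<sigma>_bd[OF that] ab unfolding \<rho>_def \<sigma>_def by (simp add: field_simps)
  then show ?thesis
    by (intro continuous_on_eq[OF cont]) (simp add: u_def)
qed

lemma velocity_eq:
  fixes f :: "real \<Rightarrow> 'a \<Rightarrow> 'b::real_normed_vector"
  assumes "directional_derivative M I f 1 t w" "{a..b} \<subseteq> I" "a < b" "t \<in> {a..b}"
  shows "velocity I f t = w"
proof
  fix p
  have "t islimpt I"
    using assms by (intro islimpt_subset[OF _ assms(2)]) (simp add: islimpt_Icc)
  then show "velocity I f t p = w p"
    unfolding velocity_def
    by (intro vector_derivative_within directional_derivative_pointwise assms)
       (simp add: trivial_limit_within)
qed

text \<open>Move \<open>f\<close> by the one-parameter group of screw motions, run with the parameter \<open>s \<eta>(t)\<close>.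
  Invariance removes the motion from the energy except for the term that comes from differentiating
  \<open>\<eta>\<close>: the energy is a quadratic polynomial in \<open>s\<close>. Its linear coefficient is the integral below; the
  symmetry of \<open>P\<close> merges the two mixed terms.\<close>

lemma noether_integral:
  fixes P :: "('a, 'n::finite) operator_field" and J :: "real ^ 'n ^ 'n" and e :: "real ^ 'n"
  assumes P: "smooth_section_L M P"
    and sym: "\<And>f h k. f \<in> Imm M \<Longrightarrow> h \<in> smooth_maps M \<Longrightarrow> k \<in> smooth_maps M \<Longrightarrow>
      vol_integral M f (\<lambda>p. P f h p \<bullet> k p) = vol_integral M f (\<lambda>p. h p \<bullet> P f k p)"
    and inv: "motion_invariant M P"
    and J: "transpose J = - J" "\<And>y. J *v (J *v (J *v y)) = - (J *v y)" "J *v e = 0"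
    and geo: "geodesic M P I f" and ab: "a < b" "{a..b} \<subseteq> I"
    and w: "smooth_into M {a..b} w" "\<And>t. t \<in> {a..b} \<Longrightarrow> directional_derivative M {a..b} f 1 t (w t)"
    and \<eta>: "real_polynomial_function \<eta>" "\<And>t. (\<eta> has_real_derivative \<eta>' t) (at t)"
      "\<eta> a = 0" "\<eta> b = 0" "continuous_on {a..b} \<eta>'"
  shows "integral {a..b} (\<lambda>t. \<eta>' t * vol_integral M (f t) (\<lambda>p. P (f t) (w t) p \<bullet> (J *v f t p + e))) = 0"
proof -
  define \<Phi> where "\<Phi> = (\<lambda>\<theta> y. screw_rotation J \<theta> *v y + \<theta> *\<^sub>R e)"
  define F where "F = (\<lambda>(z :: real \<times> real) p. \<Phi> (fst z * \<eta> (snd z)) (f (snd z) p))"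
  define \<kappa> where "\<kappa> = (\<lambda>t p. J *v f t p + e)"
  have rot: "rotation_matrix (screw_rotation J \<theta>)" for \<theta>
    by (rule rotation_matrix_screw_rotation[OF J(1,2)])
  then have orth: "orthogonal_matrix (screw_rotation J \<theta>)" for \<theta>
    by (simp add: rotation_matrix_def)
  have f: "smooth_into M {a..b} f"
    using geo smooth_into_subset ab(2) unfolding geodesic_def by blast
  have imm: "f t \<in> Imm M" if "t \<in> {a..b}" for t
    using geo ab(2) that unfolding geodesic_def by blast
  have fs: "f t \<in> smooth_maps M" and ws: "w t \<in> smooth_maps M" if "t \<in> {a..b}" for t
    using smooth_into_values[OF f that] smooth_into_values[OF w(1) that] .
  have \<kappa>: "smooth_into M {a..b} \<kappa>"
    unfolding \<kappa>_def
    by (intro smooth_into_add smooth_into_const smooth_maps_const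
        smooth_into_linear[where L = "(*v) J", OF f matrix_vector_mul_bounded_linear])
  have \<kappa>s: "\<kappa> t \<in> smooth_maps M" if "t \<in> {a..b}" for t
    using smooth_into_values[OF \<kappa> that] .
  have PS: "P (f t) u \<in> smooth_maps M" if "t \<in> {a..b}" "u \<in> smooth_maps M" for t u
    using P imm[OF that(1)] that(2) unfolding smooth_section_L_def by blast

  \<comment> \<open>The motions are defined for all \<open>s\<close>, so any width of the variation would do.\<close>
  have "smooth_variation M a b f 1 F"
    unfolding smooth_variation_def
  proof (intro conjI ballI)
    let ?S = "{-1<..<1} \<times> {a..b} :: (real \<times> real) set"
    have el: "elementary (\<lambda>z :: real \<times> real. z \<bullet> (0, 1))" "elementary (\<lambda>z :: real \<times> real. z \<bullet> (1, 0))"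
      by (rule elementary.inner)+
    have el': "elementary (\<lambda>z. fst z * \<eta> (snd z))" and el_snd: "elementary (snd :: real \<times> real \<Rightarrow> real)"
      using elementary.mult[OF el(2) elementary_polynomial[OF \<eta>(1) el(1)]] el(1)
      by (simp_all add: inner_prod_def)
    have sm: "smooth_into M ?S (\<lambda>z p. g z *\<^sub>R u (snd z) p)"
      if "elementary g" "smooth_into M {a..b} u" for g and u :: "real \<Rightarrow> 'a \<Rightarrow> real ^ 'n"
      by (rule smooth_into_scale_comp[OF that(2,1) el_snd]) auto
    have Jf: "smooth_into M {a..b} (\<lambda>t p. J *v f t p)"
      by (rule smooth_into_linear[where L = "(*v) J", OF f matrix_vector_mul_bounded_linear])
    have JJf: "smooth_into M {a..b} (\<lambda>t p. J *v (J *v f t p))"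
      by (rule smooth_into_linear[where L = "(*v) J", OF Jf matrix_vector_mul_bounded_linear])
    have ce: "smooth_into M {a..b} (\<lambda>t p. e)"
      by (rule smooth_into_const[OF smooth_maps_const])
    have "smooth_into M ?S (\<lambda>z p. 1 *\<^sub>R f (snd z) p + sin (fst z * \<eta> (snd z)) *\<^sub>R (J *v f (snd z) p)
        + (1 - cos (fst z * \<eta> (snd z))) *\<^sub>R (J *v (J *v f (snd z) p)) + (fst z * \<eta> (snd z)) *\<^sub>R e)"
      by (rule smooth_into_add[OF smooth_into_add[OF smooth_into_add]] sm elementary.const
          elementary.sin elementary_diff elementary.cos el' f Jf JJf ce)+
    then show "smooth_into M ?S F"
      by (simp add: F_def \<Phi>_def screw_rotation_apply)
    show "F (s, t) \<in> Imm M" if "t \<in> {a..b}" for s t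
      unfolding F_def \<Phi>_def by (rule Imm_motion[OF orth]) (use imm[OF that] in simp)
    show "F (0, t) = f t" for t
      by (simp add: F_def \<Phi>_def screw_rotation_apply)
    show "F (s, a) = f a" "F (s, b) = f b" for s
      by (simp_all add: F_def \<Phi>_def screw_rotation_apply \<eta>)
  qed
  then have deriv0: "((\<lambda>s. energy M P a b (\<lambda>t. F (s, t))) has_real_derivative 0) (at 0)"
    using geo ab zero_less_one unfolding geodesic_def by blast

  \<comment> \<open>The generator commutes with its one-parameter group, so the derivative of the motion in its
    parameter is the linear part \<open>exp(\<theta> J)\<close> applied to the generating field \<open>\<kappa>\<close>.\<close>
  have vel: "velocity {a..b} (\<lambda>t. F (s, t)) t
      = (\<lambda>p. screw_rotation J (s * \<eta> t) *v (w t p + (s * \<eta>' t) *\<^sub>R \<kappa> t p))"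
    if t: "t \<in> {a..b}" for s t
  proof
    fix p
    let ?\<theta> = "\<lambda>t. s * \<eta> t"
    have d\<theta>: "(?\<theta> has_real_derivative s * \<eta>' t) (at t)"
      by (rule DERIV_cmult[OF \<eta>(2)])
    have df: "((\<lambda>r. f r p) has_vector_derivative w t p) (at t within {a..b})"
      by (rule directional_derivative_pointwise[OF w(2)[OF t]])
    note dJ = bounded_linear.has_vector_derivative[OF matrix_vector_mul_bounded_linear[of J]]
    have "((\<lambda>r. f r p + sin (?\<theta> r) *\<^sub>R (J *v f r p)
          + (1 - cos (?\<theta> r)) *\<^sub>R (J *v (J *v f r p)) + ?\<theta> r *\<^sub>R e) has_vector_derivative
        w t p + (sin (?\<theta> t) *\<^sub>R (J *v w t p) + (cos (?\<theta> t) * (s * \<eta>' t)) *\<^sub>R (J *v f t p))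
          + ((1 - cos (?\<theta> t)) *\<^sub>R (J *v (J *v w t p))
             + (0 - (- sin (?\<theta> t) * (s * \<eta>' t))) *\<^sub>R (J *v (J *v f t p)))
          + (?\<theta> t *\<^sub>R 0 + (s * \<eta>' t) *\<^sub>R e)) (at t within {a..b})"
      by (intro has_vector_derivative_add has_vector_derivative_scaleR df dJ[OF df] dJ[OF dJ[OF df]]
          has_vector_derivative_const DERIV_diff DERIV_const
          has_field_derivative_at_within[OF d\<theta>]
          has_field_derivative_at_within[OF DERIV_fun_sin[OF d\<theta>]]
          has_field_derivative_at_within[OF DERIV_fun_cos[OF d\<theta>]])
    moreover have "w t p + (sin (?\<theta> t) *\<^sub>R (J *v w t p) + (cos (?\<theta> t) * (s * \<eta>' t)) *\<^sub>R (J *v f t p))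
          + ((1 - cos (?\<theta> t)) *\<^sub>R (J *v (J *v w t p))
             + (0 - (- sin (?\<theta> t) * (s * \<eta>' t))) *\<^sub>R (J *v (J *v f t p)))
          + (?\<theta> t *\<^sub>R 0 + (s * \<eta>' t) *\<^sub>R e)
        = screw_rotation J (?\<theta> t) *v (w t p + (s * \<eta>' t) *\<^sub>R \<kappa> t p)"
      by (simp add: screw_rotation_apply \<kappa>_def matrix_vector_right_distrib matrix_vector_mult_scaleR
          J(2,3) algebra_simps)
    moreover have "F (s, r) p = f r p + sin (?\<theta> r) *\<^sub>R (J *v f r p)
          + (1 - cos (?\<theta> r)) *\<^sub>R (J *v (J *v f r p)) + ?\<theta> r *\<^sub>R e" for r
      by (simp add: F_def \<Phi>_def screw_rotation_apply)
    ultimately show "velocity {a..b} (\<lambda>t. F (s, t)) t p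
        = screw_rotation J (?\<theta> t) *v (w t p + (s * \<eta>' t) *\<^sub>R \<kappa> t p)"
      unfolding velocity_def using vector_derivative_within_cbox[OF ab(1), of t] t by simp
  qed

  define q where "q = (\<lambda>t u v. vol_integral M (f t) (\<lambda>p. P (f t) u p \<bullet> v p))"
  have metric: "sobolev_metric M P (F (s, t)) (velocity {a..b} (\<lambda>t. F (s, t)) t)
      (velocity {a..b} (\<lambda>t. F (s, t)) t)
      = q t (w t) (w t) + s * (2 * (\<eta>' t * q t (w t) (\<kappa> t))) + s\<^sup>2 * ((\<eta>' t)\<^sup>2 * q t (\<kappa> t) (\<kappa> t))"
    if t: "t \<in> {a..b}" for s t
  proof -
    let ?R = "screw_rotation J (s * \<eta> t)"
    define r where "r = s * \<eta>' t"
    define v where "v = (\<lambda>p. w t p + r *\<^sub>R \<kappa> t p)"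
    note s = fs[OF t] ws[OF t] \<kappa>s[OF t] PS[OF t ws[OF t]] PS[OF t \<kappa>s[OF t]]
    have v: "v \<in> smooth_maps M"
      unfolding v_def by (intro smooth_maps_add smooth_maps_scale s)
    have Fst: "F (s, t) = (\<lambda>p. ?R *v f t p + (s * \<eta> t) *\<^sub>R e)"
      by (simp add: F_def \<Phi>_def)
    have PF: "P (F (s, t)) (\<lambda>p. ?R *v v p) = (\<lambda>p. ?R *v P (f t) v p)"
      unfolding Fst using inv rot imm[OF t] v unfolding motion_invariant_def by blast
    have Pv: "P (f t) v = (\<lambda>p. P (f t) (w t) p + r *\<^sub>R P (f t) (\<kappa> t) p)"
    proof -
      have "\<forall>r s. P (f t) (\<lambda>p. r *\<^sub>R w t p + s *\<^sub>R \<kappa> t p)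
          = (\<lambda>p. r *\<^sub>R P (f t) (w t) p + s *\<^sub>R P (f t) (\<kappa> t) p)"
        using P imm[OF t] s(2,3) unfolding smooth_section_L_def by blast
      from this[rule_format, of 1 r] show ?thesis
        by (simp add: v_def)
    qed
    have vl: "velocity {a..b} (\<lambda>t. F (s, t)) t = (\<lambda>p. ?R *v v p)"
      using vel[OF t, of s] by (simp add: v_def r_def)
    have split: "vol_integral M (f t) (\<lambda>p. P (f t) u p \<bullet> v p) = q t u (w t) + r * q t u (\<kappa> t)"
      if "u \<in> smooth_maps M" for u
      using vol_integral_inner_lincomb[OF s(1-3) PS[OF t that], of r]
      by (simp add: q_def v_def inner_commute)
    have "sobolev_metric M P (F (s, t)) (velocity {a..b} (\<lambda>t. F (s, t)) t)
        (velocity {a..b} (\<lambda>t. F (s, t)) t) = vol_integral M (f t) (\<lambda>p. P (f t) v p \<bullet> v p)"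
      unfolding sobolev_metric_def vl PF unfolding Fst
      by (simp add: vol_integral_motion[OF orth s(1)] orthogonal_matrix_inner[OF orth])
    also have "\<dots> = vol_integral M (f t) (\<lambda>p. P (f t) (w t) p \<bullet> v p)
        + r * vol_integral M (f t) (\<lambda>p. P (f t) (\<kappa> t) p \<bullet> v p)"
      unfolding Pv by (rule vol_integral_inner_lincomb[OF s(1,4,5) v])
    also have "\<dots> = (q t (w t) (w t) + r * q t (w t) (\<kappa> t)) + r * (q t (\<kappa> t) (w t) + r * q t (\<kappa> t) (\<kappa> t))"
      by (simp only: split[OF s(2)] split[OF s(3)])
    also have "q t (\<kappa> t) (w t) = q t (w t) (\<kappa> t)"
      unfolding q_def using sym[OF imm[OF t] s(3,2)] by (simp add: inner_commute)
    finally show ?thesis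
      by (simp add: r_def algebra_simps power2_eq_square)
  qed

  have cont: "continuous_on {a..b} (\<lambda>t. q t (u t) (v t))"
    if "smooth_into M {a..b} u" "smooth_into M {a..b} v" for u v
    unfolding q_def by (rule continuous_on_momentum[OF P ab(1) f imm that])
  define c0 where "c0 = integral {a..b} (\<lambda>t. q t (w t) (w t))"
  define c1 where "c1 = integral {a..b} (\<lambda>t. \<eta>' t * q t (w t) (\<kappa> t))"
  define c2 where "c2 = integral {a..b} (\<lambda>t. (\<eta>' t)\<^sup>2 * q t (\<kappa> t) (\<kappa> t))"
  have energy: "energy M P a b (\<lambda>t. F (s, t)) = 1 / 2 * c0 + s * c1 + s\<^sup>2 * (1 / 2 * c2)" for s
  proof -
    have int: "(\<lambda>t. q t (w t) (w t)) integrable_on {a..b}"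
      "(\<lambda>t. s * (2 * (\<eta>' t * q t (w t) (\<kappa> t)))) integrable_on {a..b}"
      "(\<lambda>t. s\<^sup>2 * ((\<eta>' t)\<^sup>2 * q t (\<kappa> t) (\<kappa> t))) integrable_on {a..b}"
      by (intro integrable_continuous_interval continuous_on_mult continuous_on_const
          continuous_on_power \<eta> cont w(1) \<kappa>)+
    have "energy M P a b (\<lambda>t. F (s, t)) = 1 / 2 * integral {a..b} (\<lambda>t. q t (w t) (w t)
        + s * (2 * (\<eta>' t * q t (w t) (\<kappa> t))) + s\<^sup>2 * ((\<eta>' t)\<^sup>2 * q t (\<kappa> t) (\<kappa> t)))"
      unfolding energy_def by (intro arg_cong[where f = "(*) (1 / 2)"] integral_cong metric)
    also have "\<dots> = 1 / 2 * (c0 + s * (2 * c1) + s\<^sup>2 * c2)"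
      unfolding integral_add[OF integrable_add[OF int(1,2)] int(3)] integral_add[OF int(1,2)]
      by (simp add: c0_def c1_def c2_def)
    finally show ?thesis
      by (simp add: algebra_simps)
  qed
  have "((\<lambda>s. energy M P a b (\<lambda>t. F (s, t))) has_real_derivative c1) (at 0)"
    unfolding energy by (auto intro!: derivative_eq_intros)
  then have "c1 = 0"
    using deriv0 by (rule DERIV_unique)
  then show ?thesis
    by (simp add: c1_def q_def \<kappa>_def)
qed

end

lemma constant_onI:
  assumes "\<And>s t. s \<in> I \<Longrightarrow> t \<in> I \<Longrightarrow> g s = g t"
  shows "g constant_on I"
  using assms unfolding constant_on_def by (cases "I = {}") blast+

text \<open>The generator of the rotations in the \<open>(i, j)\<close> coordinate plane, as a bivector. Contracting
  with it picks out one component of the angular momentum.\<close>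

lemma wedge_axis_mult:
  fixes y :: "real ^ 'n"
  shows "wedge (axis i 1) (axis j 1) *v y = y $ j *\<^sub>R axis i 1 - y $ i *\<^sub>R axis j 1"
  by (simp add: vec_eq_iff matrix_vector_mult_def wedge_def axis_def left_diff_distrib sum_subtractf
      if_distrib[of "\<lambda>x. x * _"] if_distrib[of "\<lambda>x. _ * x"] cong: if_cong)

lemma wedge_axis_generator:
  fixes y :: "real ^ 'n"
  assumes "i \<noteq> j"
  shows "transpose (wedge (axis i 1 :: real ^ 'n) (axis j 1)) = - wedge (axis i 1) (axis j 1)"
    and "wedge (axis i 1) (axis j 1) *v (wedge (axis i 1) (axis j 1) *v
      (wedge (axis i 1) (axis j 1) *v y)) = - (wedge (axis i 1) (axis j 1) *v y)"
proof -
  show "transpose (wedge (axis i 1 :: real ^ 'n) (axis j 1)) = - wedge (axis i 1) (axis j 1)"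
    by (simp add: vec_eq_iff transpose_def wedge_def)
  show "wedge (axis i 1) (axis j 1) *v (wedge (axis i 1) (axis j 1) *v
      (wedge (axis i 1) (axis j 1) *v y)) = - (wedge (axis i 1) (axis j 1) *v y)"
    unfolding wedge_axis_mult using assms by (simp add: axis_def)
qed

lemma bounded_linear_bivector_dual:
  "bounded_linear (\<lambda>W. bivector_dual W X :: real)" for X :: "real ^ 'n ^ 'n"
proof -
  have "linear (\<lambda>W. bivector_dual W X)"
  proof (rule linearI)
    show "bivector_dual (V + W) X = bivector_dual V X + bivector_dual W X" for V W
      by (simp add: bivector_dual_def matrix_add_ldistrib trace_add add_divide_distrib)
    show "bivector_dual (r *\<^sub>R W) X = r *\<^sub>R bivector_dual W X" for r W
      by (simp add: bivector_dual_def trace_def matrix_matrix_mult_def sum_distrib_left mult.left_commute)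
  qed
  then show ?thesis
    by (simp add: linear_conv_bounded_linear)
qed

context closed_manifold
begin

lemma momentum_conserved:
  fixes P :: "('a, 'n::finite) operator_field" and J :: "real ^ 'n ^ 'n" and e :: "real ^ 'n"
  assumes P: "smooth_section_L M P"
    and sym: "\<And>f h k. f \<in> Imm M \<Longrightarrow> h \<in> smooth_maps M \<Longrightarrow> k \<in> smooth_maps M \<Longrightarrow>
      vol_integral M f (\<lambda>p. P f h p \<bullet> k p) = vol_integral M f (\<lambda>p. h p \<bullet> P f k p)"
    and inv: "motion_invariant M P"
    and J: "transpose J = - J" "\<And>y. J *v (J *v (J *v y)) = - (J *v y)" "J *v e = 0"
    and geo: "geodesic M P I f" and I: "is_interval I"
    and w: "smooth_into M I w" "\<And>t. t \<in> I \<Longrightarrow> directional_derivative M I f 1 t (w t)"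
    and ab: "a \<in> I" "b \<in> I"
  defines "m \<equiv> \<lambda>t. vol_integral M (f t) (\<lambda>p. P (f t) (w t) p \<bullet> (J *v f t p + e))"
  shows "m a = m b"
proof -
  have less: "m a = m b" if ab: "a \<in> I" "b \<in> I" "a < b" for a b
  proof (rule constant_if_orthogonal_to_derivatives[OF ab(3)])
    have sub: "{a..b} \<subseteq> I"
      using mem_is_interval_1_I[OF I ab(1,2)] by auto
    have f: "smooth_into M {a..b} f"
      using geo smooth_into_subset sub unfolding geodesic_def by blast
    have w1: "smooth_into M {a..b} w"
      by (rule smooth_into_subset[OF w(1) sub])
    have w2: "directional_derivative M {a..b} f 1 t (w t)" if "t \<in> {a..b}" for t
      by (rule directional_derivative_subset[OF w(2) sub]) (use that sub in blast)
    have k: "smooth_into M {a..b} (\<lambda>t p. J *v f t p + e)"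
      by (rule smooth_into_add[OF smooth_into_linear[where L = "(*v) J", OF f matrix_vector_mul_bounded_linear]
            smooth_into_const[OF smooth_maps_const]])
    have imm: "f t \<in> Imm M" if "t \<in> {a..b}" for t
      using geo sub that unfolding geodesic_def by blast
    show "continuous_on {a..b} m"
      unfolding m_def
      by (rule continuous_on_momentum[where P = P and h = w, OF P ab(3) f imm w1 k])
    fix q Q
    assume Q: "real_polynomial_function q" "real_polynomial_function Q"
      "\<And>t. (Q has_real_derivative q t) (at t)" "Q a = 0" "Q b = 0"
    have q: "continuous_on {a..b} q"
      using Q(1) by (simp add: continuous_on_polymonial_function real_polynomial_function_eq)
    show "integral {a..b} (\<lambda>t. q t * m t) = 0"
      unfolding m_def by (rule noether_integral[where \<eta> = Q and \<eta>' = q and P = P and J = J and e = e and w = w,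
            OF P sym inv J geo ab(3) sub w1 w2 Q(2) Q(3) Q(4) Q(5) q])
  qed
  show ?thesis
    using less[OF ab] less[OF ab(2,1)] by (metis linorder_neqE_linordered_idom)
qed

lemma chart_continuous_wedge:
  fixes u w :: "'a \<Rightarrow> real ^ 'n"
  assumes "u \<in> smooth_maps M" "w \<in> smooth_maps M"
  shows "chart_continuous (\<lambda>p. wedge (u p) (w p))"
  unfolding chart_continuous_def
proof
  fix c assume "c \<in> atlas M"
  then have "continuous_on (chart_image c) (in_chart c u)" "continuous_on (chart_image c) (in_chart c w)"
    using assms[THEN chart_continuous_smooth] by (auto simp: chart_continuous_def)
  then have "continuous_on (chart_image c) (\<lambda>x. wedge (in_chart c u x) (in_chart c w x))"
    unfolding wedge_def
    by (intro continuous_on_vec_lambda continuous_on_diff continuous_on_mult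
        bounded_linear.continuous_on[OF bounded_linear_vec_nth])
  then show "continuous_on (chart_image c) (in_chart c (\<lambda>p. wedge (u p) (w p)))"
    by (simp add: in_chart_def comp_def)
qed

lemma bivector_dual_vol_integral:
  fixes f u :: "'a \<Rightarrow> real ^ 'n"
  assumes "f \<in> smooth_maps M" "u \<in> smooth_maps M" "X \<in> so_algebra"
  shows "vol_integral M f (\<lambda>p. (X *v f p) \<bullet> u p)
    = bivector_dual (vol_integral M f (\<lambda>p. wedge (f p) (u p))) X"
  using vol_integral_linear[OF assms(1) chart_continuous_wedge[OF assms(1,2)]
      bounded_linear_bivector_dual[of X]]
  by (simp add: bivector_dual_wedge[OF assms(3)])

lemma geodesic_momenta_constant:
  fixes P :: "('a, 'n::finite) operator_field"
  assumes adm: "admissible_operator M P" and inv: "motion_invariant M P"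
    and I: "is_interval I" "interior I \<noteq> {}" and geo: "geodesic M P I f"
  shows "(\<lambda>t. vol_integral M (f t) (P (f t) (velocity I f t))) constant_on I"
    and "(\<lambda>t. vol_integral M (f t) (\<lambda>p. wedge (f t p) (P (f t) (velocity I f t) p))) constant_on I"
    and "\<And>t. t \<in> I \<Longrightarrow> f t \<in> smooth_maps M \<and> P (f t) (velocity I f t) \<in> smooth_maps M"
proof -
  have P: "smooth_section_L M P"
    and sym: "\<And>f h k. f \<in> Imm M \<Longrightarrow> h \<in> smooth_maps M \<Longrightarrow> k \<in> smooth_maps M \<Longrightarrow>
      vol_integral M f (\<lambda>p. P f h p \<bullet> k p) = vol_integral M f (\<lambda>p. h p \<bullet> P f k p)"
    using adm unfolding admissible_operator_def by blast+
  have f: "smooth_into M I f" and imm: "\<And>t. t \<in> I \<Longrightarrow> f t \<in> Imm M"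
    using geo unfolding geodesic_def by blast+
  obtain w where w: "smooth_into M I w" "\<And>t. t \<in> I \<Longrightarrow> directional_derivative M I f 1 t (w t)"
    using smooth_into_derivative[OF f, of 1] by auto
  have vel: "velocity I f t = w t" if t: "t \<in> I" for t
  proof -
    have "\<not> I \<subseteq> {t}"
      using I(2) interior_mono[of I "{t}"] by auto
    then obtain s where s: "s \<in> I" "s \<noteq> t" by blast
    have "{min s t..max s t} \<subseteq> I"
      using mem_is_interval_1_I[OF I(1) s(1) t] mem_is_interval_1_I[OF I(1) t s(1)]
      by (auto simp: min_def max_def split: if_splits)
    then show ?thesis
      by (rule velocity_eq[OF w(2)[OF t]]) (use s in auto)
  qed
  define u where "u = (\<lambda>t. P (f t) (w t))"
  have u: "P (f t) (velocity I f t) = u t" if "t \<in> I" for t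
    by (simp add: u_def vel[OF that])
  have fs: "f t \<in> smooth_maps M" and us: "u t \<in> smooth_maps M" if "t \<in> I" for t
  proof -
    show "f t \<in> smooth_maps M" by (rule smooth_into_values[OF f that])
    show "u t \<in> smooth_maps M"
      using P imm[OF that] smooth_into_values[OF w(1) that] unfolding smooth_section_L_def u_def by blast
  qed
  then show "f t \<in> smooth_maps M \<and> P (f t) (velocity I f t) \<in> smooth_maps M" if "t \<in> I" for t
    using u that by simp
  have conserved: "vol_integral M (f s) (\<lambda>p. u s p \<bullet> (J *v f s p + e))
      = vol_integral M (f t) (\<lambda>p. u t p \<bullet> (J *v f t p + e))"
    if "transpose J = - J" "\<And>y. J *v (J *v (J *v y)) = - (J *v y)" "J *v e = 0" "s \<in> I" "t \<in> I"
    for J :: "real ^ 'n ^ 'n" and e s t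
    unfolding u_def
    by (rule momentum_conserved[where P = P and J = J and e = e and w = w,
          OF P sym inv that(1) that(2) that(3) geo I(1) w(1) w(2) that(4) that(5)])

  have linear: "vol_integral M (f s) (u s) = vol_integral M (f t) (u t)" if st: "s \<in> I" "t \<in> I" for s t
  proof -
    have "vol_integral M (f s) (u s) \<bullet> e = vol_integral M (f t) (u t) \<bullet> e" for e
    proof -
      have lin: "vol_integral M (f t) (\<lambda>p. u t p \<bullet> e) = vol_integral M (f t) (u t) \<bullet> e"
        if "t \<in> I" for t
        by (rule vol_integral_linear[where L = "\<lambda>x. x \<bullet> e", OF fs[OF that]
              chart_continuous_smooth[OF us[OF that]] bounded_linear_inner_left])
      have zero: "transpose (0 :: real ^ 'n ^ 'n) = - 0"
        by (simp add: transpose_def vec_eq_iff)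
      show ?thesis
        using conserved[of 0 e s t, OF zero _ _ st] by (simp add: lin st)
    qed
    then show ?thesis
      using vector_eq_rdot by blast
  qed
  show "(\<lambda>t. vol_integral M (f t) (P (f t) (velocity I f t))) constant_on I"
  proof (rule constant_onI)
    fix s t assume st: "s \<in> I" "t \<in> I"
    show "vol_integral M (f s) (P (f s) (velocity I f s)) = vol_integral M (f t) (P (f t) (velocity I f t))"
      unfolding u[OF st(1)] u[OF st(2)] by (rule linear[OF st])
  qed

  have angular: "vol_integral M (f s) (\<lambda>p. wedge (f s p) (u s p)) $ i $ j
      = vol_integral M (f t) (\<lambda>p. wedge (f t p) (u t p)) $ i $ j" if st: "s \<in> I" "t \<in> I" for s t i j
  proof -
    let ?J = "wedge (axis i 1 :: real ^ 'n) (axis j 1)"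
    have comp: "vol_integral M (f t) (\<lambda>p. wedge (f t p) (u t p)) $ i $ j
        = - vol_integral M (f t) (\<lambda>p. u t p \<bullet> (?J *v f t p + 0))" if "t \<in> I" for t
    proof -
      have "bounded_linear (\<lambda>W :: real ^ 'n ^ 'n. W $ i $ j)"
        by (rule bounded_linear_compose[OF bounded_linear_vec_nth bounded_linear_vec_nth])
      from vol_integral_linear[OF fs[OF that] chart_continuous_wedge[OF fs[OF that] us[OF that]] this]
      have "vol_integral M (f t) (\<lambda>p. wedge (f t p) (u t p)) $ i $ j
          = vol_integral M (f t) (\<lambda>p. wedge (f t p) (u t p) $ i $ j)"
        by simp
      also have "\<dots> = vol_integral M (f t) (\<lambda>p. - (u t p \<bullet> (?J *v f t p + 0)))"
        unfolding wedge_axis_mult by (simp add: wedge_def inner_diff_right inner_axis mult.commute)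
      also have "\<dots> = - vol_integral M (f t) (\<lambda>p. u t p \<bullet> (?J *v f t p + 0))"
        by (rule vol_integral_linear[where L = uminus, OF fs[OF that] chart_continuous_inner[OF us[OF that]
                smooth_maps_motion[OF fs[OF that]]] bounded_linear_minus[OF bounded_linear_ident]])
      finally show ?thesis .
    qed
    have zero: "vol_integral M (f t) (\<lambda>p. 0 :: real) = 0" if "t \<in> I" for t
      using vol_integral_linear[where L = "\<lambda>x. 0 :: real", OF fs[OF that]
          chart_continuous_smooth[OF fs[OF that]] bounded_linear_zero] .
    show ?thesis
    proof (cases "i = j")
      case True
      then show ?thesis
        unfolding comp[OF st(1)] comp[OF st(2)] wedge_axis_mult by (simp add: zero st)
    next
      case False
      have "?J *v 0 = 0" by simp
      from conserved[of ?J 0 s t, OF wedge_axis_generator(1)[OF False] wedge_axis_generator(2)[OF False] this st]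
      show ?thesis
        unfolding comp[OF st(1)] comp[OF st(2)] by (simp only:)
    qed
  qed
  show "(\<lambda>t. vol_integral M (f t) (\<lambda>p. wedge (f t p) (P (f t) (velocity I f t) p))) constant_on I"
  proof (rule constant_onI)
    fix s t assume st: "s \<in> I" "t \<in> I"
    show "vol_integral M (f s) (\<lambda>p. wedge (f s p) (P (f s) (velocity I f s) p))
        = vol_integral M (f t) (\<lambda>p. wedge (f t p) (P (f t) (velocity I f t) p))"
      unfolding u[OF st(1)] u[OF st(2)] vec_eq_iff by (intro allI angular[OF st])
  qed
qed

end

theorem mainTheorem10:
  fixes M :: "'a::t2_space manifold"
  assumes "closed_connected_manifold M"
    and "mdim M \<le> CARD('n::finite)"
  shows
    "(\<forall>(P :: ('a, 'n) operator_field) I f.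
       admissible_operator M P \<and> motion_invariant M P \<and> is_interval I \<and> interior I \<noteq> {} \<and> geodesic M P I f \<longrightarrow>
         (\<lambda>t. vol_integral M (f t) (P (f t) (velocity I f t))) constant_on I \<and>
         (\<forall>X\<in>so_algebra.
            (\<lambda>t. vol_integral M (f t) (\<lambda>p. (X *v f t p) \<bullet> P (f t) (velocity I f t) p)) constant_on I) \<and>
         (\<lambda>t. vol_integral M (f t) (\<lambda>p. wedge (f t p) (P (f t) (velocity I f t) p))) constant_on I \<and>
         (\<forall>t\<in>I. \<forall>X\<in>so_algebra.
            vol_integral M (f t) (\<lambda>p. (X *v f t p) \<bullet> P (f t) (velocity I f t) p)
              = bivector_dual
                  (vol_integral M (f t) (\<lambda>p. wedge (f t p) (P (f t) (velocity I f t) p))) X)) \<and>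
     (\<forall>A>0. \<forall>p :: nat.
       motion_invariant M
         (\<lambda>(f :: 'a \<Rightarrow> real ^ 'n) h x. h x + A *\<^sub>R ((bochner_laplacian M f ^^ p) h) x))"
proof -
  interpret closed_manifold M
    by standard (rule assms(1))
  show ?thesis
  proof (intro conjI allI impI)
    fix P :: "('a, 'n) operator_field" and I f
    assume "admissible_operator M P \<and> motion_invariant M P \<and> is_interval I \<and> interior I \<noteq> {} \<and>
      geodesic M P I f"
    then have "admissible_operator M P" "motion_invariant M P" "is_interval I" "interior I \<noteq> {}"
        "geodesic M P I f"
      by blast+
    note momenta = geodesic_momenta_constant[OF this]
    show "(\<lambda>t. vol_integral M (f t) (P (f t) (velocity I f t))) constant_on I"
      by (rule momenta(1))
    show wedge: "(\<lambda>t. vol_integral M (f t) (\<lambda>p. wedge (f t p) (P (f t) (velocity I f t) p))) constant_on I"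
      by (rule momenta(2))
    show dual: "\<forall>t\<in>I. \<forall>X\<in>so_algebra.
        vol_integral M (f t) (\<lambda>p. (X *v f t p) \<bullet> P (f t) (velocity I f t) p)
          = bivector_dual (vol_integral M (f t) (\<lambda>p. wedge (f t p) (P (f t) (velocity I f t) p))) X"
      using bivector_dual_vol_integral[OF conjunct1[OF momenta(3)] conjunct2[OF momenta(3)]]
      by (intro ballI)
    show "\<forall>X\<in>so_algebra.
        (\<lambda>t. vol_integral M (f t) (\<lambda>p. (X *v f t p) \<bullet> P (f t) (velocity I f t) p)) constant_on I"
    proof
      fix X :: "real ^ 'n ^ 'n"
      assume X: "X \<in> so_algebra"
      obtain W where W: "\<forall>t\<in>I. vol_integral M (f t) (\<lambda>p. wedge (f t p) (P (f t) (velocity I f t) p)) = W"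
        using wedge unfolding constant_on_def by (elim exE)
      have "vol_integral M (f t) (\<lambda>p. (X *v f t p) \<bullet> P (f t) (velocity I f t) p) = bivector_dual W X"
        if "t \<in> I" for t
        unfolding bspec[OF bspec[OF dual that] X] bspec[OF W that] by (rule refl)
      then show "(\<lambda>t. vol_integral M (f t) (\<lambda>p. (X *v f t p) \<bullet> P (f t) (velocity I f t) p)) constant_on I"
        unfolding constant_on_def by (intro exI ballI)
    qed
  qed (rule motion_invariant_bochner_operator)
qed

end
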